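(* Let $I=[0,T]$ with $T>0$, let $F\colon I\times\mathbb{R}^N\multimap\mathbb{R}^N$ be a Carathéodory map, and suppose there exists a monotone coercive strictly negatively guiding potential $V\colon\mathbb{R}^N\to\mathbb{R}$ for $F$. Let $R>0$ be such that for all $|x|\geqslant R$ one has $\nabla V(x)\neq 0$ and $\langle\nabla V(x),F(t,x)\rangle^+<0$ for every $t\in I$; and let $r>\max\{V(x)\colon|x|\leqslant R\}$. Let $g\colon C(I,\mathbb{R}^N)\to\mathbb{R}^N$ be a continuous function which maps bounded sets into bounded sets and satisfies: (i) for every $x\in AC(I,\mathbb{R}^N)$: if $x(0)=g(x)$, then there exists $t\in(0,T]$ such that $|g(x)|\leqslant|x(t)|$; (ii) $|g(i(x))|\leqslant|x|$ for all $x\in V^{-1}(\{r\})$; (iii) $g(i(x))\neq x$ for all $x\in V^{-1}(\{r\})$. Then the set of all solutions $x\in AC(I,\mathbb{R}^N)$ of the nonlocal initial value problem $$\dot{x}(t)\in F(t,x(t))\ \text{ for a.e. } t\in I,\qquad x(0)=g(x)$$ is nonempty and compact as a subset of $C(I,\mathbb{R}^N)$.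
   Context: $C(I,\mathbb{R}^N)$ is the Banach space of continuous maps with the maximum norm $\|\cdot\|$; $AC(I,\mathbb{R}^N)$ is its subspace of absolutely continuous functions. $|\cdot|$ and $\langle\cdot,\cdot\rangle$ are the Euclidean norm and inner product in $\mathbb{R}^N$. The map $i\colon\mathbb{R}^N\to C(I,\mathbb{R}^N)$ sends $x_0$ to the constant function $i(x_0)(t)=x_0$. For $a\in\mathbb{R}^N$ and a nonempty compact $B\subset\mathbb{R}^N$, $\langle a,B\rangle^+=\sup\{\langle a,b\rangle\colon b\in B\}$. A multivalued map $F\colon X\multimap Z$ assigns to each $x\in X$ a nonempty subset $F(x)\subset Z$. Carathéodory map: $F\colon I\times\mathbb{R}^N\multimap\mathbb{R}^N$ with nonempty convex compact values such that ($F_1$) for every fixed $x\in\mathbb{R}^N$ the multimap $t\mapsto F(t,x)$ is measurable, i.e. $\{t\in I\colon F(t,x)\subset A\}$ is Lebesgue measurable for every closed $A\subset\mathbb{R}^N$; ($F_2$) for a.e. $t\in I$ the multimap $x\mapsto F(t,x)$ is upper semicontinuous; ($F_3$) there is $\mu\in L^1(I,\mathbb{R})$ with $\sup\{|y|\colon y\in F(t,x)\}\leqslant\mu(t)(1+|x|)$ for every $(t,x)\in I\times\mathbb{R}^N$. $V$ is monotone if $|x|\leqslant|y|$ implies $V(x)\leqslant V(y)$ for all $x,y\in\mathbb{R}^N$. $V$ is coercive if $V(x)\to+\infty$ as $|x|\to+\infty$. Strictly negatively guiding potential for $F$: $V\in C^1(\mathbb{R}^N,\mathbb{R})$ which is nonsingular,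 i.e. there is $R>0$ with $\nabla V(x)\neq 0$ for all $|x|\geqslant R$, and such that there is $R>0$ such that $\langle\nabla V(x),F(t,x)\rangle^+<0$ for all $|x|\geqslant R$ and all $t\in I$. *)

theory Defs
  imports "HOL-Analysis.Analysis"
begin

text \<open>
  \<open>I = {0..T}\<close> throughout. Elements of \<open>C(I, \<real>\<^sup>N)\<close> are represented as functions on \<open>\<real>\<close> that are
  continuous on \<open>I\<close> and \<open>undefined\<close> outside it, so that equality of functions is equality on \<open>I\<close>,
  and the distance is the maximum distance over \<open>I\<close>.
\<close>

definition CI :: "real \<Rightarrow> (real \<Rightarrow> real ^ 'n) metric" where
  "CI T = cfunspace (top_of_set {0..T}) euclidean_metric"

definition const_fun :: "real \<Rightarrow> real ^ 'n \<Rightarrow> (real \<Rightarrow> real ^ 'n)" where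
  "const_fun T x0 = restrict (\<lambda>t. x0) {0..T}"

text \<open>
  The finite families of non-overlapping subintervals of \<open>S\<close> are the divisions of subsets of \<open>S\<close>;
  a member \<open>k\<close> is the compact interval from \<open>Inf k\<close> to \<open>Sup k\<close>.
\<close>

definition abs_continuous_on :: "real set \<Rightarrow> (real \<Rightarrow> 'a::real_normed_vector) \<Rightarrow> bool" where
  "abs_continuous_on S f \<longleftrightarrow>
     (\<forall>\<epsilon>>0. \<exists>\<delta>>0. \<forall>d E. d division_of E \<and> E \<subseteq> S \<and> (\<Sum>k\<in>d. Sup k - Inf k) < \<delta> \<longrightarrow>
        (\<Sum>k\<in>d. norm (f (Sup k) - f (Inf k))) < \<epsilon>)"

definition ACI :: "real \<Rightarrow> (real \<Rightarrow> real ^ 'n) set" where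
  "ACI T = {x \<in> mspace (CI T). abs_continuous_on {0..T} x}"

definition inner_plus :: "real ^ 'n \<Rightarrow> (real ^ 'n) set \<Rightarrow> real" where
  "inner_plus a B = Sup ((\<lambda>b. a \<bullet> b) ` B)"

definition usc_multimap :: "('a::topological_space \<Rightarrow> 'b::topological_space set) \<Rightarrow> bool" where
  "usc_multimap \<Phi> \<longleftrightarrow> (\<forall>U. open U \<longrightarrow> open {x. \<Phi> x \<subseteq> U})"

definition caratheodory_map :: "real \<Rightarrow> (real \<Rightarrow> real ^ 'n \<Rightarrow> (real ^ 'n) set) \<Rightarrow> bool" where
  "caratheodory_map T F \<longleftrightarrow>
     (\<forall>t\<in>{0..T}. \<forall>x. F t x \<noteq> {} \<and> convex (F t x) \<and> compact (F t x)) \<and>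
     (\<forall>x A. closed A \<longrightarrow> {t \<in> {0..T}. F t x \<subseteq> A} \<in> sets lebesgue) \<and>
     (AE t in lebesgue_on {0..T}. usc_multimap (F t)) \<and>
     (\<exists>\<mu>. integrable (lebesgue_on {0..T}) \<mu> \<and>
        (\<forall>t\<in>{0..T}. \<forall>x. Sup (norm ` F t x) \<le> \<mu> t * (1 + norm x)))"

definition grad :: "(real ^ 'n \<Rightarrow> real) \<Rightarrow> real ^ 'n \<Rightarrow> real ^ 'n" where
  "grad V x = (THE D. GDERIV V x :> D)"

lemma grad_eqI:
  assumes "GDERIV V x :> D"
  shows "grad V x = D"
proof -
  have "E = D" if "GDERIV V x :> E" for E
  proof -
    have "(\<lambda>h. h \<bullet> E) = (\<lambda>h. h \<bullet> D)"
      using that assms unfolding gderiv_def by (rule has_derivative_unique)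
    then show "E = D"
      using vector_eq_ldot[of E D] by (simp add: fun_eq_iff)
  qed
  with assms show ?thesis
    unfolding grad_def by (rule the_equality)
qed

definition C1_fun :: "(real ^ 'n \<Rightarrow> real) \<Rightarrow> bool" where
  "C1_fun V \<longleftrightarrow> (\<forall>x. V differentiable (at x)) \<and> continuous_on UNIV (grad V)"

definition monotone_potential :: "(real ^ 'n \<Rightarrow> real) \<Rightarrow> bool" where
  "monotone_potential V \<longleftrightarrow> (\<forall>x y. norm x \<le> norm y \<longrightarrow> V x \<le> V y)"

definition coercive :: "(real ^ 'n \<Rightarrow> real) \<Rightarrow> bool" where
  "coercive V \<longleftrightarrow> filterlim V at_top at_infinity"

definition strictly_neg_guiding ::
    "real \<Rightarrow> (real ^ 'n \<Rightarrow> real) \<Rightarrow> (real \<Rightarrow> real ^ 'n \<Rightarrow> (real ^ 'n) set) \<Rightarrow> bool" where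
  "strictly_neg_guiding T V F \<longleftrightarrow>
     C1_fun V \<and>
     (\<exists>R>0. \<forall>x. norm x \<ge> R \<longrightarrow> grad V x \<noteq> 0) \<and>
     (\<exists>R>0. \<forall>x. norm x \<ge> R \<longrightarrow> (\<forall>t\<in>{0..T}. inner_plus (grad V x) (F t x) < 0))"

definition solution_set ::
    "real \<Rightarrow> (real \<Rightarrow> real ^ 'n \<Rightarrow> (real ^ 'n) set) \<Rightarrow> ((real \<Rightarrow> real ^ 'n) \<Rightarrow> real ^ 'n)
      \<Rightarrow> (real \<Rightarrow> real ^ 'n) set" where
  "solution_set T F g =
     {x \<in> ACI T.
        (AE t in lebesgue_on {0..T}.
           \<exists>v \<in> F t (x t). (x has_vector_derivative v) (at t within {0..T})) \<and>
        x 0 = g x}"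

end

theory Submission
  imports Defs "HOL-Complex_Analysis.Great_Picard"
begin

text \<open>
  A monotone potential depends only on \<open>|x|\<close>, so \<open>V = r\<close> contains a sphere of some radius \<open>\<rho> > R\<close> and
  \<open>x \<bullet> v < 0\<close> for \<open>v \<in> F t x\<close>, \<open>|x| \<ge> R\<close>. Hence \<open>|x|\<close> decreases strictly along solutions outside the
  ball of radius \<open>R\<close>, and condition (i) confines every solution of \<open>x' \<in> l F(t, x)\<close>, \<open>x(0) = g(x)\<close>,
  \<open>0 < l \<le> 1\<close>, to that ball.

  For existence, \<open>F\<close> is replaced by \<open>\<Sum>y. w y x *\<^sub>R f y t\<close> with a finite partition of unity \<open>w\<close> and
  measurable selections \<open>f y\<close> of \<open>F(\<cdot>, y)\<close>, and solutions by Euler polygons, which depend continuously on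
  \<open>l\<close> and on the initial value. The problem becomes a fixed point problem in \<open>\<real>\<^sup>N\<close>, solved by Brouwer's
  theorem along the homotopy \<open>0 \<leadsto> g(i(x)) \<leadsto> g(E(l, x))\<close>: either \<open>l = 1\<close> is reached, or there is a solution
  with \<open>l \<in> (0, 1)\<close> starting on the sphere of radius \<open>\<rho>\<close>. By Arzela-Ascoli the polygons converge to a
  solution of the inclusion, and in the limit the second case contradicts the a priori bound (\<open>l > 0\<close>) or
  condition (iii) (\<open>l = 0\<close>). The same passage to the limit gives compactness.
\<close>

section \<open>Absolutely continuous functions on an interval\<close>

text \<open>Two obstacles shape the proof. For a right-hand side that is merely continuous in the
  state there is no single-valued solution map, so a homotopy in the initial value cannot be run on
  exact solutions. Euler polygons give an explicit curve for every parameter and starting point. But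
  they evaluate \<open>F\<close> at delayed and displaced states, so the inward inequality need not
  hold for them and the a priori bound is out of reach before the limit. Hence the alternative
  "homotopy parameter 1, or start on the sphere" is carried along the whole sequence and decided
  only for the limit curve.

  The limit curve must be differentiable almost everywhere, with derivative in \<open>F\<close>.
  Uniform convergence alone gives neither; both rest on one fixed integrable function that bounds
  all speeds. To make this bound independent of the curve, states are first retracted onto the ball
  of radius \<rho>, which turns the linear growth condition into the bound \<open>rate\<close>. The
  retraction is radial, so it keeps the sign in the inward inequality, and curves that stay in the
  ball are unaffected.\<close>

lemma integral_small_on_small_divisions:
  fixes m :: "real \<Rightarrow> real"
  assumes m: "m integrable_on {a..b}" and nonneg: "\<And>t. t \<in> {a..b} \<Longrightarrow> 0 \<le> m t" and "\<epsilon> > 0"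
  obtains \<delta> where "\<delta> > 0"
    "\<And>d E. \<lbrakk>d division_of E; E \<subseteq> {a..b}; (\<Sum>k\<in>d. Sup k - Inf k) < \<delta>\<rbrakk> \<Longrightarrow> (\<Sum>k\<in>d. integral k m) < \<epsilon>"
proof -
  \<comment> \<open>Cutting \<open>m\<close> off at height n: by dominated convergence the part
    above n has small integral over all of \<open>{a..b}\<close>, and the part below contributes at
    most n times the total length.\<close>
  define c where "c = (\<lambda>n::nat. \<lambda>t. min (m t) (real n))"
  have m_abs: "m absolutely_integrable_on {a..b}"
    using m nonneg by (simp only: absolutely_integrable_on_iff_nonneg)
  have c_int: "c n integrable_on {a..b}" for n
    unfolding c_def
    by (rule set_lebesgue_integral_eq_integral(1)
        [OF absolutely_integrable_min_1[OF m_abs absolutely_integrable_continuous_real[OF continuous_on_const]]])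
  have "(\<lambda>n. integral {a..b} (c n)) \<longlonglongrightarrow> integral {a..b} m"
  proof (rule dominated_convergence(2)[OF c_int m])
    show "norm (c n t) \<le> m t" if "t \<in> {a..b}" for n t
      using nonneg[OF that] by (auto simp: c_def)
    show "(\<lambda>n. c n t) \<longlonglongrightarrow> m t" for t
    proof (rule tendsto_eventually)
      obtain N :: nat where "m t \<le> real N"
        using real_arch_simple by blast
      then show "eventually (\<lambda>n. c n t = m t) sequentially"
        unfolding c_def by (intro eventually_sequentiallyI[of N]) auto
    qed
  qed
  then have "eventually (\<lambda>n. dist (integral {a..b} (c n)) (integral {a..b} m) < \<epsilon> / 2) sequentially"
    using \<open>\<epsilon> > 0\<close> by (intro tendstoD) auto
  then obtain n where n: "dist (integral {a..b} (c n)) (integral {a..b} m) < \<epsilon> / 2"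
    by (auto simp: eventually_sequentially)
  have diff_int: "(\<lambda>t. m t - c n t) integrable_on {a..b}"
    by (intro integrable_diff m c_int)
  show thesis
  proof
    \<comment> \<open>The summand 1 keeps the quotient meaningful when the cut-off height n is
      0.\<close>
    show "\<epsilon> / (2 * (real n + 1)) > 0"
      using \<open>\<epsilon> > 0\<close> by auto
    fix d E
    assume d: "d division_of E" and E: "E \<subseteq> {a..b}" and len: "(\<Sum>k\<in>d. Sup k - Inf k) < \<epsilon> / (2 * (real n + 1))"
    have k_sub: "k \<subseteq> {a..b}" "k \<noteq> {}" if "k \<in> d" for k
      using division_ofD(2,3)[OF d that] E by auto
    have k_int: "f integrable_on k" if "k \<in> d" "f integrable_on {a..b}" for k and f :: "real \<Rightarrow> real"
      using division_ofD(4)[OF d that(1)] k_sub[OF that(1)] that(2)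
      by (metis box_real(2) integrable_on_subcbox)
    have E_int: "(\<lambda>t. m t - c n t) integrable_on E"
      by (metis box_real(2) diff_int d E integrable_on_subdivision)
    have "integral k m \<le> integral k (\<lambda>t. m t - c n t) + real n * (Sup k - Inf k)" if k: "k \<in> d" for k
    proof -
      obtain u v where uv: "k = {u..v}" "u \<le> v"
        using division_ofD(4)[OF d k] k_sub[OF k] by (metis atLeastatMost_empty_iff box_real(2))
      have "integral k (c n) \<le> integral k (\<lambda>t. real n)"
        by (rule integral_le[OF k_int[OF k c_int] k_int[OF k integrable_const_ivl]]) (simp add: c_def)
      also have "\<dots> = real n * (Sup k - Inf k)"
        using uv by simp
      finally have "integral k (c n) \<le> real n * (Sup k - Inf k)" .
      moreover have "integral k (\<lambda>t. m t - c n t) = integral k m - integral k (c n)"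
        by (rule integral_diff[OF k_int[OF k m] k_int[OF k c_int]])
      ultimately show ?thesis by simp
    qed
    then have "(\<Sum>k\<in>d. integral k m) \<le> (\<Sum>k\<in>d. integral k (\<lambda>t. m t - c n t) + real n * (Sup k - Inf k))"
      by (rule sum_mono)
    also have "\<dots> = integral E (\<lambda>t. m t - c n t) + real n * (\<Sum>k\<in>d. Sup k - Inf k)"
      by (simp add: sum.distrib sum_distrib_left integral_combine_division_topdown[OF E_int d])
    also have "integral E (\<lambda>t. m t - c n t) \<le> integral {a..b} (\<lambda>t. m t - c n t)"
      by (rule integral_subset_le[OF E E_int diff_int]) (auto simp: c_def)
    also have "integral {a..b} (\<lambda>t. m t - c n t) = integral {a..b} m - integral {a..b} (c n)"
      by (intro integral_diff m c_int)
    also have "\<dots> < \<epsilon> / 2"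
      using n unfolding dist_real_def by linarith
    also have "real n * (\<Sum>k\<in>d. Sup k - Inf k) \<le> (real n + 1) * (\<epsilon> / (2 * (real n + 1)))"
    proof (rule mult_mono)
      show "0 \<le> (\<Sum>k\<in>d. Sup k - Inf k)"
        by (intro sum_nonneg) (metis atLeastatMost_empty_iff box_real(2) d cInf_atLeastAtMost
            cSup_atLeastAtMost diff_ge_0_iff_ge division_ofD(4) k_sub(2))
    qed (use len in auto)
    also have "(real n + 1) * (\<epsilon> / (2 * (real n + 1))) = \<epsilon> / 2"
      by (simp add: field_simps add_eq_0_iff)
    finally show "(\<Sum>k\<in>d. integral k m) < \<epsilon>"
      by simp
  qed
qed

text \<open>Domination of increments by the integral of one fixed \<open>m\<close> is the working
  form of absolute continuity throughout: unlike the latter, it passes to pointwise limits.\<close>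

lemma abs_continuous_on_dominated:
  fixes x :: "real \<Rightarrow> 'a::real_normed_vector"
  assumes m: "m integrable_on {a..b}" "\<And>t. t \<in> {a..b} \<Longrightarrow> 0 \<le> m t"
    and x: "\<And>s t. \<lbrakk>a \<le> s; s \<le> t; t \<le> b\<rbrakk> \<Longrightarrow> norm (x t - x s) \<le> integral {s..t} m"
  shows "abs_continuous_on {a..b} x"
  unfolding abs_continuous_on_def
proof (intro allI impI)
  fix \<epsilon> :: real assume "\<epsilon> > 0"
  with m obtain \<delta> where "\<delta> > 0"
    and \<delta>: "\<And>d E. \<lbrakk>d division_of E; E \<subseteq> {a..b}; (\<Sum>k\<in>d. Sup k - Inf k) < \<delta>\<rbrakk> \<Longrightarrow> (\<Sum>k\<in>d. integral k m) < \<epsilon>"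
    using integral_small_on_small_divisions[of m a b \<epsilon>] by blast
  have "(\<Sum>k\<in>d. norm (x (Sup k) - x (Inf k))) < \<epsilon>"
    if d: "d division_of E" and E: "E \<subseteq> {a..b}" and len: "(\<Sum>k\<in>d. Sup k - Inf k) < \<delta>" for d E
  proof -
    have "norm (x (Sup k) - x (Inf k)) \<le> integral k m" if k: "k \<in> d" for k
    proof -
      obtain u v where "k = {u..v}" "u \<le> v"
        using division_ofD(3,4)[OF d k] by (metis atLeastatMost_empty_iff box_real(2))
      moreover have "k \<subseteq> {a..b}"
        using division_ofD(2)[OF d k] E by blast
      ultimately show ?thesis
        using x[of u v] by auto
    qed
    then have "(\<Sum>k\<in>d. norm (x (Sup k) - x (Inf k))) \<le> (\<Sum>k\<in>d. integral k m)"
      by (rule sum_mono)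
    also have "\<dots> < \<epsilon>"
      by (rule \<delta>[OF d E len])
    finally show ?thesis .
  qed
  then show "\<exists>\<delta>>0. \<forall>d E. d division_of E \<and> E \<subseteq> {a..b} \<and> (\<Sum>k\<in>d. Sup k - Inf k) < \<delta> \<longrightarrow>
        (\<Sum>k\<in>d. norm (x (Sup k) - x (Inf k))) < \<epsilon>"
    using \<open>\<delta> > 0\<close> by blast
qed

text \<open>Lebesgue differentiation. The averages in \<open>integrable_ccontinuous_explicit\<close>
  extend to the right of the point only, so left difference quotients are treated as right ones of
  the reflected function.\<close>

lemma indefinite_integral_has_vector_derivative_ae:
  fixes f :: "real \<Rightarrow> 'a::euclidean_space"
  assumes f: "f integrable_on {a..b}"
  obtains N where "negligible N"
    "\<And>t. t \<in> {a..b} - N \<Longrightarrow> ((\<lambda>u. integral {a..u} f) has_vector_derivative f t) (at t within {a..b})"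
proof -
  \<comment> \<open>Extension by zero, so that averages over \<open>{x..x+h}\<close> make sense
    beyond the end of the interval.\<close>
  define f1 where "f1 = (\<lambda>t. if t \<in> {a..b} then f t else 0)"
  define f2 where "f2 = (\<lambda>t. f1 (-t))"
  have f1_UNIV: "f1 integrable_on UNIV"
    using f integrable_restrict_UNIV unfolding f1_def by blast
  have f1_int: "f1 integrable_on {u..v}" for u v
    using f1_UNIV integrable_on_subinterval by blast
  have f2_int: "f2 integrable_on {u..v}" for u v
    using f1_int[of "-v" "-u"] Henstock_Kurzweil_Integration.integrable_reflect_real[where f = f1 and a = "-v" and b = "-u"] by (simp add: f2_def)
  have one_sided: "\<exists>N. negligible N \<and>
      (\<forall>x e. x \<notin> N \<longrightarrow> 0 < e \<longrightarrow> (\<exists>d>0. \<forall>h. 0 < h \<and> h < d \<longrightarrow> norm (integral {x..x+h} \<phi> /\<^sub>R h - \<phi> x) < e))"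
    if "\<And>u v. \<phi> integrable_on {u..v}" for \<phi> :: "real \<Rightarrow> 'a"
  proof (rule integrable_ccontinuous_explicit[of \<phi>])
    show "\<phi> integrable_on cbox u v" for u v
      using that by (simp add: box_real)
    fix N assume N: "negligible N" "\<And>x e. \<lbrakk>x \<notin> N; 0 < e\<rbrakk> \<Longrightarrow> \<exists>d>0. \<forall>h. 0 < h \<and> h < d \<longrightarrow>
        norm (integral (cbox x (x + h *\<^sub>R One)) \<phi> /\<^sub>R h ^ DIM(real) - \<phi> x) < e"
    show ?thesis
      by (intro exI[of _ N] conjI allI impI N(1)) (use N(2) in simp)
  qed
  obtain N1 where N1: "negligible N1"
    "\<And>x e. \<lbrakk>x \<notin> N1; 0 < e\<rbrakk> \<Longrightarrow> \<exists>d>0. \<forall>h. 0 < h \<and> h < d \<longrightarrow> norm(integral {x..x+h} f1 /\<^sub>R h - f1 x) < e"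
    using one_sided[OF f1_int] by blast
  obtain N2 where N2: "negligible N2"
    "\<And>x e. \<lbrakk>x \<notin> N2; 0 < e\<rbrakk> \<Longrightarrow> \<exists>d>0. \<forall>h. 0 < h \<and> h < d \<longrightarrow> norm(integral {x..x+h} f2 /\<^sub>R h - f2 x) < e"
    using one_sided[OF f2_int] by blast
  have scale: "norm (w - h *\<^sub>R z) \<le> e * h" if "norm (w /\<^sub>R h - z) < e" "h > 0" for w z :: 'a and h e
  proof -
    have "w - h *\<^sub>R z = h *\<^sub>R (w /\<^sub>R h - z)"
      using that by (simp add: scaleR_right_diff_distrib)
    then have "norm (w - h *\<^sub>R z) = h * norm (w /\<^sub>R h - z)"
      using that by simp
    then show ?thesis
      using that by (simp add: mult.commute)
  qed
  have incr: "integral {a..v} f - integral {a..u} f = integral {u..v} f1"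
    if "a \<le> u" "u \<le> v" "v \<le> b" for u v
  proof -
    have "f integrable_on {a..v}"
      by (rule integrable_on_subinterval[OF f]) (use that in auto)
    then have "integral {a..u} f + integral {u..v} f = integral {a..v} f"
      using that by (intro Henstock_Kurzweil_Integration.integral_combine) auto
    moreover have "integral {u..v} f = integral {u..v} f1"
      using that by (intro integral_cong) (auto simp: f1_def)
    ultimately show ?thesis by (simp add: algebra_simps)
  qed
  show thesis
  proof
    have "negligible (uminus ` N2)"
      by (rule negligible_differentiable_image_negligible[OF order_refl N2(1)])
        (intro derivative_intros differentiable_on_minus differentiable_on_id)
    then show "negligible (N1 \<union> uminus ` N2)"
      using N1(1) by (rule negligible_Un[rotated])
    fix t assume t: "t \<in> {a..b} - (N1 \<union> uminus ` N2)"
    then have "- t \<notin> N2" by force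
    show "((\<lambda>u. integral {a..u} f) has_vector_derivative f t) (at t within {a..b})"
      unfolding has_vector_derivative_def has_derivative_within_alt
    proof (intro conjI allI impI)
      show "bounded_linear (\<lambda>h. h *\<^sub>R f t)"
        by (rule bounded_linear_scaleR_left)
      fix e :: real assume "e > 0"
      obtain d1 where d1: "d1 > 0" "\<And>h. 0 < h \<Longrightarrow> h < d1 \<Longrightarrow> norm(integral {t..t+h} f1 /\<^sub>R h - f1 t) < e"
        using N1(2)[of t e] t \<open>e > 0\<close> by blast
      obtain d2 where d2: "d2 > 0" "\<And>h. 0 < h \<Longrightarrow> h < d2 \<Longrightarrow> norm(integral {-t..-t+h} f2 /\<^sub>R h - f2 (-t)) < e"
        using N2(2)[of "-t" e] \<open>- t \<notin> N2\<close> \<open>e > 0\<close> by blast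
      have ft: "f1 t = f t" "f2 (-t) = f t"
        using t by (auto simp: f1_def f2_def)
      show "\<exists>d>0. \<forall>y\<in>{a..b}. norm (y - t) < d \<longrightarrow>
          norm (integral {a..y} f - integral {a..t} f - (y - t) *\<^sub>R f t) \<le> e * norm (y - t)"
      proof (intro exI conjI ballI impI)
        show "min d1 d2 > 0" using d1 d2 by auto
        fix y assume y: "y \<in> {a..b}" "norm (y - t) < min d1 d2"
        consider "y = t" | "y > t" | "y < t" by linarith
        then show "norm (integral {a..y} f - integral {a..t} f - (y - t) *\<^sub>R f t) \<le> e * norm (y - t)"
        proof cases
          case 2
          have "norm (integral {t..t + (y - t)} f1 - (y - t) *\<^sub>R f1 t) \<le> e * (y - t)"
            using 2 y by (intro scale d1(2)) auto
          then show ?thesis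
            using incr[of t y] 2 t y ft by simp
        next
          case 3
          have "norm (integral {-t..-t + (t - y)} f2 - (t - y) *\<^sub>R f2 (-t)) \<le> e * (t - y)"
            using 3 y by (intro scale d2(2)) auto
          moreover have "integral {-t..-t + (t - y)} f2 = integral {y..t} f1"
            unfolding f2_def using Henstock_Kurzweil_Integration.integral_reflect_real[where f = f1 and a = y and b = t] by simp
          ultimately have "norm (integral {a..t} f - integral {a..y} f - (t - y) *\<^sub>R f t) \<le> e * (t - y)"
            using incr[of y t] 3 t y ft by simp
          then have "norm (- (integral {a..t} f - integral {a..y} f - (t - y) *\<^sub>R f t)) \<le> e * (t - y)"
            by (simp only: norm_minus_cancel)
          then show ?thesis
            using 3 by (simp add: algebra_simps)
        qed simp
      qed
    qed
  qed
qed

text \<open>The fundamental theorem for the gauge integral. Cells tagged outside \<open>N\<close>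
  are controlled by the derivative at the tag. Cells tagged in \<open>N\<close> are forced by the
  gauge into an open set \<open>G\<close> of small measure, where absolute continuity makes the sum
  of increments small.\<close>

lemma abs_continuous_on_has_integral:
  fixes x :: "real \<Rightarrow> 'a::euclidean_space"
  assumes ac: "abs_continuous_on {a..b} x" and "a \<le> b" and N: "negligible N"
    and deriv: "\<And>t. t \<in> {a..b} - N \<Longrightarrow> (x has_vector_derivative v t) (at t within {a..b})"
  shows "(v has_integral (x b - x a)) {a..b}"
proof -
  \<comment> \<open>Nothing is known about \<open>v\<close> on \<open>N\<close>; with value 0 there,
    a cell tagged in \<open>N\<close> contributes only the increment of \<open>x\<close>.\<close>
  define w where "w = (\<lambda>t. if t \<in> N then 0 else v t)"
  \<comment> \<open>The empty set is a separate case because the passage from tagged cells to their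
    division asks for the value 0 on every degenerate interval, while \<open>Sup {}\<close> and
    \<open>Inf {}\<close> mean nothing here.\<close>
  define D where "D = (\<lambda>k::real set. if k = {} then 0 else norm (x (Sup k) - x (Inf k)))"
  have "(w has_integral (x b - x a)) {a..b}"
    unfolding has_integral_real
  proof (intro allI impI)
    fix e :: real assume "e > 0"
    obtain \<delta> where "\<delta> > 0" and
      \<delta>: "\<And>d E. \<lbrakk>d division_of E; E \<subseteq> {a..b}; (\<Sum>k\<in>d. Sup k - Inf k) < \<delta>\<rbrakk> \<Longrightarrow>
             (\<Sum>k\<in>d. norm (x (Sup k) - x (Inf k))) < e / 2"
    proof -
      have "e / 2 > 0" using \<open>e > 0\<close> by simp
      then show ?thesis
        using ac that unfolding abs_continuous_on_def by blast
    qed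
    obtain G where G: "open G" "N \<subseteq> G" "G \<in> lmeasurable" "measure lebesgue G < \<delta>"
    proof -
      obtain G where G: "open G" "N \<subseteq> G" "G - N \<in> lmeasurable" "emeasure lebesgue (G - N) < ennreal \<delta>"
        using sets_lebesgue_outer_open[of N \<delta>] \<open>\<delta> > 0\<close> N negligible_imp_sets by blast
      have 1: "G \<in> lmeasurable"
      proof -
        have "N \<union> (G - N) \<in> lmeasurable"
          by (rule fmeasurable.Un[OF negligible_imp_measurable[OF N] G(3)])
        then show ?thesis
          using G(2) by (simp add: Un_absorb1 Un_Diff_cancel)
      qed
      have "measure lebesgue G = measure lebesgue (G - N)"
        using measure_Diff_null_set[of G lebesgue N] N 1 by (simp add: negligible_iff_null_sets fmeasurableD)
      also have "\<dots> < \<delta>"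
        using G by (metis \<open>\<delta> > 0\<close> emeasure_eq_measure2 ennreal_less_iff measure_nonneg)
      finally show ?thesis
        using that G 1 by blast
    qed
    \<comment> \<open>Slope tolerance: over total length \<open>b - a\<close> it costs at most half
      of \<open>e\<close>; the summand 1 covers \<open>a = b\<close>.\<close>
    define c where "c = e / (2 * (b - a + 1))"
    have "c > 0"
      using \<open>e > 0\<close> \<open>a \<le> b\<close> by (auto simp: c_def)
    have "\<forall>t. \<exists>r. 0 < r \<and> (t \<in> N \<longrightarrow> ball t r \<subseteq> G) \<and>
        (t \<in> {a..b} - N \<longrightarrow> (\<forall>y\<in>{a..b}. norm (y - t) < r \<longrightarrow>
            norm (x y - x t - (y - t) *\<^sub>R v t) \<le> c * norm (y - t)))" (is "\<forall>t. \<exists>r. ?P t r")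
    proof
      fix t
      show "\<exists>r. ?P t r"
      proof (cases "t \<in> N")
        case True
        then show ?thesis
          using G(1,2) open_contains_ball by blast
      next
        case False
        show ?thesis
        proof (cases "t \<in> {a..b}")
          case True
          then show ?thesis
            using deriv[of t] False \<open>c > 0\<close> unfolding has_vector_derivative_def has_derivative_within_alt
            by blast
        qed (use False in \<open>auto intro: zero_less_one\<close>)
      qed
    qed
    then obtain r where "\<forall>t. ?P t (r t)"
      by (rule choice[THEN exE])
    then have r: "\<And>t. r t > 0" "\<And>t. t \<in> N \<Longrightarrow> ball t (r t) \<subseteq> G"
      "\<And>t y. \<lbrakk>t \<in> {a..b} - N; y \<in> {a..b}; norm (y - t) < r t\<rbrakk> \<Longrightarrow>
            norm (x y - x t - (y - t) *\<^sub>R v t) \<le> c * norm (y - t)"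
      by blast+
    show "\<exists>\<gamma>. gauge \<gamma> \<and> (\<forall>p. p tagged_division_of {a..b} \<and> \<gamma> fine p \<longrightarrow>
        norm ((\<Sum>(t, k)\<in>p. measure lborel k *\<^sub>R w t) - (x b - x a)) < e)"
    proof (intro exI conjI allI impI)
      show "gauge (\<lambda>t. ball t (r t))"
        using r(1) by (simp add: gauge_def)
      fix p assume "p tagged_division_of {a..b} \<and> (\<lambda>t. ball t (r t)) fine p"
      then have p: "p tagged_division_of {a..b}" and fine: "\<And>t k. (t, k) \<in> p \<Longrightarrow> k \<subseteq> ball t (r t)"
        by (auto simp: fine_def)
      have fin: "finite p"
        using p by (rule tagged_division_of_finite)
      have pk: "\<exists>u v. k = {u..v} \<and> u \<le> t \<and> t \<le> v \<and> a \<le> u \<and> v \<le> b" if tk: "(t, k) \<in> p" for t k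
      proof -
        have "t \<in> k" "k \<subseteq> {a..b}" "\<exists>u v. k = {u..v}"
          using tagged_division_ofD(2,3,4)[OF p tk] by (auto simp: box_real)
        then show ?thesis by auto
      qed
      define q where "q = {(t, k) \<in> p. t \<in> N}"
      have q_div: "q tagged_division_of (\<Union>(snd ` q))"
      proof (rule tagged_partial_division_of_Union_self[OF tagged_partial_division_subset])
        show "p tagged_partial_division_of {a..b}"
          using p by (simp add: tagged_division_of_def)
      qed (auto simp: q_def)
      have q_snd: "snd ` q division_of \<Union>(snd ` q)"
        using q_div by (rule division_of_tagged_division)
      have q_ne: "k \<noteq> {}" "k \<subseteq> G" "k \<subseteq> {a..b}" "Sup k - Inf k = measure lebesgue k" if k: "k \<in> snd ` q" for k
      proof -
        obtain t where t: "(t, k) \<in> p" "t \<in> N"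
          using k by (auto simp: q_def)
        show "k \<subseteq> G"
          using r(2)[OF t(2)] fine[OF t(1)] by blast
        show "k \<noteq> {}" "k \<subseteq> {a..b}" "Sup k - Inf k = measure lebesgue k"
          using pk[OF t(1)] by auto
      qed
      have term_N: "(\<Sum>(t, k)\<in>q. D k) < e / 2"
      proof -
        have "(\<Sum>(t, k)\<in>q. D k) = (\<Sum>k\<in>snd ` q. D k)"
        proof (rule sum.over_tagged_division_lemma[OF q_div])
          show "D (cbox u v) = 0" if "box u v = {}" for u v :: real
            using that by (cases "u = v") (auto simp: D_def box_real)
        qed
        also have "\<dots> = (\<Sum>k\<in>snd ` q. norm (x (Sup k) - x (Inf k)))"
          using q_ne(1) by (intro sum.cong) (auto simp: D_def)
        also have "\<dots> < e / 2"
        proof (rule \<delta>[OF q_snd])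
          show "\<Union> (snd ` q) \<subseteq> {a..b}"
            using q_ne(3) by blast
          have "(\<Sum>k\<in>snd ` q. Sup k - Inf k) = measure lebesgue (\<Union>(snd ` q))"
            using content_division[OF q_snd] q_ne(4) by simp
          also have "\<dots> \<le> measure lebesgue G"
          proof (rule measure_mono_fmeasurable[OF _ _ G(3)])
            show "\<Union> (snd ` q) \<subseteq> G"
              using q_ne(2) by blast
            show "\<Union> (snd ` q) \<in> sets lebesgue"
              using lmeasurable_division[OF q_snd] by (rule fmeasurableD)
          qed
          finally show "(\<Sum>k\<in>snd ` q. Sup k - Inf k) < \<delta>"
            using G(4) by simp
        qed
        finally show ?thesis .
      qed
      have "x b - x a = (\<Sum>(t, k)\<in>p. x (Sup k) - x (Inf k))"
        using additive_tagged_division_1[OF \<open>a \<le> b\<close> p, of x] by simp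
      then have "(\<Sum>(t, k)\<in>p. measure lborel k *\<^sub>R w t) - (x b - x a) =
          (\<Sum>(t, k)\<in>p. measure lborel k *\<^sub>R w t - (x (Sup k) - x (Inf k)))"
        by (simp add: sum_subtractf case_prod_unfold)
      also have "norm \<dots> \<le> (\<Sum>(t, k)\<in>p. (if t \<in> N then D k else 0) + c * measure lborel k)"
      proof (rule sum_norm_le, clarify)
        fix t k assume tk: "(t, k) \<in> p"
        obtain u z where uz: "k = {u..z}" "u \<le> t" "t \<le> z" "a \<le> u" "z \<le> b"
          using pk[OF tk] by blast
        show "norm (measure lborel k *\<^sub>R w t - (x (Sup k) - x (Inf k))) \<le> (if t \<in> N then D k else 0) + c * measure lborel k"
        proof (cases "t \<in> N")
          case True
          then show ?thesis
            using uz \<open>c > 0\<close> by (simp add: w_def D_def norm_minus_commute)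
        next
          case False
          have "z \<in> k" "u \<in> k"
            using uz by auto
          then have "z \<in> ball t (r t)" "u \<in> ball t (r t)"
            using fine[OF tk] by blast+
          then have "norm (z - t) < r t" "norm (u - t) < r t"
            by (auto simp: dist_norm norm_minus_commute)
          then have "norm (x z - x t - (z - t) *\<^sub>R v t) \<le> c * norm (z - t)"
               "norm (x u - x t - (u - t) *\<^sub>R v t) \<le> c * norm (u - t)"
            using uz False by (intro r(3); simp)+
          \<comment> \<open>Straddling the tag: the two one-sided errors add up to \<open>c\<close>
            times the length of the cell because \<open>t\<close> lies between \<open>u\<close> and
            \<open>z\<close>.\<close>
          then have "norm ((x u - x t - (u - t) *\<^sub>R v t) - (x z - x t - (z - t) *\<^sub>R v t)) \<le> c * (t - u) + c * (z - t)"
            using uz norm_triangle_ineq4[of "x u - x t - (u - t) *\<^sub>R v t" "x z - x t - (z - t) *\<^sub>R v t"]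
            by simp
          moreover have "(x u - x t - (u - t) *\<^sub>R v t) - (x z - x t - (z - t) *\<^sub>R v t) = (z - u) *\<^sub>R v t - (x z - x u)"
            by (simp add: algebra_simps)
          ultimately show ?thesis
            using False uz by (simp add: w_def algebra_simps)
        qed
      qed
      also have "\<dots> = (\<Sum>(t, k)\<in>p. if t \<in> N then D k else 0) + c * (\<Sum>(t, k)\<in>p. measure lborel k)"
        by (simp add: sum.distrib sum_distrib_left case_prod_unfold)
      also have "(\<Sum>(t, k)\<in>p. if t \<in> N then D k else 0) = (\<Sum>(t, k)\<in>q. D k)"
        unfolding q_def using fin by (intro sum.mono_neutral_cong_right) (auto split: if_splits)
      also have "(\<Sum>(t, k)\<in>p. measure lborel k) = b - a"
        using additive_content_tagged_division[of p a b] p \<open>a \<le> b\<close> by (simp add: box_real)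
      also have "c * (b - a) \<le> e / 2"
        using \<open>e > 0\<close> \<open>a \<le> b\<close> by (simp add: c_def field_simps)
      finally show "norm ((\<Sum>(t, k)\<in>p. measure lborel k *\<^sub>R w t) - (x b - x a)) < e"
        using term_N by simp
    qed
  qed
  then show ?thesis
    by (rule has_integral_spike[OF N, rotated]) (auto simp: w_def)
qed

section \<open>Densities of dominated monotone functions and almost everywhere
  differentiability\<close>

lemma has_integral_change_finite:
  fixes f :: "'a::euclidean_space \<Rightarrow> 'b::banach"
  assumes "(f has_integral y) S" and "finite ((S - T) \<union> (T - S))"
  shows "(f has_integral y) T"
proof -
  have neg: "negligible X" if "X \<subseteq> (S - T) \<union> (T - S)" for X
    using that assms(2) by (meson finite_subset negligible_finite)
  then have "(f has_integral y) S \<longleftrightarrow> (f has_integral y) T"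
    by (intro has_integral_spike_set_eq neg) blast+
  then show ?thesis
    using assms(1) by simp
qed

text \<open>The masses of the intervals from -n to n become stationary since \<open>A\<close> is
  constant outside \<open>{a..b}\<close>. The total mass is needed because the induction over Borel
  sets below takes complements, which requires finite measures.\<close>

lemma emeasure_interval_measure_UNIV:
  assumes mono: "\<And>s t. s \<le> t \<Longrightarrow> A s \<le> A t" and cont: "continuous_on UNIV A"
    and left: "\<And>t. t \<le> a \<Longrightarrow> A t = A a" and right: "\<And>t. b \<le> t \<Longrightarrow> A t = A b"
  shows "emeasure (interval_measure A) UNIV = ennreal (A b - A a)"
proof (rule LIMSEQ_unique)
  let ?I = "\<lambda>n. {- real n<..real n}"
  have "(\<Union>n. ?I n) = UNIV"
  proof -
    have "\<exists>n. - real n < t \<and> t \<le> real n" for t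
    proof -
      obtain n where "\<bar>t\<bar> < real n"
        using reals_Archimedean2 by blast
      then show ?thesis
        by (intro exI[of _ n]) auto
    qed
    then show ?thesis by auto
  qed
  moreover have "incseq ?I"
    by (auto simp: incseq_def)
  ultimately show "(\<lambda>n. emeasure (interval_measure A) (?I n)) \<longlonglongrightarrow> emeasure (interval_measure A) UNIV"
    using Lim_emeasure_incseq[of ?I "interval_measure A"] by (auto simp: image_subset_iff)
  obtain n0 :: nat where n0: "real n0 \<ge> max \<bar>a\<bar> \<bar>b\<bar>"
    using real_arch_simple by blast
  show "(\<lambda>n. emeasure (interval_measure A) (?I n)) \<longlonglongrightarrow> ennreal (A b - A a)"
  proof (rule tendsto_eventually, rule eventually_sequentiallyI)
    fix n assume "n \<ge> n0"
    then have "real n \<ge> max \<bar>a\<bar> \<bar>b\<bar>"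
      using n0 by (meson of_nat_mono order_trans)
    then have "- real n \<le> a" "b \<le> real n"
      by auto
    then have "A (- real n) = A a" "A (real n) = A b"
      using left right by blast+
    moreover have "emeasure (interval_measure A) (?I n) = ennreal (A (real n) - A (- real n))"
      using cont by (intro emeasure_interval_measure_Ioc mono)
        (auto simp: continuous_on_eq_continuous_at continuous_at_imp_continuous_within)
    ultimately show "emeasure (interval_measure A) (?I n) = ennreal (A b - A a)"
      by simp
  qed
qed

text \<open>
  The Stieltjes measure of \<open>\<phi>\<close> is dominated by the measure with density \<open>m\<close>, since adding the
  Stieltjes measure of the nondecreasing function \<open>(\<integral>m) - \<phi>\<close> gives the latter.
\<close>

lemma dominated_monotone_density:
  fixes \<phi> m :: "real \<Rightarrow> real"
  assumes "a \<le> b" and m: "m integrable_on {a..b}" "\<And>t. t \<in> {a..b} \<Longrightarrow> 0 \<le> m t"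
    and mono: "\<And>s t. \<lbrakk>a \<le> s; s \<le> t; t \<le> b\<rbrakk> \<Longrightarrow> \<phi> s \<le> \<phi> t"
    and dom: "\<And>s t. \<lbrakk>a \<le> s; s \<le> t; t \<le> b\<rbrakk> \<Longrightarrow> \<phi> t - \<phi> s \<le> integral {s..t} m"
  obtains f where "f integrable_on {a..b}" "\<And>t. t \<in> {a..b} \<Longrightarrow> integral {a..t} f = \<phi> t - \<phi> a"
proof -
  \<comment> \<open>Clamping to \<open>{a..b}\<close> extends all functions to the line as constants
    outside the interval, so that they generate finite Stieltjes measures on the whole line.\<close>
  define c where "c = (\<lambda>t. min b (max a t))"
  define A where "A = (\<lambda>t. \<phi> (c t))"
  define G where "G = (\<lambda>t. integral {a..c t} m)"
  define B where "B = (\<lambda>t. G t - A t)"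
  have c: "a \<le> c t" "c t \<le> b" "s \<le> t \<Longrightarrow> c s \<le> c t" for s t
    using \<open>a \<le> b\<close> by (auto simp: c_def)
  have G_diff: "G t - G s = integral {c s..c t} m" if "s \<le> t" for s t
  proof -
    have "m integrable_on {a..c t}"
      by (rule integrable_on_subinterval[OF m(1)]) (use c in auto)
    then have "integral {a..c s} m + integral {c s..c t} m = integral {a..c t} m"
      using c that by (intro Henstock_Kurzweil_Integration.integral_combine) auto
    then show ?thesis by (simp add: G_def)
  qed
  have A_mono: "A s \<le> A t" and A_le: "A t - A s \<le> G t - G s" if "s \<le> t" for s t
    using that c by (auto simp: A_def G_diff intro: mono dom)
  have B_mono: "B s \<le> B t" if "s \<le> t" for s t
    using A_le[OF that] by (simp add: B_def)
  have G_cont: "continuous_on UNIV G"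
  proof -
    have "continuous_on {a..b} (\<lambda>t. integral {a..t} m)"
      by (rule indefinite_integral_continuous_1[OF m(1)])
    moreover have "continuous_on UNIV c"
      unfolding c_def by (intro continuous_intros)
    ultimately show ?thesis
      unfolding G_def by (rule continuous_on_compose2) (use c in auto)
  qed
  have A_cont: "continuous_on UNIV A"
    unfolding continuous_on_iff
  proof (intro ballI allI impI)
    fix t e :: real assume "0 < e"
    then obtain d where "d > 0" and d: "\<And>s. dist s t < d \<Longrightarrow> dist (G s) (G t) < e"
      using G_cont unfolding continuous_on_iff by blast
    have "dist (A s) (A t) \<le> dist (G s) (G t)" for s
      using A_mono[of s t] A_mono[of t s] A_le[of s t] A_le[of t s]
      by (cases "s \<le> t") (auto simp: dist_real_def)
    then show "\<exists>d>0. \<forall>s\<in>UNIV. dist s t < d \<longrightarrow> dist (A s) (A t) < e"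
      using d \<open>d > 0\<close> by (meson le_less_trans)
  qed
  have B_cont: "continuous_on UNIV B"
    unfolding B_def by (intro continuous_intros G_cont A_cont)
  have add: "ennreal (A t - A s) + ennreal (B t - B s) = ennreal (G t - G s)" if "s \<le> t" for s t
  proof -
    have "ennreal (A t - A s) + ennreal (B t - B s) = ennreal ((A t - A s) + (B t - B s))"
      using A_mono[OF that] B_mono[OF that] by (intro ennreal_plus[symmetric]) auto
    then show ?thesis by (simp add: B_def)
  qed
  let ?\<alpha> = "interval_measure A" and ?\<beta> = "interval_measure B"
  define h where "h = (\<lambda>t. indicator {a..b} t * m t)"
  define \<gamma> where "\<gamma> = density lebesgue (\<lambda>t. ennreal (h t))"
  have h_meas [measurable]: "h \<in> borel_measurable lebesgue"
    using has_integral_implies_lebesgue_measurable[OF integrable_integral[OF m(1)]]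
    by (simp add: h_def)
  have Ioc: "emeasure ?\<alpha> {s<..t} = ennreal (A t - A s)" "emeasure ?\<beta> {s<..t} = ennreal (B t - B s)" if "s \<le> t" for s t
    using that A_cont B_cont
    by (intro emeasure_interval_measure_Ioc A_mono B_mono;
        simp add: continuous_on_eq_continuous_at continuous_at_imp_continuous_within)+
  have \<gamma>_space: "space \<gamma> = UNIV"
    by (simp add: \<gamma>_def)
  have h_integral: "(h has_integral (G t - G s)) {s<..t}" if "s \<le> t" for s t
  proof -
    have "(m has_integral (G t - G s)) {c s..c t}"
      unfolding G_diff[OF that]
      by (intro integrable_integral integrable_on_subinterval[OF m(1)]) (use c in auto)
    \<comment> \<open>Clamping a half-open interval and intersecting it with \<open>{a..b}\<close>
      give the same set up to the points a, b and s.\<close>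
    then have "(m has_integral (G t - G s)) ({a..b} \<inter> {s<..t})"
    proof (rule has_integral_change_finite)
      show "finite ({c s..c t} - {a..b} \<inter> {s<..t} \<union> ({a..b} \<inter> {s<..t} - {c s..c t}))"
        by (rule finite_subset[of _ "{a, b, s}"]) (auto simp: c_def)
    qed
    then have "((\<lambda>t. if t \<in> {a..b} then m t else 0) has_integral (G t - G s)) {s<..t}"
      by (simp only: has_integral_restrict_Int)
    then show ?thesis
      by (rule has_integral_eq[rotated]) (simp add: h_def indicator_def)
  qed
  have \<gamma>_Ioc: "emeasure \<gamma> {s<..t} = ennreal (G t - G s)" if "s \<le> t" for s t
  proof -
    have "emeasure \<gamma> {s<..t} = (\<integral>\<^sup>+ u. ennreal (h u) * indicator {s<..t} u \<partial>lebesgue)"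
      unfolding \<gamma>_def by (rule emeasure_density) auto
    also have "\<dots> = (\<integral>\<^sup>+ u. ennreal (indicator {s<..t} u * h u) \<partial>lborel)"
      unfolding nn_integral_completion
      by (intro nn_integral_cong) (auto simp: indicator_def)
    also have "\<dots> = ennreal (G t - G s)"
      by (rule nn_integral_has_integral_lebesgue[OF _ h_integral[OF that]]) (use m(2) in \<open>auto simp: h_def indicator_def\<close>)
    finally show ?thesis .
  qed
  have \<gamma>_UNIV: "emeasure \<gamma> UNIV = ennreal (G b - G a)"
  proof -
    have "(h has_integral (G b - G a)) UNIV"
    proof -
      have "(m has_integral (G b - G a)) {a..b}"
        using G_diff[OF \<open>a \<le> b\<close>] \<open>a \<le> b\<close> integrable_integral[OF m(1)] by (simp add: c_def)
      then have "((\<lambda>t. if t \<in> {a..b} then m t else 0) has_integral (G b - G a)) UNIV"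
        by (simp only: has_integral_restrict_UNIV)
      then show ?thesis
        by (rule has_integral_eq[rotated]) (simp add: h_def indicator_def)
    qed
    then have "(\<integral>\<^sup>+ u. ennreal (indicator UNIV u * h u) \<partial>lborel) = ennreal (G b - G a)"
      by (intro nn_integral_has_integral_lebesgue) (use m(2) in \<open>auto simp: h_def indicator_def\<close>)
    then show ?thesis
      unfolding \<gamma>_def by (subst emeasure_density) (auto simp: nn_integral_completion)
  qed
  \<comment> \<open>Both sides agree on half-open intervals, an intersection-stable generator, and
    are finite; agreement spreads to all Borel sets. Since \<gamma> has a density, Lebesgue null
    sets are then null for the Stieltjes measure of \<phi>.\<close>
  have sum_eq: "emeasure ?\<alpha> X + emeasure ?\<beta> X = emeasure \<gamma> X" if "X \<in> sets borel" for X
  proof -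
    have X: "X \<in> sigma_sets UNIV (range (\<lambda>(s, t). {s<..t::real}))"
      using that by (simp add: borel_sigma_sets_Ioc)
    have borel_iff: "Y \<in> sets borel" if "Y \<in> sigma_sets UNIV (range (\<lambda>(s, t). {s<..t::real}))" for Y
      using that by (simp add: borel_sigma_sets_Ioc)
    have in_\<gamma>: "Y \<in> sets \<gamma>" if "Y \<in> sets borel" for Y
      using that by (auto simp: \<gamma>_def)
    have Int: "Int_stable (range (\<lambda>(s, t). {s<..t::real}))"
      unfolding Int_stable_def by (auto simp: image_iff)
    have "range (\<lambda>(s, t). {s<..t::real}) \<subseteq> Pow UNIV"
      by simp
    from Int this X show ?thesis
    proof (induct rule: sigma_sets_induct_disjoint)
      case (basic Y)
      then obtain s t where Y: "Y = {s<..t}" by auto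
      show ?case
      proof (cases "s \<le> t")
        case True
        then show ?thesis
          unfolding Y Ioc[OF True] \<gamma>_Ioc[OF True] by (rule add)
      qed (simp add: Y)
    next
      case (compl Y)
      have UNIV_eq: "emeasure ?\<alpha> UNIV = ennreal (A b - A a)" "emeasure ?\<beta> UNIV = ennreal (B b - B a)"
        using \<open>a \<le> b\<close> by (intro emeasure_interval_measure_UNIV A_mono B_mono A_cont B_cont;
          simp add: A_def B_def G_def c_def min_def max_def)+
      have fin: "emeasure ?\<alpha> Y \<noteq> \<infinity>" "emeasure ?\<beta> Y \<noteq> \<infinity>" "emeasure \<gamma> Y \<noteq> \<infinity>"
        using emeasure_space[of ?\<alpha> Y] emeasure_space[of ?\<beta> Y] emeasure_space[of \<gamma> Y]
          \<gamma>_space UNIV_eq \<gamma>_UNIV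
        by (auto simp: top_unique)
      have Y: "Y \<in> sets borel" "UNIV - Y \<in> sets borel"
        using borel_iff[OF compl(1)] by auto
      have split: "emeasure \<mu> Y + emeasure \<mu> (UNIV - Y) = emeasure \<mu> UNIV" if "Y \<in> sets \<mu>" "UNIV - Y \<in> sets \<mu>" for \<mu>
        using plus_emeasure[OF that] by auto
      have "emeasure \<gamma> Y + (emeasure ?\<alpha> (UNIV - Y) + emeasure ?\<beta> (UNIV - Y)) = emeasure ?\<alpha> UNIV + emeasure ?\<beta> UNIV"
        unfolding compl(2)[symmetric] using split[of ?\<alpha>] split[of ?\<beta>] Y by (simp add: algebra_simps)
      also have "\<dots> = emeasure \<gamma> UNIV"
        unfolding UNIV_eq \<gamma>_UNIV by (rule add[OF \<open>a \<le> b\<close>])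
      also have "\<dots> = emeasure \<gamma> Y + emeasure \<gamma> (UNIV - Y)"
        using split[of \<gamma>] Y in_\<gamma> by simp
      finally show ?case
        using fin(3) by (simp add: ennreal_add_left_cancel)
    next
      case (union Y)
      have Y: "range Y \<subseteq> sets borel"
        using union(2) borel_iff by blast
      have "emeasure ?\<alpha> (\<Union>i. Y i) + emeasure ?\<beta> (\<Union>i. Y i) = (\<Sum>i. emeasure ?\<alpha> (Y i) + emeasure ?\<beta> (Y i))"
        using union(1) Y by (subst suminf_add[symmetric]) (auto simp: suminf_emeasure)
      also have "\<dots> = (\<Sum>i. emeasure \<gamma> (Y i))"
        using union(3) by simp
      also have "\<dots> = emeasure \<gamma> (\<Union>i. Y i)"
        using union(1) Y in_\<gamma> by (intro suminf_emeasure) auto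
      finally show ?case .
    qed auto
  qed
  have "absolutely_continuous lborel ?\<alpha>"
    unfolding absolutely_continuous_def
  proof
    fix X :: "real set" assume X: "X \<in> null_sets lborel"
    then have "X \<in> null_sets lebesgue"
      by (rule null_sets_completionI)
    then have "X \<in> null_sets \<gamma>"
      using absolutely_continuousI_density[of "\<lambda>t. ennreal (h t)" lebesgue]
      by (auto simp: absolutely_continuous_def \<gamma>_def)
    then show "X \<in> null_sets ?\<alpha>"
      using sum_eq[of X] X by (auto simp: null_sets_def)
  qed
  then obtain f where f [measurable]: "f \<in> borel_measurable lborel" and f_density: "density lborel f = ?\<alpha>"
    using sigma_finite_measure.Radon_Nikodym[OF sigma_finite_lborel, of ?\<alpha>] by auto
  have "((\<lambda>u. enn2real (f u)) has_integral (\<phi> t - \<phi> a)) {a..t}" if t: "t \<in> {a..b}" for t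
  proof -
    have "(\<integral>\<^sup>+ u. f u * indicator {a<..t} u \<partial>lborel) = emeasure ?\<alpha> {a<..t}"
      unfolding f_density[symmetric] by (rule emeasure_density[symmetric]) auto
    also have "\<dots> = ennreal (\<phi> t - \<phi> a)"
      using t Ioc(1)[of a t] by (simp add: A_def c_def)
    finally have I: "(\<integral>\<^sup>+ u. f u * indicator {a<..t} u \<partial>lborel) = ennreal (\<phi> t - \<phi> a)" .
    have "AE u in lborel. f u * indicator {a<..t} u \<noteq> \<infinity>"
      by (rule nn_integral_PInf_AE) (auto simp: I)
    then have "(\<integral>\<^sup>+ u. ennreal (enn2real (f u * indicator {a<..t} u)) \<partial>lborel) = ennreal (\<phi> t - \<phi> a)"
      unfolding I[symmetric] by (intro nn_integral_cong_AE) (auto simp: less_top)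
    then have "((\<lambda>u. enn2real (f u * indicator {a<..t} u)) has_integral (\<phi> t - \<phi> a)) UNIV"
      using mono[of a t] t by (intro nn_integral_has_integral) auto
    then have "((\<lambda>u. if u \<in> {a<..t} then enn2real (f u) else 0) has_integral (\<phi> t - \<phi> a)) UNIV"
      by (rule has_integral_eq[rotated]) (simp add: indicator_def)
    then have "((\<lambda>u. enn2real (f u)) has_integral (\<phi> t - \<phi> a)) {a<..t}"
      by (simp only: has_integral_restrict_UNIV)
    then show ?thesis
    proof (rule has_integral_change_finite)
      show "finite ({a<..t} - {a..t} \<union> ({a..t} - {a<..t}))"
        by (rule finite_subset[of _ "{a}"]) auto
    qed
  qed
  then show thesis
    using \<open>a \<le> b\<close> by (intro that[of "\<lambda>u. enn2real (f u)"]) (auto simp: has_integral_integrable_integral)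
qed

text \<open>Adding the indefinite integral M of \<open>m\<close> to a coordinate of x makes it
  nondecreasing with increments dominated by the integral of 2m. It is then an indefinite integral,
  hence differentiable almost everywhere, and so is M; subtracting M returns the coordinate.\<close>

lemma dominated_has_vector_derivative_ae:
  fixes x :: "real \<Rightarrow> 'a::euclidean_space"
  assumes "a \<le> b" and m: "m integrable_on {a..b}" "\<And>t. t \<in> {a..b} \<Longrightarrow> 0 \<le> m t"
    and x: "\<And>s t. \<lbrakk>a \<le> s; s \<le> t; t \<le> b\<rbrakk> \<Longrightarrow> norm (x t - x s) \<le> integral {s..t} m"
  obtains v N where "negligible N"
    "\<And>t. t \<in> {a..b} - N \<Longrightarrow> (x has_vector_derivative v t) (at t within {a..b})"
proof -
  define M where "M = (\<lambda>t. integral {a..t} m)"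
  have M_diff: "M t - M s = integral {s..t} m" if "a \<le> s" "s \<le> t" "t \<le> b" for s t
  proof -
    have "m integrable_on {a..t}"
      by (rule integrable_on_subinterval[OF m(1)]) (use that in auto)
    then have "integral {a..s} m + integral {s..t} m = integral {a..t} m"
      using that by (intro Henstock_Kurzweil_Integration.integral_combine) auto
    then show ?thesis by (simp add: M_def)
  qed
  have x_comp: "\<bar>x t \<bullet> i - x s \<bullet> i\<bar> \<le> M t - M s" if "i \<in> Basis" "a \<le> s" "s \<le> t" "t \<le> b" for i s t
    using Basis_le_norm[OF that(1), of "x t - x s"] x[OF that(2-4)] M_diff[OF that(2-4)]
    by (simp add: inner_diff_left)
  have "\<exists>f. f integrable_on {a..b} \<and> (\<forall>t\<in>{a..b}. integral {a..t} f = (x t \<bullet> i + M t) - (x a \<bullet> i + M a))"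
    if i: "i \<in> Basis" for i
  proof (rule dominated_monotone_density[of a b "\<lambda>t. 2 * m t" "\<lambda>t. x t \<bullet> i + M t"])
    show "(\<lambda>t. 2 * m t) integrable_on {a..b}"
      using integrable_cmul[OF m(1), of 2] by simp
    show "x s \<bullet> i + M s \<le> x t \<bullet> i + M t" if "a \<le> s" "s \<le> t" "t \<le> b" for s t
      using x_comp[OF i that] by linarith
    show "x t \<bullet> i + M t - (x s \<bullet> i + M s) \<le> integral {s..t} (\<lambda>t. 2 * m t)"
      if "a \<le> s" "s \<le> t" "t \<le> b" for s t
      using x_comp[OF i that] M_diff[OF that] by simp
  qed (use \<open>a \<le> b\<close> m(2) in auto)
  then obtain f where f: "\<And>i. i \<in> Basis \<Longrightarrow> f i integrable_on {a..b}"
    "\<And>i t. \<lbrakk>i \<in> Basis; t \<in> {a..b}\<rbrakk> \<Longrightarrow> integral {a..t} (f i) = (x t \<bullet> i + M t) - (x a \<bullet> i + M a)"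
    by metis
  obtain N0 where N0: "negligible N0"
    "\<And>t. t \<in> {a..b} - N0 \<Longrightarrow> (M has_vector_derivative m t) (at t within {a..b})"
    unfolding M_def using indefinite_integral_has_vector_derivative_ae[OF m(1)] by blast
  have "\<exists>N. negligible N \<and> (\<forall>t \<in> {a..b} - N.
      ((\<lambda>u. integral {a..u} (f i)) has_vector_derivative f i t) (at t within {a..b}))" if "i \<in> Basis" for i
    using indefinite_integral_has_vector_derivative_ae[OF f(1)[OF that]] by metis
  then obtain N where N: "\<And>i. i \<in> Basis \<Longrightarrow> negligible (N i)"
    "\<And>i t. \<lbrakk>i \<in> Basis; t \<in> {a..b} - N i\<rbrakk> \<Longrightarrow>
      ((\<lambda>u. integral {a..u} (f i)) has_vector_derivative f i t) (at t within {a..b})"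
    by metis
  show thesis
  proof
    show "negligible (N0 \<union> (\<Union>i\<in>Basis. N i))"
      using N0(1) N(1) by (intro negligible_Un negligible_Union) auto
    fix t assume t: "t \<in> {a..b} - (N0 \<union> (\<Union>i\<in>Basis. N i))"
    have "((\<lambda>u. x u \<bullet> i) has_vector_derivative (f i t - m t)) (at t within {a..b})" if i: "i \<in> Basis" for i
    proof (rule has_vector_derivative_transform)
      show "((\<lambda>u. integral {a..u} (f i) - M u + (x a \<bullet> i + M a)) has_vector_derivative (f i t - m t)) (at t within {a..b})"
        using has_vector_derivative_add[OF has_vector_derivative_diff[OF N(2)[OF i] N0(2)] has_vector_derivative_const] t i
        by simp
      show "t \<in> {a..b}" using t by simp
      show "x u \<bullet> i = integral {a..u} (f i) - M u + (x a \<bullet> i + M a)" if "u \<in> {a..b}" for u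
        using f(2)[OF i that] by simp
    qed
    then have "((\<lambda>u. (x u \<bullet> i) *\<^sub>R i) has_vector_derivative ((f i t - m t) *\<^sub>R i)) (at t within {a..b})"
      if "i \<in> Basis" for i
      using bounded_linear.has_vector_derivative[OF bounded_linear_scaleR_left, of "\<lambda>u. x u \<bullet> i"] that by blast
    then have "((\<lambda>u. \<Sum>i\<in>Basis. (x u \<bullet> i) *\<^sub>R i) has_vector_derivative (\<Sum>i\<in>Basis. (f i t - m t) *\<^sub>R i)) (at t within {a..b})"
      by (rule has_vector_derivative_sum)
    then show "(x has_vector_derivative (\<Sum>i\<in>Basis. (f i t - m t) *\<^sub>R i)) (at t within {a..b})"
      by (simp add: euclidean_representation)
  qed
qed

lemma mono_has_vector_derivative_nonneg:
  fixes f :: "real \<Rightarrow> real"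
  assumes mono: "\<And>s t. \<lbrakk>a \<le> s; s \<le> t; t \<le> b\<rbrakk> \<Longrightarrow> f s \<le> f t"
    and deriv: "(f has_vector_derivative d) (at t within {a..b})" and t: "a < t" "t < b"
  shows "0 \<le> d"
proof (rule tendsto_lowerbound)
  have "(f has_real_derivative d) (at t)"
    using deriv t by (simp add: has_real_derivative_iff_has_vector_derivative at_within_Icc_at)
  then show "((\<lambda>y. (f y - f t) / (y - t)) \<longlongrightarrow> d) (at t)"
    by (simp add: has_field_derivative_iff)
  have "\<forall>\<^sub>F y in at t. y \<in> {a<..<b}"
    using t by (intro eventually_at_in_open') auto
  then show "\<forall>\<^sub>F y in at t. 0 \<le> (f y - f t) / (y - t)"
  proof (rule eventually_mono)
    fix y assume "y \<in> {a<..<b}"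
    then show "0 \<le> (f y - f t) / (y - t)"
      using mono[of y t] mono[of t y] t by (cases "y \<le> t") (auto simp: zero_le_divide_iff)
  qed
qed simp

text \<open>If v were outside, a hyperplane would separate it from \<open>G\<close> with a positive
  gap. As \<open>G\<close> is bounded, the separating direction can be moved into the dense set
  \<open>D\<close> at the cost of half the gap; the slack \<epsilon> uses up the other half. A
  countable \<open>D\<close> is what later keeps the exceptional times a null set.\<close>

lemma mem_convex_compactI:
  fixes v :: "'a::euclidean_space"
  assumes D: "\<And>X. open X \<Longrightarrow> X \<noteq> {} \<Longrightarrow> \<exists>q\<in>D. q \<in> X"
    and G: "convex G" "compact G"
    and le: "\<And>q \<epsilon>. \<lbrakk>q \<in> D; 0 < \<epsilon>\<rbrakk> \<Longrightarrow> \<exists>y\<in>G. q \<bullet> v < q \<bullet> y + \<epsilon>"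
  shows "v \<in> G"
proof (rule ccontr)
  assume "v \<notin> G"
  then obtain p \<beta> where p: "p \<bullet> v < \<beta>" "\<And>y. y \<in> G \<Longrightarrow> \<beta> < p \<bullet> y"
    using separating_hyperplane_closed_point[OF G(1) compact_imp_closed[OF G(2)]] by blast
  obtain C where C: "C > 0" "\<And>y. y \<in> G \<Longrightarrow> norm y \<le> C"
    using compact_imp_bounded[OF G(2)] unfolding bounded_pos by blast
  define \<eta> where "\<eta> = \<beta> - p \<bullet> v"
  have "\<eta> > 0" using p(1) by (simp add: \<eta>_def)
  \<comment> \<open>Vectors \<open>y - v\<close> with y in \<open>G\<close> have norm at most
    \<open>C + norm v\<close>, so tilting the direction by less than \<delta> changes the inner
    product by at most half of \<eta>.\<close>
  define \<delta> where "\<delta> = \<eta> / (2 * (C + norm v))"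
  have pos: "C + norm v > 0"
    using C(1) by (simp add: add_pos_nonneg)
  then have "\<delta> > 0"
    using \<open>\<eta> > 0\<close> by (simp add: \<delta>_def)
  then obtain q where q: "q \<in> D" "q \<in> ball (- p) \<delta>"
    using D[of "ball (- p) \<delta>"] by auto
  have "norm (q + p) < \<delta>"
    using q(2) by (simp add: dist_norm norm_minus_commute algebra_simps)
  obtain y where y: "y \<in> G" "q \<bullet> v < q \<bullet> y + \<eta> / 2"
    using le[OF q(1), of "\<eta> / 2"] \<open>\<eta> > 0\<close> by auto
  have "(q + p) \<bullet> (y - v) \<le> norm (q + p) * norm (y - v)"
    by (rule norm_cauchy_schwarz)
  also have "\<dots> \<le> \<delta> * (C + norm v)"
    using \<open>norm (q + p) < \<delta>\<close> C(2)[OF y(1)] norm_triangle_ineq4[of y v] \<open>\<delta> > 0\<close> by (intro mult_mono) auto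
  also have "\<dots> = \<eta> / 2"
    using pos by (simp add: \<delta>_def del: distrib_left_numeral)
  finally have "(q + p) \<bullet> (y - v) \<le> \<eta> / 2" .
  moreover have "p \<bullet> (y - v) > \<eta>"
    using p(2)[OF y(1)] by (simp add: \<eta>_def inner_diff_right)
  moreover have "q \<bullet> (y - v) > - (\<eta> / 2)"
    using y(2) by (simp add: inner_diff_right)
  ultimately show False
    by (simp add: inner_add_left)
qed

section \<open>Limits of differential inclusions\<close>

lemma increment_norm_le:
  fixes x :: "real \<Rightarrow> 'a::euclidean_space"
  assumes u: "(u has_integral (x t - x s)) {s..t}" and m: "m integrable_on {a..b}"
    and bound: "\<And>\<tau>. \<tau> \<in> {a..b} \<Longrightarrow> norm (u \<tau>) \<le> m \<tau>" and st: "a \<le> s" "t \<le> b"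
  shows "norm (x t - x s) \<le> integral {s..t} m"
proof -
  have "norm (integral {s..t} u) \<le> integral {s..t} m"
  proof (rule integral_norm_bound_integral)
    show "m integrable_on {s..t}"
      by (rule integrable_on_subinterval[OF m]) (use st in auto)
  qed (use u bound st in auto)
  then show ?thesis
    using integral_unique[OF u] by simp
qed

lemma limit_increment_norm_le:
  fixes E u :: "nat \<Rightarrow> real \<Rightarrow> 'a::euclidean_space"
  assumes m: "m integrable_on {a..b}"
    and u: "\<And>n s t. \<lbrakk>a \<le> s; s \<le> t; t \<le> b\<rbrakk> \<Longrightarrow> (u n has_integral (E n t - E n s)) {s..t}"
    and bound: "\<And>n t. t \<in> {a..b} \<Longrightarrow> norm (u n t) \<le> m t"
    and conv: "\<And>t. t \<in> {a..b} \<Longrightarrow> (\<lambda>n. E n t) \<longlonglongrightarrow> x t"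
    and st: "a \<le> s" "s \<le> t" "t \<le> b"
  shows "norm (x t - x s) \<le> integral {s..t} m"
proof (rule LIMSEQ_le_const2)
  show "(\<lambda>n. norm (E n t - E n s)) \<longlonglongrightarrow> norm (x t - x s)"
    using st by (intro tendsto_intros conv) auto
  show "\<exists>n0. \<forall>n\<ge>n0. norm (E n t - E n s) \<le> integral {s..t} m"
  proof (intro exI allI impI)
    show "norm (E n t - E n s) \<le> integral {s..t} m" for n
      by (rule increment_norm_le[where u = "u n", OF u[OF st] m bound]) (use st in auto)
  qed
qed

text \<open>
  Since \<open>G\<close> may fail to be measurable, the derivative \<open>v\<close> of the limit is first compared with the measurable
  functions \<open>sup\<^bsub>n \<ge> k\<^esub> p \<bullet> u n\<close> for countably many directions \<open>p\<close>, and only then, pointwise, with \<open>G\<close>.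
\<close>

theorem limit_of_differential_inclusions:
  fixes E u :: "nat \<Rightarrow> real \<Rightarrow> 'a::euclidean_space"
  assumes "a \<le> b" and m: "m integrable_on {a..b}" "\<And>t. t \<in> {a..b} \<Longrightarrow> 0 \<le> m t"
    and u: "\<And>n s t. \<lbrakk>a \<le> s; s \<le> t; t \<le> b\<rbrakk> \<Longrightarrow> (u n has_integral (E n t - E n s)) {s..t}"
    and bound: "\<And>n t. t \<in> {a..b} \<Longrightarrow> norm (u n t) \<le> m t"
    and conv: "\<And>t. t \<in> {a..b} \<Longrightarrow> (\<lambda>n. E n t) \<longlonglongrightarrow> x t"
    and N: "negligible N"
    and G: "\<And>t. t \<in> {a..b} - N \<Longrightarrow> convex (G t) \<and> compact (G t) \<and> G t \<noteq> {}"
    and near: "\<And>t. t \<in> {a..b} - N \<Longrightarrow> (\<lambda>n. infdist (u n t) (G t)) \<longlonglongrightarrow> 0"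
  shows "\<exists>v N'. negligible N' \<and>
    (\<forall>t\<in>{a..b} - N'. (x has_vector_derivative v t) (at t within {a..b}) \<and> v t \<in> G t)"
proof -
  have dom: "norm (x t - x s) \<le> integral {s..t} m" if "a \<le> s" "s \<le> t" "t \<le> b" for s t
    by (rule limit_increment_norm_le[OF m(1) u bound conv that])
  obtain v N1 where N1: "negligible N1"
    and v: "\<And>t. t \<in> {a..b} - N1 \<Longrightarrow> (x has_vector_derivative v t) (at t within {a..b})"
    using dominated_has_vector_derivative_ae[OF \<open>a \<le> b\<close> m dom] by blast
  obtain D :: "'a set" where D: "countable D" "\<And>X. open X \<Longrightarrow> X \<noteq> {} \<Longrightarrow> \<exists>q\<in>D. q \<in> X"
    using countable_dense_exists by blast
  \<comment> \<open>Taking the supremum over a tail makes the bound hold for all later n at once,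
    hence also for the limit increments, and leaves the tail index k free to be chosen after the
    time t.\<close>
  define W where "W = (\<lambda>p k t. SUP n\<in>{k::nat..}. p \<bullet> u n t)"
  have pu_le: "\<bar>p \<bullet> u n t\<bar> \<le> norm p * m t" if "t \<in> {a..b}" for p n t
    using Cauchy_Schwarz_ineq2[of p "u n t"] mult_left_mono[OF bound[OF that] norm_ge_zero[of p], of n] by linarith
  have bdd: "bdd_above ((\<lambda>n. p \<bullet> u n t) ` K)" if "t \<in> {a..b}" for p t K
    using pu_le[OF that] by (intro bdd_aboveI2[of _ _ "norm p * m t"]) (simp add: abs_le_iff)
  have u_int: "u n integrable_on {a..b}" for n
    using u[of a b n] \<open>a \<le> b\<close> by auto
  have pu_int: "(\<lambda>t. p \<bullet> u n t) integrable_on {s..t}" if "a \<le> s" "t \<le> b" for p n s t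
    using integrable_linear[OF integrable_on_subinterval[OF u_int[of n]] bounded_linear_inner_right[of p], of s t] that
    by (auto simp: o_def)
  have u_meas: "u n \<in> borel_measurable (lebesgue_on {a..b})" for n
    by (rule integrable_imp_measurable[OF u_int])
  have W_abs: "\<bar>W p k t\<bar> \<le> norm p * m t" if "t \<in> {a..b}" for p k t
  proof -
    have "W p k t \<le> norm p * m t"
      unfolding W_def using pu_le[OF that] by (intro cSUP_least) (auto simp: abs_le_iff)
    moreover have "p \<bullet> u k t \<le> W p k t"
      unfolding W_def by (intro cSUP_upper bdd that) auto
    ultimately show ?thesis
      using pu_le[OF that, of p k] by linarith
  qed
  have W_int: "W p k integrable_on {a..b}" for p k
  proof (rule measurable_bounded_by_integrable_imp_integrable_real)
    show "W p k \<in> borel_measurable (lebesgue_on {a..b})"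
      unfolding W_def
    proof (rule borel_measurable_cSUP)
      show "(\<lambda>t. p \<bullet> u n t) \<in> borel_measurable (lebesgue_on {a..b})" for n
        by (intro borel_measurable_inner borel_measurable_const u_meas)
    qed (use bdd in auto)
    show "(\<lambda>t. norm p * m t) integrable_on {a..b}"
      using integrable_cmul[OF m(1), of "norm p"] by simp
  qed (use W_abs in auto)
  have W_incr: "p \<bullet> (x t - x s) \<le> integral {s..t} (W p k)" if st: "a \<le> s" "s \<le> t" "t \<le> b" for p k s t
  proof (rule LIMSEQ_le_const2)
    show "(\<lambda>n. p \<bullet> (E n t - E n s)) \<longlonglongrightarrow> p \<bullet> (x t - x s)"
      using st by (intro tendsto_intros conv) auto
    have "p \<bullet> (E n t - E n s) \<le> integral {s..t} (W p k)" if "n \<ge> k" for n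
    proof -
      have "p \<bullet> (E n t - E n s) = integral {s..t} (\<lambda>\<tau>. p \<bullet> u n \<tau>)"
        using has_integral_linear[OF u[OF st, of n] bounded_linear_inner_right[of p]]
        by (simp add: o_def integral_unique)
      also have "\<dots> \<le> integral {s..t} (W p k)"
      proof (rule integral_le[OF pu_int])
        show "W p k integrable_on {s..t}"
          by (rule integrable_on_subinterval[OF W_int]) (use st in auto)
        show "p \<bullet> u n \<tau> \<le> W p k \<tau>" if "\<tau> \<in> {s..t}" for \<tau>
          unfolding W_def using that st \<open>n \<ge> k\<close> by (intro cSUP_upper bdd) auto
      qed (use st in auto)
      finally show ?thesis .
    qed
    then show "\<exists>n0. \<forall>n\<ge>n0. p \<bullet> (E n t - E n s) \<le> integral {s..t} (W p k)"
      by blast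
  qed
  have "\<exists>N. negligible N \<and> (\<forall>t\<in>{a..b} - N.
      ((\<lambda>\<tau>. integral {a..\<tau>} (W p k)) has_vector_derivative W p k t) (at t within {a..b}))" for p k
    using indefinite_integral_has_vector_derivative_ae[OF W_int] by metis
  then obtain NW where NW: "\<And>p k. negligible (NW p k)"
    "\<And>p k t. t \<in> {a..b} - NW p k \<Longrightarrow>
      ((\<lambda>\<tau>. integral {a..\<tau>} (W p k)) has_vector_derivative W p k t) (at t within {a..b})"
    by metis
  \<comment> \<open>The integral of \<open>W p k\<close> minus p \<bullet> x is nondecreasing by the
    increment bound, so its derivative is nonnegative wherever it exists.\<close>
  have v_le_W: "p \<bullet> v t \<le> W p k t" if t: "a < t" "t < b" "t \<notin> N1" "t \<notin> NW p k" for p k t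
  proof -
    have "((\<lambda>\<tau>. integral {a..\<tau>} (W p k) - p \<bullet> x \<tau>) has_vector_derivative (W p k t - p \<bullet> v t)) (at t within {a..b})"
      using t by (intro has_vector_derivative_diff NW(2) v
          bounded_linear.has_vector_derivative[OF bounded_linear_inner_right]) auto
    then have "0 \<le> W p k t - p \<bullet> v t"
    proof (rule mono_has_vector_derivative_nonneg[rotated])
      fix s \<tau> assume st: "a \<le> s" "s \<le> \<tau>" "\<tau> \<le> b"
      have "W p k integrable_on {a..\<tau>}"
        by (rule integrable_on_subinterval[OF W_int]) (use st in auto)
      then have "integral {a..s} (W p k) + integral {s..\<tau>} (W p k) = integral {a..\<tau>} (W p k)"
        using st by (intro Henstock_Kurzweil_Integration.integral_combine) auto
      then show "integral {a..s} (W p k) - p \<bullet> x s \<le> integral {a..\<tau>} (W p k) - p \<bullet> x \<tau>"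
        using W_incr[OF st, of p k] by (simp add: inner_diff_right)
    qed (use t in auto)
    then show ?thesis by simp
  qed
  \<comment> \<open>The endpoints are dropped because the derivative comparison uses a two-sided
    neighbourhood. Only the directions in \<open>D\<close> enter, so the union of the sets
    \<open>NW p k\<close> is countable.\<close>
  define N' where "N' = N \<union> N1 \<union> {a, b} \<union> (\<Union>p\<in>D. \<Union>k. NW p k)"
  show ?thesis
  proof (intro exI conjI ballI)
    have "negligible (\<Union>p\<in>D. \<Union>k. NW p k)"
      using D(1) NW(1) by (intro negligible_countable_Union) auto
    then show "negligible N'"
      unfolding N'_def using N N1 by (intro negligible_Un) auto
    fix t assume t: "t \<in> {a..b} - N'"
    show "(x has_vector_derivative v t) (at t within {a..b})"
      using t v by (auto simp: N'_def)
    show "v t \<in> G t"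
    proof -
      have tN: "t \<in> {a..b} - N" "a < t" "t < b" "t \<notin> N1" "\<And>p k. p \<in> D \<Longrightarrow> t \<notin> NW p k"
        using t by (auto simp: N'_def less_le)
      show ?thesis
      proof (rule mem_convex_compactI[OF D(2)])
        show "convex (G t)" "compact (G t)"
          using G[OF tN(1)] by auto
        fix q and \<epsilon> :: real assume q: "q \<in> D" "0 < \<epsilon>"
        define \<delta> where "\<delta> = \<epsilon> / (2 * (norm q + 1))"
        have "\<delta> > 0" using q(2) by (simp add: \<delta>_def add_nonneg_pos)
        then have "\<forall>\<^sub>F n in sequentially. infdist (u n t) (G t) < \<delta>"
          using near[OF tN(1)] by (intro order_tendstoD(2)) auto
        then obtain k where k: "\<And>n. n \<ge> k \<Longrightarrow> infdist (u n t) (G t) < \<delta>"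
          by (auto simp: eventually_sequentially)
        have "q \<bullet> v t \<le> W q k t"
          using v_le_W tN q(1) by blast
        also have "\<dots> < W q k t + \<epsilon> / 2"
          using q(2) by simp
        finally have "q \<bullet> v t - \<epsilon> / 2 < W q k t"
          by simp
        then obtain n where n: "n \<ge> k" "q \<bullet> v t - \<epsilon> / 2 < q \<bullet> u n t"
          unfolding W_def using tN by (subst (asm) less_cSUP_iff) (auto intro: bdd)
        obtain y where y: "y \<in> G t" "infdist (u n t) (G t) = dist (u n t) y"
          using infdist_attains_inf[of "G t" "u n t"] G[OF tN(1)] compact_imp_closed by blast
        have "q \<bullet> (u n t - y) \<le> norm q * norm (u n t - y)"
          by (rule norm_cauchy_schwarz)
        also have "\<dots> \<le> (norm q + 1) * \<delta>"
          using k[OF n(1)] y(2) by (intro mult_mono) (auto simp: dist_norm)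
        also have "\<dots> = \<epsilon> / 2"
          using add_nonneg_pos[OF norm_ge_zero zero_less_one, of q]
          by (simp add: \<delta>_def del: distrib_left_numeral)
        finally have "q \<bullet> u n t \<le> q \<bullet> y + \<epsilon> / 2"
          by (simp add: inner_diff_right)
        then show "\<exists>y\<in>G t. q \<bullet> v t < q \<bullet> y + \<epsilon>"
          using n(2) y(1) by (intro bexI[of _ y]) auto
      qed
    qed
  qed
qed

section \<open>The potential and the decay of solutions outside a ball\<close>

lemma AE_lebesgue_on_Icc_iff:
  "(AE t in lebesgue_on {a..b::real}. P t) \<longleftrightarrow> (\<exists>N. negligible N \<and> (\<forall>t\<in>{a..b} - N. P t))"
proof -
  have "(AE t in lebesgue_on {a..b}. P t) \<longleftrightarrow> (AE t in lebesgue. t \<in> {a..b} \<longrightarrow> P t)"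
    by (intro AE_restrict_space_iff) auto
  also have "\<dots> \<longleftrightarrow> (\<exists>N. negligible N \<and> (\<forall>t\<in>{a..b} - N. P t))"
    unfolding eventually_ae_filter_negligible by blast
  finally show ?thesis .
qed

lemma differentiable_imp_GDERIV_grad:
  fixes V :: "real ^ 'n \<Rightarrow> real"
  assumes "V differentiable (at x)"
  shows "GDERIV V x :> grad V x"
proof -
  obtain L where L: "(V has_derivative L) (at x)"
    using assms by (auto simp: differentiable_def)
  have "L h = h \<bullet> adjoint L 1" for h
    using adjoint_works[OF has_derivative_linear[OF L], of h 1] by simp
  then have "L = (\<lambda>h. h \<bullet> adjoint L 1)"
    by (rule ext)
  then have "GDERIV V x :> adjoint L 1"
    using L by (simp add: gderiv_def)
  then show ?thesis
    using grad_eqI by metis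
qed

text \<open>Monotonicity makes the gradient a nonnegative multiple of \<open>x\<close>.\<close>

lemma monotone_potential_inner_neg:
  fixes V :: "real ^ 'n \<Rightarrow> real"
  assumes V: "monotone_potential V" "V differentiable (at x)" and "x \<noteq> 0" and w: "grad V x \<bullet> w < 0"
  shows "x \<bullet> w < 0"
proof (rule ccontr)
  assume "\<not> x \<bullet> w < 0"
  let ?D = "grad V x"
  have descent: "?D \<bullet> h \<le> 0" if h: "x \<bullet> h < 0" for h
  proof (rule ccontr)
    assume "\<not> ?D \<bullet> h \<le> 0"
    have "h \<noteq> 0" using h by auto
    have "((\<lambda>s. V (x + s *\<^sub>R h)) has_derivative (\<lambda>s. (s *\<^sub>R h) \<bullet> ?D)) (at 0)"
    proof (rule has_derivative_compose[where g = V])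
      show "((\<lambda>s. x + s *\<^sub>R h) has_derivative (\<lambda>s. s *\<^sub>R h)) (at 0)"
        by (auto intro!: derivative_eq_intros)
      show "(V has_derivative (\<lambda>y. y \<bullet> ?D)) (at (x + 0 *\<^sub>R h))"
        using differentiable_imp_GDERIV_grad[OF V(2)] by (simp add: gderiv_def)
    qed
    then have "((\<lambda>s. V (x + s *\<^sub>R h)) has_real_derivative (?D \<bullet> h)) (at 0)"
      by (simp add: has_field_derivative_def inner_commute mult.commute mult_commute_abs)
    then obtain d where d: "d > 0" "\<And>s. \<lbrakk>0 < s; s < d\<rbrakk> \<Longrightarrow> V x < V (x + s *\<^sub>R h)"
      using DERIV_pos_inc_right[of "\<lambda>s. V (x + s *\<^sub>R h)" "?D \<bullet> h" 0] \<open>\<not> ?D \<bullet> h \<le> 0\<close> by auto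
    \<comment> \<open>The second entry is the largest step for which x + s h is no longer than x, by
      expanding the square of the norm; the first keeps s inside the range where V
      increases.\<close>
    define s where "s = min (d / 2) (- 2 * (x \<bullet> h) / (h \<bullet> h))"
    have "s > 0" "s < d" "s * (h \<bullet> h) \<le> - 2 * (x \<bullet> h)"
      using d(1) h \<open>h \<noteq> 0\<close> by (auto simp: s_def min_def field_simps)
    have "(norm (x + s *\<^sub>R h))\<^sup>2 = (norm x)\<^sup>2 + s * (2 * (x \<bullet> h) + s * (h \<bullet> h))"
      by (simp add: power2_norm_eq_inner inner_add inner_commute algebra_simps)
    also have "\<dots> \<le> (norm x)\<^sup>2"
      using \<open>s > 0\<close> \<open>s * (h \<bullet> h) \<le> - 2 * (x \<bullet> h)\<close> by (simp add: mult_nonneg_nonpos)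
    finally have "norm (x + s *\<^sub>R h) \<le> norm x"
      by (rule power2_le_imp_le) simp
    then have "V (x + s *\<^sub>R h) \<le> V x"
      using V(1) unfolding monotone_potential_def by blast
    then show False
      using d(2)[OF \<open>s > 0\<close> \<open>s < d\<close>] by simp
  qed
  \<comment> \<open>Tilting -w by a small multiple of x makes its inner product with x strictly
    negative. The size of e is chosen so that the gradient still has positive inner product with the
    tilted vector, against \<open>descent\<close>.\<close>
  define e where "e = - (?D \<bullet> w) / (2 * (\<bar>?D \<bullet> x\<bar> + 1))"
  have "e > 0"
    using w unfolding e_def by (intro divide_pos_pos) auto
  have "e * (x \<bullet> x) > 0"
    using \<open>e > 0\<close> \<open>x \<noteq> 0\<close> by simp
  then have "x \<bullet> (- w - e *\<^sub>R x) < 0"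
    using \<open>\<not> x \<bullet> w < 0\<close> unfolding inner_diff_right inner_scaleR_right inner_minus_right
    by linarith
  then have "?D \<bullet> (- w - e *\<^sub>R x) \<le> 0"
    by (rule descent)
  then have "- (?D \<bullet> w) \<le> e * (?D \<bullet> x)"
    by (simp add: inner_diff_right)
  also have "\<dots> \<le> e * (\<bar>?D \<bullet> x\<bar> + 1)"
    using \<open>e > 0\<close> by (intro mult_left_mono) auto
  also have "\<dots> = - (?D \<bullet> w) / 2"
    by (simp add: e_def field_simps)
  finally show False
    using w by simp
qed

text \<open>Monotonicity applied in both directions makes V constant on spheres, so the intermediate
  value theorem along a single ray finds a whole sphere. It lies strictly outside radius R since V
  stays below r on that ball.\<close>

lemma coercive_monotone_level_sphere:
  fixes V :: "real ^ 'n \<Rightarrow> real"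
  assumes V: "continuous_on UNIV V" "monotone_potential V" "coercive V"
    and "R \<ge> 0" and r: "r > Sup {V x | x. norm x \<le> R}"
  obtains \<rho> where "\<rho> > R" "\<And>x. norm x = \<rho> \<Longrightarrow> V x = r"
proof -
  obtain e :: "real ^ 'n" where e: "norm e = 1"
    using vector_choose_size[of 1] by auto
  have norm_e: "norm (s *\<^sub>R e) = s" if "s \<ge> 0" for s
    using that e by simp
  have mono: "V x \<le> V y" if "norm x \<le> norm y" for x y
    using V(2) that by (auto simp: monotone_potential_def)
  have low: "V x < r" if "norm x \<le> R" for x
  proof -
    have "V x \<le> Sup {V x | x. norm x \<le> R}"
    proof (rule cSup_upper)
      show "bdd_above {V x |x. norm x \<le> R}"
        using mono norm_e[OF \<open>R \<ge> 0\<close>] by (intro bdd_aboveI[of _ "V (R *\<^sub>R e)"]) auto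
    qed (use that in auto)
    then show ?thesis using r by simp
  qed
  have "\<forall>\<^sub>F x in at_infinity. r \<le> V x"
    using V(3) by (simp add: coercive_def filterlim_at_top)
  then obtain B where B: "\<And>x. B \<le> norm x \<Longrightarrow> r \<le> V x"
    by (auto simp: eventually_at_infinity)
  define S where "S = max R B"
  have "\<exists>s\<ge>R. s \<le> S \<and> V (s *\<^sub>R e) = r"
  proof (rule IVT')
    show "V (R *\<^sub>R e) \<le> r"
      using low[of "R *\<^sub>R e"] norm_e[OF \<open>R \<ge> 0\<close>] by simp
    show "r \<le> V (S *\<^sub>R e)"
      using \<open>R \<ge> 0\<close> by (intro B, subst norm_e) (auto simp: S_def)
    show "continuous_on {R..S} (\<lambda>s. V (s *\<^sub>R e))"
      by (rule continuous_on_compose2[OF V(1)]) (auto intro!: continuous_intros)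
  qed (simp add: S_def)
  then obtain \<rho> where \<rho>: "\<rho> \<ge> R" "V (\<rho> *\<^sub>R e) = r" by blast
  have "V x = r" if "norm x = \<rho>" for x
  proof (rule antisym)
    have "norm (\<rho> *\<^sub>R e) = norm x"
      using norm_e[of \<rho>] that \<rho>(1) \<open>R \<ge> 0\<close> by linarith
    then show "V x \<le> r" "r \<le> V x"
      using mono[of x "\<rho> *\<^sub>R e"] mono[of "\<rho> *\<^sub>R e" x] \<rho>(2) by simp_all
  qed
  moreover have "\<rho> > R"
    using low[of "\<rho> *\<^sub>R e"] \<rho> norm_e[of \<rho>] \<open>R \<ge> 0\<close> by (cases "\<rho> = R") auto
  ultimately show thesis
    using that by blast
qed

text \<open>The squared norm is again dominated, hence the integral of its derivative, which is
  negative almost everywhere; this gives weak decrease.\<close>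

lemma norm_decreasing_if_inward:
  fixes x :: "real \<Rightarrow> 'a::euclidean_space"
  assumes "a < b" and m: "m integrable_on {a..b}" "\<And>t. t \<in> {a..b} \<Longrightarrow> 0 \<le> m t"
    and dom: "\<And>s t. \<lbrakk>a \<le> s; s \<le> t; t \<le> b\<rbrakk> \<Longrightarrow> norm (x t - x s) \<le> integral {s..t} m"
    and N: "negligible N"
    and v: "\<And>t. t \<in> {a..b} - N \<Longrightarrow> (x has_vector_derivative v t) (at t within {a..b}) \<and> x t \<bullet> v t < 0"
  shows "norm (x b) < norm (x a)"
proof -
  define q where "q = (\<lambda>t. x t \<bullet> x t)"
  define K where "K = norm (x a) + integral {a..b} m"
  have int_le: "integral {s..t} m \<le> integral {a..b} m" if "a \<le> s" "s \<le> t" "t \<le> b" for s t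
  proof (rule integral_subset_le)
    show "m integrable_on {s..t}"
      by (rule integrable_on_subinterval[OF m(1)]) (use that in auto)
  qed (use that m in auto)
  have K: "norm (x t) \<le> K" if "t \<in> {a..b}" for t
    using norm_triangle_sub[of "x t" "x a"] dom[of a t] int_le[of a t] that by (auto simp: K_def)
  have "K \<ge> 0"
    using K[of a] norm_ge_zero[of "x a"] \<open>a < b\<close> by (auto simp del: norm_ge_zero)
  have q_dom: "norm (q t - q s) \<le> integral {s..t} (\<lambda>\<tau>. 2 * K * m \<tau>)" if st: "a \<le> s" "s \<le> t" "t \<le> b" for s t
  proof -
    have "q t - q s = (x t + x s) \<bullet> (x t - x s)"
      by (simp add: q_def algebra_simps inner_commute)
    then have "norm (q t - q s) \<le> norm (x t + x s) * norm (x t - x s)"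
      using Cauchy_Schwarz_ineq2[of "x t + x s" "x t - x s"] by simp
    also have "\<dots> \<le> (2 * K) * integral {s..t} m"
      using dom[OF st] K[of s] K[of t] st norm_triangle_ineq[of "x t" "x s"] \<open>K \<ge> 0\<close> by (intro mult_mono) auto
    finally show ?thesis by simp
  qed
  have q_ac: "abs_continuous_on {s..t} q" if st: "a \<le> s" "s \<le> t" "t \<le> b" for s t
  proof (rule abs_continuous_on_dominated[of "\<lambda>\<tau>. 2 * K * m \<tau>"])
    show "(\<lambda>\<tau>. 2 * K * m \<tau>) integrable_on {s..t}"
      using integrable_cmul[OF integrable_on_subinterval[OF m(1)], of s t "2 * K"] st by simp
  qed (use st m(2) \<open>K \<ge> 0\<close> q_dom in auto)
  have q_deriv: "(q has_vector_derivative 2 * (x t \<bullet> v t)) (at t within {a..b})" if "t \<in> {a..b} - N" for t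
  proof -
    have "(x has_derivative (\<lambda>h. h *\<^sub>R v t)) (at t within {a..b})"
      using v[OF that] by (simp add: has_vector_derivative_def)
    from has_derivative_inner[OF this this] show ?thesis
      by (simp add: q_def has_vector_derivative_def inner_commute algebra_simps)
  qed
  have q_mono: "q t \<le> q s" if st: "a \<le> s" "s \<le> t" "t \<le> b" for s t
  proof -
    have "((\<lambda>\<tau>. 2 * (x \<tau> \<bullet> v \<tau>)) has_integral (q t - q s)) {s..t}"
    proof (rule abs_continuous_on_has_integral[OF q_ac[OF st] st(2) N])
      show "(q has_vector_derivative 2 * (x \<tau> \<bullet> v \<tau>)) (at \<tau> within {s..t})" if "\<tau> \<in> {s..t} - N" for \<tau>
        by (rule has_vector_derivative_within_subset[OF q_deriv]) (use that st in auto)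
    qed
    then have "((\<lambda>\<tau>. if \<tau> \<in> N then 0 else 2 * (x \<tau> \<bullet> v \<tau>)) has_integral (q t - q s)) {s..t}"
      by (rule has_integral_spike[OF N, rotated]) auto
    then have "q t - q s \<le> 0"
    proof (rule has_integral_le[OF _ has_integral_0])
      show "(if \<tau> \<in> N then 0 else 2 * (x \<tau> \<bullet> v \<tau>)) \<le> 0" if "\<tau> \<in> {s..t}" for \<tau>
        using v[of \<tau>] that st by (auto simp: less_imp_le)
    qed
    then show ?thesis by simp
  qed
  \<comment> \<open>Strictness: equality at the ends would make the monotone \<open>q\<close>
    constant, with derivative 0 at some interior point off \<open>N\<close>.\<close>
  have "q b \<noteq> q a"
  proof
    assume "q b = q a"
    then have const: "q t = q a" if "t \<in> {a..b}" for t
      using q_mono[of a t] q_mono[of t b] that by auto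
    have "\<not> negligible {a<..<b}"
      using \<open>a < b\<close> open_not_negligible[of "{a<..<b}"] by auto
    then obtain t where t: "t \<in> {a<..<b}" "t \<notin> N"
      using N negligible_subset by blast
    have "(q has_vector_derivative 2 * (x t \<bullet> v t)) (at t)"
      using q_deriv[of t] t by (simp add: at_within_Icc_at)
    moreover have "(q has_vector_derivative 0) (at t)"
    proof (rule has_vector_derivative_transform_within_open[of "\<lambda>_. q a" _ _ "{a<..<b}"])
      show "q a = q s" if "s \<in> {a<..<b}" for s
        using const[of s] that by auto
    qed (use t in auto)
    ultimately have "2 * (x t \<bullet> v t) = 0"
      by (rule vector_derivative_unique_at)
    then show False
      using v[of t] t by auto
  qed
  then have "q b < q a"
    using q_mono[of a b] \<open>a < b\<close> by simp
  then show ?thesis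
    by (simp add: q_def norm_eq_sqrt_inner)
qed

text \<open>The curve is quantified inside the conclusion because d depends on \<open>m\<close> and
  e alone; this uniformity is what equicontinuity of a whole sequence needs.\<close>

lemma dominated_equicontinuous:
  assumes m: "m integrable_on {a..b::real}" and "0 < e"
  obtains d where "d > 0" and "\<And>(x :: real \<Rightarrow> 'a::euclidean_space) s t.
    \<lbrakk>\<And>s t. \<lbrakk>a \<le> s; s \<le> t; t \<le> b\<rbrakk> \<Longrightarrow> norm (x t - x s) \<le> integral {s..t} m;
      s \<in> {a..b}; t \<in> {a..b}; \<bar>s - t\<bar> < d\<rbrakk> \<Longrightarrow> norm (x s - x t) < e"
proof -
  define M where "M = (\<lambda>t. integral {a..t} m)"
  have "uniformly_continuous_on {a..b} M"
    unfolding M_def by (intro compact_uniformly_continuous indefinite_integral_continuous_1 m) auto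
  then obtain d where "d > 0" and d: "\<And>s t. \<lbrakk>s \<in> {a..b}; t \<in> {a..b}; dist s t < d\<rbrakk> \<Longrightarrow> dist (M s) (M t) < e"
    using \<open>0 < e\<close> unfolding uniformly_continuous_on_def by metis
  have M_diff: "integral {s..t} m = M t - M s" if "a \<le> s" "s \<le> t" "t \<le> b" for s t
  proof -
    have "m integrable_on {a..t}"
      by (rule integrable_on_subinterval[OF m]) (use that in auto)
    then have "integral {a..s} m + integral {s..t} m = integral {a..t} m"
      using that by (intro Henstock_Kurzweil_Integration.integral_combine) auto
    then show ?thesis by (simp add: M_def)
  qed
  show thesis
  proof (rule that[OF \<open>d > 0\<close>])
    fix x :: "real \<Rightarrow> 'a" and s t
    assume dom: "\<And>s t. \<lbrakk>a \<le> s; s \<le> t; t \<le> b\<rbrakk> \<Longrightarrow> norm (x t - x s) \<le> integral {s..t} m"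
      and st: "s \<in> {a..b}" "t \<in> {a..b}" "\<bar>s - t\<bar> < d"
    have "dist (M s) (M t) < e"
      using d[OF st(1,2)] st(3) by (simp add: dist_real_def)
    then show "norm (x s - x t) < e"
      using dom[of s t] dom[of t s] M_diff[of s t] M_diff[of t s] st
      by (cases "s \<le> t") (auto simp: dist_real_def norm_minus_commute)
  qed
qed

lemma dominated_continuous_on:
  fixes x :: "real \<Rightarrow> 'a::euclidean_space"
  assumes m: "m integrable_on {a..b}"
    and dom: "\<And>s t. \<lbrakk>a \<le> s; s \<le> t; t \<le> b\<rbrakk> \<Longrightarrow> norm (x t - x s) \<le> integral {s..t} m"
  shows "continuous_on {a..b} x"
  unfolding continuous_on_iff dist_norm
proof (intro ballI allI impI)
  fix s e :: real assume "s \<in> {a..b}" "0 < e"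
  then show "\<exists>d>0. \<forall>t\<in>{a..b}. norm (t - s) < d \<longrightarrow> norm (x t - x s) < e"
    using dominated_equicontinuous[OF m \<open>0 < e\<close>, where 'a = 'a] dom
    by (smt (verit) real_norm_def)
qed

text \<open>
  The bound is claimed only from norms above \<open>R\<close>: a curve starting on the sphere of radius \<open>R\<close> may
  dip into the ball and touch the sphere again at an exceptional time.
\<close>

lemma norm_decreasing_outside_ball:
  fixes x :: "real \<Rightarrow> 'a::euclidean_space"
  assumes m: "m integrable_on {a..b}" "\<And>t. t \<in> {a..b} \<Longrightarrow> 0 \<le> m t"
    and dom: "\<And>s t. \<lbrakk>a \<le> s; s \<le> t; t \<le> b\<rbrakk> \<Longrightarrow> norm (x t - x s) \<le> integral {s..t} m"
    and N: "negligible N"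
    and v: "\<And>t. t \<in> {a..b} - N \<Longrightarrow> (x has_vector_derivative v t) (at t within {a..b})"
    and inward: "\<And>t. \<lbrakk>t \<in> {a..b} - N; R \<le> norm (x t)\<rbrakk> \<Longrightarrow> x t \<bullet> v t < 0"
    and t: "a < t" "t \<le> b" "R < norm (x t)"
  shows "norm (x t) < norm (x a)"
proof -
  have cont: "continuous_on {a..b} x"
    by (rule dominated_continuous_on[OF m(1) dom])
  have decr: "norm (x t) < norm (x s)" if s: "a \<le> s" "s < t" "\<And>\<tau>. \<tau> \<in> {s..t} \<Longrightarrow> R \<le> norm (x \<tau>)" for s
  proof (rule norm_decreasing_if_inward[OF s(2) _ _ _ N])
    show "m integrable_on {s..t}"
      by (rule integrable_on_subinterval[OF m(1)]) (use s t in auto)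
    show "(x has_vector_derivative v \<tau>) (at \<tau> within {s..t}) \<and> x \<tau> \<bullet> v \<tau> < 0" if "\<tau> \<in> {s..t} - N" for \<tau>
      using that s t by (auto intro!: inward has_vector_derivative_within_subset[OF v])
  qed (use s t m dom in auto)
  show ?thesis
  proof (cases "\<forall>\<tau>\<in>{a..t}. R \<le> norm (x \<tau>)")
    case True
    then show ?thesis
      using decr[of a] t by auto
  next
    case False
    \<comment> \<open>\<open>Sup S\<close> is the last visit to the ball before t. By continuity the
      norm there is exactly R, and from then on the curve stays outside, so it would have to
      decrease below R, although its norm at t exceeds R.\<close>
    define S where "S = {\<tau> \<in> {a..t}. norm (x \<tau>) \<le> R}"
    have "closed S"
    proof -
      have "continuous_on {a..t} (\<lambda>\<tau>. norm (x \<tau>))"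
        using t by (intro continuous_on_norm continuous_on_subset[OF cont]) auto
      moreover have "S = {a..t} \<inter> (\<lambda>\<tau>. norm (x \<tau>)) -` {..R}"
        by (auto simp: S_def)
      ultimately show ?thesis
        by (simp add: continuous_closed_preimage)
    qed
    moreover have "S \<noteq> {}" "bdd_above S"
      using False by (auto simp: S_def intro!: bdd_aboveI[of _ t])
    ultimately have "Sup S \<in> S"
      by (rule closed_contains_Sup[rotated 2])
    then have s: "a \<le> Sup S" "Sup S \<le> t" "norm (x (Sup S)) \<le> R"
      by (auto simp: S_def)
    have "Sup S < t"
      using s t by (cases "Sup S = t") auto
    have above: "R < norm (x \<tau>)" if "Sup S < \<tau>" "\<tau> \<le> t" for \<tau>
      using cSup_upper[of \<tau> S] \<open>bdd_above S\<close> that s by (force simp: S_def)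
    have "R \<le> norm (x (Sup S))"
    proof (rule ccontr)
      assume less: "\<not> R \<le> norm (x (Sup S))"
      have "continuous_on {Sup S..t} (\<lambda>\<tau>. norm (x \<tau>))"
        using s t by (intro continuous_on_norm continuous_on_subset[OF cont]) auto
      then have "\<exists>\<tau>\<ge>Sup S. \<tau> \<le> t \<and> norm (x \<tau>) = R"
        using less s t by (intro IVT') auto
      then obtain \<tau> where "Sup S \<le> \<tau>" "\<tau> \<le> t" "norm (x \<tau>) = R"
        by blast
      then show False
        using above[of \<tau>] less by (cases "\<tau> = Sup S") auto
    qed
    then have "norm (x t) < norm (x (Sup S))"
      using above s \<open>Sup S < t\<close> by (intro decr) (auto simp: le_less)
    then show ?thesis
      using s t by simp
  qed
qed

section \<open>Selections, partitions of unity and fixed points\<close>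

text \<open>The element of least norm is unique by convexity, so whether it belongs to a closed set
  can be read off from the distances to 0 of \<Phi> t and of its part in that set, and rational
  radii suffice for the comparison.\<close>

lemma closest_point_measurable:
  fixes \<Phi> :: "'b \<Rightarrow> 'a::euclidean_space set"
  assumes \<Phi>: "\<And>t. t \<in> space M \<Longrightarrow> \<Phi> t \<noteq> {} \<and> convex (\<Phi> t) \<and> compact (\<Phi> t)"
    and meas: "\<And>A. closed A \<Longrightarrow> {t \<in> space M. \<Phi> t \<subseteq> A} \<in> sets M"
  shows "(\<lambda>t. closest_point (\<Phi> t) 0) \<in> borel_measurable M"
proof -
  have meas_open: "{t \<in> space M. \<Phi> t \<subseteq> U} \<in> sets M" if U: "open U" for U
  proof (cases "U = UNIV")
    case False
    \<comment> \<open>Closed sets exhausting U, to which the hypothesis applies; compactness puts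
      \<Phi> t inside one of them as soon as it lies in U. The case U = UNIV is separate since
      \<open>infdist\<close> to the empty set is 0.\<close>
    define A where "A = (\<lambda>n. {x. inverse (real (Suc n)) \<le> infdist x (- U)})"
    have "{t \<in> space M. \<Phi> t \<subseteq> U} = (\<Union>n. {t \<in> space M. \<Phi> t \<subseteq> A n})"
    proof (intro equalityI subsetI)
      fix t assume "t \<in> {t \<in> space M. \<Phi> t \<subseteq> U}"
      then have t: "t \<in> space M" "\<Phi> t \<inter> - U = {}" by auto
      then obtain d where d: "d > 0" "\<And>x y. \<lbrakk>x \<in> \<Phi> t; y \<in> - U\<rbrakk> \<Longrightarrow> d \<le> dist x y"
        using separate_compact_closed[of "\<Phi> t" "- U"] \<Phi>[OF t(1)] U by (auto simp: closed_def)
      obtain n where n: "inverse (real (Suc n)) < d"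
        using reals_Archimedean[OF d(1)] by blast
      have "x \<in> A n" if "x \<in> \<Phi> t" for x
      proof -
        have "d \<le> infdist x (- U)"
          unfolding infdist_def using False d(2)[OF that] by (auto intro!: cINF_greatest)
        then show ?thesis
          using n by (simp add: A_def)
      qed
      then show "t \<in> (\<Union>n. {t \<in> space M. \<Phi> t \<subseteq> A n})"
        using t(1) by blast
    next
      fix t assume "t \<in> (\<Union>n. {t \<in> space M. \<Phi> t \<subseteq> A n})"
      then obtain n where t: "t \<in> space M" "\<Phi> t \<subseteq> A n" by blast
      have "x \<in> U" if "x \<in> A n" for x
      proof (rule ccontr)
        assume "x \<notin> U"
        then have "infdist x (- U) = 0" by simp
        with that show False by (simp add: A_def)
      qed
      then show "t \<in> {t \<in> space M. \<Phi> t \<subseteq> U}"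
        using t by auto
    qed
    moreover have "closed (A n)" for n
      unfolding A_def by (intro closed_Collect_le continuous_intros)
    ultimately show ?thesis
      by (simp only:) (intro sets.countable_UN image_subsetI meas)
  qed auto
  have "(\<lambda>t. closest_point (\<Phi> t) 0) \<in> measurable M (sigma UNIV (Collect closed))"
  proof (rule measurable_measure_of)
    fix C :: "'a set" assume "C \<in> Collect closed"
    then have C: "closed C" by simp
    \<comment> \<open>The condition at q reads: if \<Phi> t meets \<open>ball 0 q\<close>, then it
      meets \<open>C \<inter> cball 0 q\<close>. Over all rational q this says that the part of
      \<Phi> t in C comes as close to 0 as \<Phi> t itself.\<close>
    have "(\<lambda>t. closest_point (\<Phi> t) 0) -` C \<inter> space M =
      (\<Inter>q\<in>\<rat>. {t \<in> space M. \<Phi> t \<subseteq> - ball 0 q} \<union> (space M - {t \<in> space M. \<Phi> t \<subseteq> - (C \<inter> cball 0 q)})) \<inter> space M"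
    proof (intro equalityI subsetI)
      fix t assume t: "t \<in> (\<lambda>t. closest_point (\<Phi> t) 0) -` C \<inter> space M"
      then have ts: "t \<in> space M" by simp
      note \<Phi>t = \<Phi>[OF ts]
      have in_\<Phi>: "closest_point (\<Phi> t) 0 \<in> \<Phi> t"
        using \<Phi>t compact_imp_closed closest_point_in_set by blast
      have "\<Phi> t \<subseteq> - ball 0 q \<or> \<not> \<Phi> t \<subseteq> - (C \<inter> cball 0 q)" for q
      proof (cases "norm (closest_point (\<Phi> t) 0) \<le> q")
        case True
        then show ?thesis
          using in_\<Phi> t by auto
      next
        case False
        have "norm (closest_point (\<Phi> t) 0) \<le> norm y" if "y \<in> \<Phi> t" for y
          using closest_point_le[of "\<Phi> t" y 0] \<Phi>t that compact_imp_closed by auto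
        then show ?thesis
          using False by fastforce
      qed
      then show "t \<in> (\<Inter>q\<in>\<rat>. {t \<in> space M. \<Phi> t \<subseteq> - ball 0 q} \<union> (space M - {t \<in> space M. \<Phi> t \<subseteq> - (C \<inter> cball 0 q)})) \<inter> space M"
        using ts by auto
    next
      fix t assume t: "t \<in> (\<Inter>q\<in>\<rat>. {t \<in> space M. \<Phi> t \<subseteq> - ball 0 q} \<union> (space M - {t \<in> space M. \<Phi> t \<subseteq> - (C \<inter> cball 0 q)})) \<inter> space M"
      then have ts: "t \<in> space M" by simp
      note \<Phi>t = \<Phi>[OF ts]
      define c where "c = closest_point (\<Phi> t) 0"
      have c: "c \<in> \<Phi> t"
        unfolding c_def using \<Phi>t compact_imp_closed closest_point_in_set by blast
      have meet: "\<exists>y\<in>\<Phi> t \<inter> C. norm y \<le> q" if "q \<in> \<rat>" "norm c < q" for q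
      proof -
        have "\<not> \<Phi> t \<subseteq> - ball 0 q"
          using that(2) c by auto
        then have "\<not> \<Phi> t \<subseteq> - (C \<inter> cball 0 q)"
          using t that(1) by auto
        then show ?thesis by auto
      qed
      obtain q0 where "q0 \<in> \<rat>" "norm c < q0"
        using Rats_dense_in_real[of "norm c" "norm c + 1"] by auto
      then have "\<Phi> t \<inter> C \<noteq> {}"
        using meet by blast
      moreover have "compact (\<Phi> t \<inter> C)"
        using \<Phi>t C by (simp add: compact_Int_closed)
      ultimately obtain y where y: "y \<in> \<Phi> t \<inter> C" "\<And>z. z \<in> \<Phi> t \<inter> C \<Longrightarrow> norm y \<le> norm z"
        using continuous_attains_inf[of "\<Phi> t \<inter> C" norm] continuous_on_norm_id by blast
      have "norm y \<le> norm c"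
      proof (rule ccontr)
        assume "\<not> norm y \<le> norm c"
        then obtain q where "q \<in> \<rat>" "norm c < q" "q < norm y"
          using Rats_dense_in_real[of "norm c" "norm y"] by auto
        then show False
          using meet[of q] y(2) by fastforce
      qed
      have c_le: "norm c \<le> norm z" if "z \<in> \<Phi> t" for z
        unfolding c_def using closest_point_le[of "\<Phi> t" z 0] \<Phi>t that compact_imp_closed by auto
      have "y = c"
        unfolding c_def
      proof (rule closest_point_unique)
        show "\<forall>z\<in>\<Phi> t. dist 0 y \<le> dist 0 z"
          using c_le \<open>norm y \<le> norm c\<close> by (auto intro: order_trans)
      qed (use y(1) \<Phi>t in \<open>auto simp: compact_imp_closed\<close>)
      then show "t \<in> (\<lambda>t. closest_point (\<Phi> t) 0) -` C \<inter> space M"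
        using y(1) ts by (simp add: c_def)
    qed
    also have "\<dots> \<in> sets M"
    proof -
      have "{t \<in> space M. \<Phi> t \<subseteq> - ball 0 q} \<in> sets M" for q :: real
        by (rule meas) (simp add: closed_def)
      moreover have "{t \<in> space M. \<Phi> t \<subseteq> - (C \<inter> cball 0 q)} \<in> sets M" for q
        by (rule meas_open[OF open_Compl[OF closed_Int[OF C closed_cball]]])
      ultimately show ?thesis
        by (intro sets.Int sets.top sets.countable_INT' image_subsetI sets.Un sets.Diff countable_rat)
          (use Rats_0 in blast)
    qed
    finally show "(\<lambda>t. closest_point (\<Phi> t) 0) -` C \<inter> space M \<in> sets M" .
  qed auto
  then show ?thesis
    by (simp add: borel_eq_closed)
qed

text \<open>Tent functions of radius \<epsilon> around the points of a finite \<epsilon>-net,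
  divided by their sum. Off \<open>D\<close> the sum may vanish; the quotient is then 0, so
  nonnegativity and the support condition hold everywhere.\<close>

lemma compact_finite_partition_near:
  fixes D :: "'a::metric_space set"
  assumes "compact D" and "\<epsilon> > 0"
  obtains Y and w :: "'a \<Rightarrow> 'a \<Rightarrow> real" where "finite Y" "Y \<subseteq> D"
    "\<And>y. y \<in> Y \<Longrightarrow> continuous_on D (w y)" "\<And>x y. w y x \<ge> 0"
    "\<And>x. x \<in> D \<Longrightarrow> (\<Sum>y\<in>Y. w y x) = 1" "\<And>x y. w y x \<noteq> 0 \<Longrightarrow> dist y x < \<epsilon>"
proof -
  obtain Y where Y: "finite Y" "Y \<subseteq> D" "D \<subseteq> (\<Union>y\<in>Y. ball y \<epsilon>)"
    using compact_imp_seq_compact[OF \<open>compact D\<close>] seq_compact_imp_totally_bounded \<open>\<epsilon> > 0\<close> by metis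
  define \<phi> where "\<phi> = (\<lambda>(y::'a) (x::'a). max 0 (\<epsilon> - dist y x))"
  define S where "S = (\<lambda>x. \<Sum>y\<in>Y. \<phi> y x)"
  have \<phi>: "\<phi> y x \<ge> 0" for y x
    by (simp add: \<phi>_def)
  have S_nonneg: "S x \<ge> 0" for x
    unfolding S_def by (intro sum_nonneg \<phi>)
  have S_pos: "S x > 0" if "x \<in> D" for x
  proof -
    have "x \<in> (\<Union>y\<in>Y. ball y \<epsilon>)"
      using Y(3) that by blast
    then obtain y where y: "y \<in> Y" "dist y x < \<epsilon>"
      by auto
    have "0 < \<phi> y x"
      using y(2) by (simp add: \<phi>_def)
    also have "\<dots> \<le> S x"
      unfolding S_def using y(1) Y(1) \<phi> by (intro member_le_sum) auto
    finally show ?thesis .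
  qed
  show thesis
  proof
    show "finite Y" "Y \<subseteq> D" by fact+
    show "continuous_on D (\<lambda>x. \<phi> y x / S x)" if "y \<in> Y" for y
    proof (intro continuous_on_divide ballI)
      show "continuous_on D (\<phi> y)" "continuous_on D S"
        unfolding \<phi>_def S_def by (intro continuous_intros)+
      show "S x \<noteq> 0" if "x \<in> D" for x
        using S_pos[OF that] by simp
    qed
    show "\<phi> y x / S x \<ge> 0" for x y
      using \<phi> S_nonneg by simp
    show "(\<Sum>y\<in>Y. \<phi> y x / S x) = 1" if "x \<in> D" for x
      using S_pos[OF that] by (simp add: sum_divide_distrib[symmetric]) (simp add: S_def)
    show "dist y x < \<epsilon>" if "\<phi> y x / S x \<noteq> 0" for x y
      using that by (auto simp: \<phi>_def max_def split: if_splits)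
  qed
qed

lemma dominated_uniform_limit_subsequence:
  fixes E :: "nat \<Rightarrow> real \<Rightarrow> 'a::euclidean_space"
  assumes "a \<le> b" and m: "m integrable_on {a..b}" "\<And>t. t \<in> {a..b} \<Longrightarrow> 0 \<le> m t"
    and dom: "\<And>n s t. \<lbrakk>a \<le> s; s \<le> t; t \<le> b\<rbrakk> \<Longrightarrow> norm (E n t - E n s) \<le> integral {s..t} m"
    and B: "\<And>n. norm (E n a) \<le> B"
  obtains x k where "continuous_on {a..b} x" "strict_mono (k :: nat \<Rightarrow> nat)"
    "uniform_limit {a..b} (E \<circ> k) x sequentially"
proof (rule Arzela_Ascoli[of "{a..b}" E "B + integral {a..b} m"])
  show "norm (E n t) \<le> B + integral {a..b} m" if "t \<in> {a..b}" for n t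
  proof -
    have "integral {a..t} m \<le> integral {a..b} m"
    proof (rule integral_subset_le)
      show "m integrable_on {a..t}"
        by (rule integrable_on_subinterval[OF m(1)]) (use that in auto)
    qed (use that m in auto)
    then show ?thesis
      using norm_triangle_sub[of "E n t" "E n a"] dom[of a t n] B[of n] that by auto
  qed
  show "\<exists>d>0. \<forall>n t. t \<in> {a..b} \<and> norm (s - t) < d \<longrightarrow> norm (E n s - E n t) < e"
    if "s \<in> {a..b}" "0 < e" for s e
  proof -
    obtain d where "d > 0" and d: "\<And>(x :: real \<Rightarrow> 'a) s t.
      \<lbrakk>\<And>s t. \<lbrakk>a \<le> s; s \<le> t; t \<le> b\<rbrakk> \<Longrightarrow> norm (x t - x s) \<le> integral {s..t} m;
        s \<in> {a..b}; t \<in> {a..b}; \<bar>s - t\<bar> < d\<rbrakk> \<Longrightarrow> norm (x s - x t) < e"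
      using dominated_equicontinuous[OF m(1) \<open>0 < e\<close>, where 'a = 'a] by blast
    show ?thesis
      using \<open>d > 0\<close> d[OF dom] that(1) by (intro exI[of _ d]) auto
  qed
  fix x k
  assume x: "continuous_on {a..b} x" "strict_mono (k :: nat \<Rightarrow> nat)"
    and lim: "\<And>e. 0 < e \<Longrightarrow> \<exists>N. \<forall>n t. N \<le> n \<and> t \<in> {a..b} \<longrightarrow> norm (E (k n) t - x t) < e"
  have "uniform_limit {a..b} (E \<circ> k) x sequentially"
    unfolding uniform_limit_sequentially_iff dist_norm o_def using lim by blast
  with x show thesis
    by (rule that)
qed simp

text \<open>
  The homotopy is spread over the shell \<open>\<rho> \<le> |x| \<le> 2\<rho>\<close>, radially rescaled so that fixed points of the
  resulting self-map project to fixed points of the homotopy.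
\<close>

lemma homotopy_fixed_point:
  fixes H :: "real \<Rightarrow> 'a::euclidean_space \<Rightarrow> 'a"
  assumes "\<rho> > 0" and cont: "continuous_on ({0..1} \<times> cball 0 \<rho>) (\<lambda>(s, x). H s x)"
    and H0: "\<And>x. x \<in> cball 0 \<rho> \<Longrightarrow> H 0 x = 0"
  obtains s y where "s \<in> {0..1}" "norm y \<le> \<rho>" "H s y = y" "s = 1 \<or> norm y = \<rho>"
proof -
  define c where "c = (\<lambda>x::'a. max 1 (norm x / \<rho>))"
  define \<sigma> where "\<sigma> = (\<lambda>x::'a. min 1 (max 0 (2 - norm x / \<rho>)))"
  define \<Psi> where "\<Psi> = (\<lambda>x. c x *\<^sub>R H (\<sigma> x) (x /\<^sub>R c x))"
  have c: "c x \<ge> 1" for x by (simp add: c_def)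
  have c_pos: "c x > 0" for x
    using c[of x] by linarith
  have proj: "norm (x /\<^sub>R c x) \<le> \<rho>" for x
  proof -
    have "norm x \<le> c x * \<rho>"
      using \<open>\<rho> > 0\<close> by (simp add: c_def field_simps max_def)
    then show ?thesis
      using c_pos[of x] by (simp add: field_simps)
  qed
  have \<sigma>: "\<sigma> x \<in> {0..1}" for x
    by (simp add: \<sigma>_def)
  have contc: "continuous_on UNIV c" and cont\<sigma>: "continuous_on UNIV \<sigma>"
    unfolding c_def \<sigma>_def using \<open>\<rho> > 0\<close> by (intro continuous_intros; simp)+
  have cont\<Psi>: "continuous_on UNIV \<Psi>"
  proof -
    have "continuous_on UNIV (\<lambda>x. (\<sigma> x, x /\<^sub>R c x))"
      using c_pos by (intro continuous_intros contc cont\<sigma>) (auto simp: less_imp_neq[symmetric])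
    then have "continuous_on UNIV (\<lambda>x. (\<lambda>(s, x). H s x) (\<sigma> x, x /\<^sub>R c x))"
      by (rule continuous_on_compose2[OF cont]) (use \<sigma> proj in auto)
    then show ?thesis
      unfolding \<Psi>_def by (intro continuous_intros contc) simp
  qed
  \<comment> \<open>As H 0 vanishes, \<Psi> does so outside a compact ball and is bounded on the
    whole space; a ball whose radius is such a bound is mapped into itself.\<close>
  have outside: "\<Psi> x = 0" if "norm x \<ge> 2 * \<rho>" for x
  proof -
    have "\<sigma> x = 0"
      using that \<open>\<rho> > 0\<close> by (simp add: \<sigma>_def field_simps)
    then show ?thesis
      using H0[of "x /\<^sub>R c x"] proj[of x] by (simp add: \<Psi>_def)
  qed
  have "bounded (\<Psi> ` cball 0 (2 * \<rho>))"
    by (intro compact_imp_bounded compact_continuous_image continuous_on_subset[OF cont\<Psi>]) auto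
  then obtain B where B: "B > 0" "\<And>x. norm x \<le> 2 * \<rho> \<Longrightarrow> norm (\<Psi> x) \<le> B"
    unfolding bounded_pos by auto
  have "norm (\<Psi> x) \<le> B" for x
    using B outside[of x] by (cases "norm x \<le> 2 * \<rho>") auto
  then have "\<Psi> \<in> cball 0 B \<rightarrow> cball 0 B"
    by auto
  then obtain x where x: "\<Psi> x = x"
    using brouwer_ball[OF B(1) continuous_on_subset[OF cont\<Psi> subset_UNIV], of 0] by metis
  show thesis
  proof
    show "\<sigma> x \<in> {0..1}" "norm (x /\<^sub>R c x) \<le> \<rho>"
      by (fact \<sigma>, fact proj)
    have "(c x *\<^sub>R H (\<sigma> x) (x /\<^sub>R c x)) /\<^sub>R c x = x /\<^sub>R c x"
      using x by (simp add: \<Psi>_def)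
    then show "H (\<sigma> x) (x /\<^sub>R c x) = x /\<^sub>R c x"
      using c_pos[of x] by simp
    show "\<sigma> x = 1 \<or> norm (x /\<^sub>R c x) = \<rho>"
    proof (cases "norm x \<le> \<rho>")
      case True
      then show ?thesis
        using \<open>\<rho> > 0\<close> by (simp add: \<sigma>_def min_def max_def field_simps)
    next
      case False
      then have "c x = norm x / \<rho>"
        using \<open>\<rho> > 0\<close> by (simp add: c_def field_simps)
      moreover have "norm (x /\<^sub>R c x) = norm x / c x"
        using c_pos[of x] by (simp add: divide_inverse_commute)
      moreover have "norm x > 0"
        using False \<open>\<rho> > 0\<close> by linarith
      ultimately have "norm (x /\<^sub>R c x) = \<rho>"
        by simp
      then show ?thesis ..
    qed
  qed
qed

section \<open>Membership and convergence in the space of continuous functions\<close>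

lemma mem_CI_iff:
  "x \<in> mspace (CI T) \<longleftrightarrow> x \<in> extensional {0..T} \<and> continuous_on {0..T} x"
  unfolding CI_def by (subst compactin_mspace_cfunspace) (auto simp: compact_space_subtopology)

lemma mdist_CI_le:
  assumes "0 \<le> e" "\<And>t. t \<in> {0..T} \<Longrightarrow> norm (x t - y t) \<le> e"
  shows "mdist (CI T) x y \<le> e"
  unfolding CI_def using assms by (intro mdist_cfunspace_le) (auto simp: dist_norm)

lemma limitin_CI:
  assumes "\<And>n. y n \<in> mspace (CI T)" "x \<in> mspace (CI T)" "uniform_limit {0..T} y x sequentially"
  shows "limitin (mtopology_of (CI T)) y x sequentially"
proof -
  have "\<forall>\<^sub>F n in sequentially. mdist (CI T) (y n) x < e" if "e > 0" for e
  proof -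
    have "\<forall>\<^sub>F n in sequentially. \<forall>t\<in>{0..T}. dist (y n t) (x t) < e / 2"
      using uniform_limitD[OF assms(3), of "e / 2"] that by simp
    then show ?thesis
    proof (rule eventually_mono)
      fix n assume "\<forall>t\<in>{0..T}. dist (y n t) (x t) < e / 2"
      then have "mdist (CI T) (y n) x \<le> e / 2"
        using that by (intro mdist_CI_le) (auto simp: dist_norm less_imp_le)
      then show "mdist (CI T) (y n) x < e"
        using that by simp
    qed
  qed
  then show ?thesis
    using assms(1,2) unfolding mtopology_of_def
    by (simp add: Metric_space.limitin_metric[OF Metric_space_mspace_mdist])
qed

section \<open>Euler polygons\<close>

text \<open>The state is frozen on each cell of length h, so finitely many integrations determine
  the curve, without existence or uniqueness of solutions. The values at the nodes are kept separate
  because continuity in the parameters is proved by induction on them.\<close>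

primrec euler_node :: "(real \<Rightarrow> 'a \<Rightarrow> 'a) \<Rightarrow> real \<Rightarrow> 'a \<Rightarrow> nat \<Rightarrow> 'a::euclidean_space" where
  "euler_node Q h x0 0 = x0"
| "euler_node Q h x0 (Suc k) = euler_node Q h x0 k +
     integral {real k * h..real (Suc k) * h} (\<lambda>s. Q s (euler_node Q h x0 k))"

definition euler_rhs :: "(real \<Rightarrow> 'a \<Rightarrow> 'a) \<Rightarrow> real \<Rightarrow> 'a \<Rightarrow> real \<Rightarrow> 'a::euclidean_space" where
  "euler_rhs Q h x0 s = Q s (euler_node Q h x0 (nat \<lfloor>s / h\<rfloor>))"

definition euler_curve :: "(real \<Rightarrow> 'a \<Rightarrow> 'a) \<Rightarrow> real \<Rightarrow> 'a \<Rightarrow> real \<Rightarrow> 'a::euclidean_space" where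
  "euler_curve Q h x0 t = x0 + integral {0..t} (euler_rhs Q h x0)"

context
  fixes Q :: "real \<Rightarrow> 'a \<Rightarrow> 'a::euclidean_space" and h T :: real and m :: "real \<Rightarrow> real"
  assumes meas: "\<And>x. (\<lambda>s. Q s x) \<in> borel_measurable (lebesgue_on {0..T})"
    and bound: "\<And>s x. s \<in> {0..T} \<Longrightarrow> norm (Q s x) \<le> m s"
    and m: "m integrable_on {0..T}" and h: "h > 0"
begin

lemma euler_rhs_integrable: "euler_rhs Q h x0 integrable_on {0..T}"
proof (rule measurable_bounded_by_integrable_imp_integrable)
  have "(\<lambda>s. s / h) \<in> borel_measurable (lebesgue_on {0..T})"
    using h by (intro continuous_imp_measurable_on_sets_lebesgue continuous_intros) auto
  then have "(\<lambda>s. \<lfloor>s / h\<rfloor>) \<in> measurable (lebesgue_on {0..T}) (count_space UNIV)"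
    by (rule measurable_compose) (rule measurable_real_floor)
  then have "(\<lambda>s. nat \<lfloor>s / h\<rfloor>) \<in> measurable (lebesgue_on {0..T}) (count_space UNIV)"
    by (rule measurable_compose) simp
  then show "euler_rhs Q h x0 \<in> borel_measurable (lebesgue_on {0..T})"
    unfolding euler_rhs_def by (rule measurable_compose_countable[OF meas])
qed (use bound m in \<open>auto simp: euler_rhs_def\<close>)

lemma euler_curve_increment:
  assumes "0 \<le> s" "s \<le> t" "t \<le> T"
  shows "(euler_rhs Q h x0 has_integral (euler_curve Q h x0 t - euler_curve Q h x0 s)) {s..t}"
proof -
  have "euler_rhs Q h x0 integrable_on {0..t}" "euler_rhs Q h x0 integrable_on {s..t}"
    by (rule integrable_on_subinterval[OF euler_rhs_integrable]; use assms in auto)+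
  then show ?thesis
    using Henstock_Kurzweil_Integration.integral_combine[of 0 s t "euler_rhs Q h x0"] assms
    by (simp add: has_integral_integrable_integral euler_curve_def algebra_simps)
qed

lemma euler_curve_node:
  "real k * h \<le> T \<Longrightarrow> euler_curve Q h x0 (real k * h) = euler_node Q h x0 k"
proof (induction k)
  case 0
  then show ?case by (simp add: euler_curve_def)
next
  case (Suc k)
  let ?I = "{real k * h..real (Suc k) * h}"
  have le: "real k * h \<le> real (Suc k) * h"
    using h by (intro mult_right_mono) auto
  have "integral ?I (euler_rhs Q h x0) = integral ?I (\<lambda>s. Q s (euler_node Q h x0 k))"
  \<comment> \<open>The right endpoint of a cell already has the index of the next cell, so the
    integrands may differ at that one point.\<close>
  proof (rule integral_spike[of "{real (Suc k) * h}"])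
    fix s assume s: "s \<in> ?I - {real (Suc k) * h}"
    then have "real k \<le> s / h" "s / h < real (Suc k)"
      using h by (auto simp: field_simps)
    then have "\<lfloor>s / h\<rfloor> = int k"
      by (simp add: floor_eq_iff)
    then show "Q s (euler_node Q h x0 k) = euler_rhs Q h x0 s"
      by (simp add: euler_rhs_def)
  qed simp
  moreover have "integral ?I (euler_rhs Q h x0) =
      euler_curve Q h x0 (real (Suc k) * h) - euler_curve Q h x0 (real k * h)"
    using euler_curve_increment[of "real k * h" "real (Suc k) * h" x0] le Suc.prems h
    by (intro integral_unique) auto
  ultimately show ?case
    using Suc le by simp
qed

text \<open>The polygon as solution of a delay equation with lag below h; the later limit argument
  sees the recursion only in this form.\<close>

lemma euler_rhs_eq:
  assumes "s \<in> {0..T}"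
  shows "euler_rhs Q h x0 s = Q s (euler_curve Q h x0 (real (nat \<lfloor>s / h\<rfloor>) * h))"
    and "real (nat \<lfloor>s / h\<rfloor>) * h \<in> {0..T}" and "\<bar>s - real (nat \<lfloor>s / h\<rfloor>) * h\<bar> < h"
proof -
  have nat: "real (nat \<lfloor>s / h\<rfloor>) = of_int \<lfloor>s / h\<rfloor>"
    using assms h by simp
  have *: "real (nat \<lfloor>s / h\<rfloor>) * h \<le> s" "s < real (nat \<lfloor>s / h\<rfloor>) * h + h"
    using pos_le_divide_eq[OF h, THEN iffD1, OF of_int_floor_le[of "s / h"]]
      pos_divide_less_eq[OF h, THEN iffD1, OF floor_correct[of "s / h", THEN conjunct2]]
    unfolding nat by (simp_all add: distrib_right)
  have "0 \<le> real (nat \<lfloor>s / h\<rfloor>) * h"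
    using h by simp
  with * show "real (nat \<lfloor>s / h\<rfloor>) * h \<in> {0..T}" "\<bar>s - real (nat \<lfloor>s / h\<rfloor>) * h\<bar> < h"
    using assms * unfolding atLeastAtMost_iff by linarith+
  then show "euler_rhs Q h x0 s = Q s (euler_curve Q h x0 (real (nat \<lfloor>s / h\<rfloor>) * h))"
    by (simp add: euler_rhs_def euler_curve_node)
qed

end

text \<open>The parameter enters only through the coefficients of fixed functions f y. Hence the
  step from one node to the next is a finite sum of continuous coefficients times constant
  integrals, and continuity of all nodes follows by induction.\<close>

lemma euler_curve_continuous_parameters:
  fixes f :: "'a::euclidean_space \<Rightarrow> real \<Rightarrow> 'a" and c :: "'p::metric_space \<Rightarrow> 'a \<Rightarrow> 'a \<Rightarrow> real"
    and z :: "'p \<Rightarrow> 'a" and Y :: "'a set"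
  defines "Q \<equiv> \<lambda>p s x. \<Sum>y\<in>Y. c p y x *\<^sub>R f y s"
  assumes Y: "finite Y" and h: "h > 0" and m: "m integrable_on {0..T}"
    and f_int: "\<And>y. y \<in> Y \<Longrightarrow> f y integrable_on {0..T}"
    and f_bound: "\<And>y s. \<lbrakk>y \<in> Y; s \<in> {0..T}\<rbrakk> \<Longrightarrow> norm (f y s) \<le> m s"
    and c: "\<And>y. y \<in> Y \<Longrightarrow> continuous_on UNIV (\<lambda>(p, x). c p y x)" and z: "continuous_on UNIV z"
    and rhs: "\<And>p. euler_rhs (Q p) h (z p) integrable_on {0..T}"
    and "e > 0"
  shows "\<forall>\<^sub>F p' in nhds p. \<forall>t\<in>{0..T}. norm (euler_curve (Q p') h (z p') t - euler_curve (Q p) h (z p) t) < e"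
proof -
  let ?n = "\<lambda>p k. euler_node (Q p) h (z p) k"
  have c_comp: "continuous_on UNIV (\<lambda>p. c p y (\<phi> p))" if "y \<in> Y" "continuous_on UNIV \<phi>" for y \<phi>
  proof -
    have "continuous_on UNIV (\<lambda>p. (p, \<phi> p))"
      using that(2) by (intro continuous_intros)
    then have "continuous_on UNIV (\<lambda>p. (\<lambda>(p, x). c p y x) (p, \<phi> p))"
      by (rule continuous_on_compose2[OF c[OF that(1)]]) auto
    then show ?thesis by simp
  qed
  have node_cont: "real k * h \<le> T \<Longrightarrow> continuous_on UNIV (\<lambda>p. ?n p k)" for k
  proof (induction k)
    case 0
    then show ?case using z by simp
  next
    case (Suc k)
    let ?I = "{real k * h..real (Suc k) * h}"
    have le: "real k * h \<le> real (Suc k) * h"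
      using h by (intro mult_right_mono) auto
    have f_I: "f y integrable_on ?I" if "y \<in> Y" for y
      by (rule integrable_on_subinterval[OF f_int[OF that]]) (use Suc.prems h in auto)
    have "integral ?I (\<lambda>s. Q p s x) = (\<Sum>y\<in>Y. c p y x *\<^sub>R integral ?I (f y))" for p x
      unfolding Q_def using Y f_I by (subst integral_sum) (auto intro: integrable_cmul)
    moreover have "continuous_on UNIV (\<lambda>p. ?n p k)"
      using Suc le by simp
    ultimately show ?case
      by (auto intro!: continuous_intros c_comp)
  qed
  define K where "K = nat \<lfloor>T / h\<rfloor>"
  \<comment> \<open>Sums the coefficient changes over all cells meeting \<open>{0..T}\<close>, so it
    dominates the change on every single cell; being a finite sum it is continuous in the
    parameter.\<close>
  define \<Delta> where "\<Delta> = (\<lambda>p'. \<Sum>k\<le>K. \<Sum>y\<in>Y. \<bar>c p' y (?n p' k) - c p y (?n p k)\<bar>)"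
  define \<Theta> where "\<Theta> = (\<lambda>p'. norm (z p' - z p) + \<Delta> p' * integral {0..T} m)"
  have diff_le: "norm (euler_curve (Q p') h (z p') t - euler_curve (Q p) h (z p) t) \<le> \<Theta> p'"
    if t: "t \<in> {0..T}" for p' t
  proof -
    have int_t: "euler_rhs (Q p) h (z p) integrable_on {0..t}" for p
      by (rule integrable_on_subinterval[OF rhs]) (use t in auto)
    have m_t: "(\<lambda>s. \<Delta> p' * m s) integrable_on {0..t}"
      using integrable_cmul[OF integrable_on_subinterval[OF m], of 0 t "\<Delta> p'"] t by simp
    have m_nonneg: "0 \<le> m s" if "s \<in> {0..T}" "Y \<noteq> {}" for s
      using f_bound[OF _ that(1)] that(2) norm_ge_zero order_trans by blast
    have \<Delta>_nonneg: "0 \<le> \<Delta> p'"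
      unfolding \<Delta>_def by (intro sum_nonneg) auto
    have "norm (euler_rhs (Q p') h (z p') s - euler_rhs (Q p) h (z p) s) \<le> \<Delta> p' * m s" if s: "s \<in> {0..t}" for s
    proof -
      define k where "k = nat \<lfloor>s / h\<rfloor>"
      have "k \<le> K"
        unfolding k_def K_def using s t h by (intro nat_mono floor_mono divide_right_mono) auto
      have "euler_rhs (Q p') h (z p') s - euler_rhs (Q p) h (z p) s =
          (\<Sum>y\<in>Y. (c p' y (?n p' k) - c p y (?n p k)) *\<^sub>R f y s)"
        by (simp add: euler_rhs_def Q_def k_def sum_subtractf scaleR_left_diff_distrib)
      also have "norm \<dots> \<le> (\<Sum>y\<in>Y. \<bar>c p' y (?n p' k) - c p y (?n p k)\<bar> * m s)"
        using f_bound s t by (intro sum_norm_le) (auto intro!: mult_left_mono)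
      also have "\<dots> = (\<Sum>y\<in>Y. \<bar>c p' y (?n p' k) - c p y (?n p k)\<bar>) * m s"
        by (simp add: sum_distrib_right)
      also have "\<dots> \<le> \<Delta> p' * m s"
      \<comment> \<open>Nonnegativity of \<open>m\<close> is inferred from the bounds on the f y,
        hence only for nonempty \<open>Y\<close>; otherwise \<Delta> is 0.\<close>
      proof (cases "Y = {}")
        case False
        have "(\<Sum>y\<in>Y. \<bar>c p' y (?n p' k) - c p y (?n p k)\<bar>) \<le> \<Delta> p'"
          unfolding \<Delta>_def using \<open>k \<le> K\<close>
          by (intro member_le_sum[of k "{..K}" "\<lambda>k. \<Sum>y\<in>Y. \<bar>c p' y (?n p' k) - c p y (?n p k)\<bar>"] sum_nonneg) auto
        then show ?thesis
          using m_nonneg[OF _ False] s t by (intro mult_right_mono) auto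
      qed (simp add: \<Delta>_def)
      finally show ?thesis .
    qed
    then have "norm (integral {0..t} (\<lambda>s. euler_rhs (Q p') h (z p') s - euler_rhs (Q p) h (z p) s))
        \<le> integral {0..t} (\<lambda>s. \<Delta> p' * m s)"
      by (intro integral_norm_bound_integral integrable_diff int_t m_t) auto
    also have "\<dots> \<le> \<Delta> p' * integral {0..T} m"
    proof (cases "Y = {}")
      case False
      have "integral {0..t} m \<le> integral {0..T} m"
      proof (rule integral_subset_le)
        show "m integrable_on {0..t}"
          by (rule integrable_on_subinterval[OF m]) (use t in auto)
      qed (use t m m_nonneg[OF _ False] in auto)
      then show ?thesis
        using \<Delta>_nonneg by (simp add: mult_left_mono)
    qed (simp add: \<Delta>_def)
    finally show ?thesis
      using norm_triangle_ineq[of "z p' - z p" "integral {0..t} (\<lambda>s. euler_rhs (Q p') h (z p') s - euler_rhs (Q p) h (z p) s)"]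
      by (simp add: \<Theta>_def euler_curve_def integral_diff[OF int_t int_t] algebra_simps)
  qed
  have "continuous_on UNIV \<Theta>"
  proof (cases "0 \<le> T")
    case True
    have "continuous_on UNIV (\<lambda>p'. ?n p' k)" if "k \<le> K" for k
    proof (rule node_cont)
      have "real k \<le> T / h"
      proof -
        have "real k \<le> real K"
          using that by simp
        also have "real K = of_int \<lfloor>T / h\<rfloor>"
          using True h by (simp add: K_def)
        also have "\<dots> \<le> T / h"
          by (rule of_int_floor_le)
        finally show ?thesis .
      qed
      then show "real k * h \<le> T"
        using h by (simp add: field_simps)
    qed
    then show ?thesis
      unfolding \<Theta>_def \<Delta>_def by (intro continuous_intros z c_comp) auto
  next
    case False
    then show ?thesis
      unfolding \<Theta>_def by (auto intro!: continuous_intros z)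
  qed
  moreover have "\<Theta> p = 0"
    by (simp add: \<Theta>_def \<Delta>_def)
  ultimately have "(\<Theta> \<longlongrightarrow> 0) (nhds p)"
    using tendsto_at_iff_tendsto_nhds[of \<Theta> p]
    by (metis UNIV_I continuous_on_eq_continuous_at isCont_def open_UNIV)
  then have "\<forall>\<^sub>F p' in nhds p. \<Theta> p' < e"
    using \<open>e > 0\<close> by (rule order_tendstoD(2))
  then show ?thesis
    by (rule eventually_mono) (use diff_le le_less_trans in blast)
qed

lemma continuous_map_into_CI:
  fixes X :: "'p::metric_space \<Rightarrow> real \<Rightarrow> real ^ 'n"
  assumes X: "\<And>p. X p \<in> mspace (CI T)"
    and lim: "\<And>p e. e > 0 \<Longrightarrow> \<forall>\<^sub>F p' in nhds p. \<forall>t\<in>{0..T}. norm (X p' t - X p t) < e"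
  shows "continuous_map euclidean (mtopology_of (CI T)) X"
  unfolding mtopology_of_def Metric_space.continuous_map_to_metric[OF Metric_space_mspace_mdist]
proof (intro ballI allI impI)
  fix p and e :: real assume "0 < e"
  then obtain U where U: "open U" "p \<in> U" "\<And>p' t. \<lbrakk>p' \<in> U; t \<in> {0..T}\<rbrakk> \<Longrightarrow> norm (X p' t - X p t) < e / 2"
    using lim[of "e / 2" p] unfolding eventually_nhds by auto
  have "X p' \<in> Metric_space.mball (mspace (CI T)) (mdist (CI T)) (X p) e" if "p' \<in> U" for p'
  proof -
    have "mdist (CI T) (X p) (X p') \<le> e / 2"
      using U(3)[OF that] \<open>0 < e\<close> by (intro mdist_CI_le) (auto simp: norm_minus_commute less_imp_le)
    then show ?thesis
      using X \<open>0 < e\<close> by (simp add: Metric_space.in_mball[OF Metric_space_mspace_mdist])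
  qed
  then show "\<exists>U. openin euclidean U \<and> p \<in> U \<and>
      (\<forall>y\<in>U. X y \<in> Metric_space.mball (mspace (CI T)) (mdist (CI T)) (X p) e)"
    using open_openin[THEN iffD1, OF U(1)] U(2) by blast
qed

section \<open>The nonlocal problem\<close>

lemma convex_combination_near:
  fixes S :: "'a::real_normed_vector set"
  assumes "convex S" "S \<noteq> {}" "finite Y" and c: "\<And>y. y \<in> Y \<Longrightarrow> c y \<ge> 0" "(\<Sum>y\<in>Y. c y) = 1"
    and near: "\<And>y. \<lbrakk>y \<in> Y; c y \<noteq> 0\<rbrakk> \<Longrightarrow> \<exists>w\<in>S. dist (v y) w < \<epsilon>"
  shows "\<exists>w\<in>S. dist (\<Sum>y\<in>Y. c y *\<^sub>R v y) w \<le> \<epsilon>"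
proof -
  have "\<exists>w\<in>S. c y \<noteq> 0 \<longrightarrow> dist (v y) w < \<epsilon>" if "y \<in> Y" for y
    using near[OF that] \<open>S \<noteq> {}\<close> by blast
  then obtain W where W: "\<And>y. y \<in> Y \<Longrightarrow> W y \<in> S" "\<And>y. \<lbrakk>y \<in> Y; c y \<noteq> 0\<rbrakk> \<Longrightarrow> dist (v y) (W y) < \<epsilon>"
    by metis
  have "(\<Sum>y\<in>Y. c y *\<^sub>R W y) \<in> S"
    using assms(1,3) c W(1) by (intro convex_sum) auto
  moreover have "dist (\<Sum>y\<in>Y. c y *\<^sub>R v y) (\<Sum>y\<in>Y. c y *\<^sub>R W y) \<le> \<epsilon>"
  proof -
    have "(\<Sum>y\<in>Y. c y *\<^sub>R v y) - (\<Sum>y\<in>Y. c y *\<^sub>R W y) = (\<Sum>y\<in>Y. c y *\<^sub>R (v y - W y))"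
      by (simp add: sum_subtractf scaleR_right_diff_distrib)
    also have "norm \<dots> \<le> (\<Sum>y\<in>Y. c y * \<epsilon>)"
    proof (rule sum_norm_le)
      fix y assume y: "y \<in> Y"
      show "norm (c y *\<^sub>R (v y - W y)) \<le> c y * \<epsilon>"
        using c(1)[OF y] W(2)[OF y] by (cases "c y = 0") (auto simp: dist_norm less_imp_le)
    qed
    also have "\<dots> = \<epsilon>"
      using c(2) by (simp add: sum_distrib_right[symmetric])
    finally show ?thesis
      by (simp add: dist_norm)
  qed
  ultimately show ?thesis by blast
qed

lemma usc_multimap_near:
  fixes \<Phi> :: "'a::metric_space \<Rightarrow> 'b::metric_space set"
  assumes "usc_multimap \<Phi>" "\<epsilon> > 0"
  obtains \<delta> where "\<delta> > 0" "\<And>y v. \<lbrakk>dist y x < \<delta>; v \<in> \<Phi> y\<rbrakk> \<Longrightarrow> \<exists>w\<in>\<Phi> x. dist v w < \<epsilon>"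
proof -
  define U where "U = (\<Union>w\<in>\<Phi> x. ball w \<epsilon>)"
  have "open U"
    unfolding U_def by (intro open_UN ballI open_ball)
  then have "open {y. \<Phi> y \<subseteq> U}"
    using assms(1) by (simp add: usc_multimap_def)
  moreover have "x \<in> {y. \<Phi> y \<subseteq> U}"
    using \<open>\<epsilon> > 0\<close> by (auto simp: U_def)
  ultimately obtain \<delta> where "\<delta> > 0" and \<delta>: "ball x \<delta> \<subseteq> {y. \<Phi> y \<subseteq> U}"
    using openE by blast
  show thesis
  proof (rule that[OF \<open>\<delta> > 0\<close>])
    fix y v assume "dist y x < \<delta>" "v \<in> \<Phi> y"
    then have "v \<in> U"
      using \<delta> by (auto simp: dist_commute subset_iff)
    then show "\<exists>w\<in>\<Phi> x. dist v w < \<epsilon>"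
      by (auto simp: U_def dist_commute)
  qed
qed

text \<open>Every y with nonzero weight tends to x with the p n, so by upper semicontinuity the f n
  y approach \<Phi> x, and by convexity so do their combinations. Boundedness of \<Phi> x absorbs
  the change of the factor from \<kappa> n to l.\<close>

lemma usc_multimap_convex_combinations_limit:
  fixes \<Phi> :: "'a::euclidean_space \<Rightarrow> 'b::euclidean_space set"
  assumes usc: "usc_multimap \<Phi>" and \<Phi>: "convex (\<Phi> x)" "compact (\<Phi> x)" "\<Phi> x \<noteq> {}"
    and Y: "\<And>n. finite (Y n)" and c: "\<And>n y. y \<in> Y n \<Longrightarrow> c n y \<ge> 0" "\<And>n. (\<Sum>y\<in>Y n. c n y) = 1"
    and near: "\<And>n y. \<lbrakk>y \<in> Y n; c n y \<noteq> 0\<rbrakk> \<Longrightarrow> dist y (p n) < e n"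
    and lims: "p \<longlonglongrightarrow> x" "e \<longlonglongrightarrow> 0" "\<kappa> \<longlonglongrightarrow> l" and \<kappa>: "\<And>n. \<kappa> n \<in> {0..1}"
    and f: "\<And>n y. y \<in> Y n \<Longrightarrow> f n y \<in> \<Phi> y"
  shows "(\<lambda>n. infdist (\<kappa> n *\<^sub>R (\<Sum>y\<in>Y n. c n y *\<^sub>R f n y)) ((*\<^sub>R) l ` \<Phi> x)) \<longlonglongrightarrow> 0"
proof (rule LIMSEQ_I)
  fix \<epsilon> :: real assume "\<epsilon> > 0"
  obtain \<delta> where "\<delta> > 0" and \<delta>: "\<And>y v. \<lbrakk>dist y x < \<delta>; v \<in> \<Phi> y\<rbrakk> \<Longrightarrow> \<exists>w\<in>\<Phi> x. dist v w < \<epsilon> / 3"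
    using usc_multimap_near[OF usc, of "\<epsilon> / 3" x] \<open>\<epsilon> > 0\<close> by auto
  obtain B where B: "B > 0" "\<And>w. w \<in> \<Phi> x \<Longrightarrow> norm w \<le> B"
    using compact_imp_bounded[OF \<Phi>(2)] unfolding bounded_pos by blast
  \<comment> \<open>Two halves of \<delta> add up to the distance from y to x. The bound on \<kappa>
    n is scaled by B so that changing the factor costs a third of \<epsilon>, as does approximating
    the combination.\<close>
  have "\<forall>\<^sub>F n in sequentially. dist (p n) x < \<delta> / 2 \<and> e n < \<delta> / 2 \<and> dist (\<kappa> n) l < \<epsilon> / (3 * B)"
    using lims \<open>\<delta> > 0\<close> \<open>\<epsilon> > 0\<close> B(1)
    by (intro eventually_conj tendstoD order_tendstoD(2)[OF lims(2)]) auto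
  then obtain n0 where n0: "\<And>n. n \<ge> n0 \<Longrightarrow> dist (p n) x < \<delta> / 2 \<and> e n < \<delta> / 2 \<and> dist (\<kappa> n) l < \<epsilon> / (3 * B)"
    unfolding eventually_sequentially by blast
  have "norm (infdist (\<kappa> n *\<^sub>R (\<Sum>y\<in>Y n. c n y *\<^sub>R f n y)) ((*\<^sub>R) l ` \<Phi> x) - 0) < \<epsilon>" if n: "n \<ge> n0" for n
  proof -
    let ?s = "\<Sum>y\<in>Y n. c n y *\<^sub>R f n y"
    have "\<exists>w\<in>\<Phi> x. dist (f n y) w < \<epsilon> / 3" if "y \<in> Y n" "c n y \<noteq> 0" for y
    proof (rule \<delta>[OF _ f[OF that(1)]])
      show "dist y x < \<delta>"
        using near[OF that] n0[OF n] dist_triangle[of y x "p n"] by linarith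
    qed
    then obtain w where w: "w \<in> \<Phi> x" "dist ?s w \<le> \<epsilon> / 3"
      using convex_combination_near[OF \<Phi>(1,3) Y c(1,2), of n "f n" "\<epsilon> / 3"] by blast
    have "\<kappa> n *\<^sub>R ?s - l *\<^sub>R w = \<kappa> n *\<^sub>R (?s - w) + (\<kappa> n - l) *\<^sub>R w"
      by (simp add: algebra_simps)
    then have "norm (\<kappa> n *\<^sub>R ?s - l *\<^sub>R w) \<le> \<bar>\<kappa> n\<bar> * norm (?s - w) + \<bar>\<kappa> n - l\<bar> * norm w"
      by (metis norm_triangle_ineq norm_scaleR)
    also have "\<dots> \<le> 1 * (\<epsilon> / 3) + \<epsilon> / (3 * B) * B"
      using \<kappa>[of n] w(2) n0[OF n] B \<open>\<epsilon> > 0\<close> w(1)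
      by (intro add_mono mult_mono) (auto simp: dist_norm)
    also have "\<dots> < \<epsilon>"
      using B(1) \<open>\<epsilon> > 0\<close> by (simp add: field_simps)
    finally have "dist (\<kappa> n *\<^sub>R ?s) (l *\<^sub>R w) < \<epsilon>"
      by (simp add: dist_norm)
    moreover have "infdist (\<kappa> n *\<^sub>R ?s) ((*\<^sub>R) l ` \<Phi> x) \<le> dist (\<kappa> n *\<^sub>R ?s) (l *\<^sub>R w)"
      using w(1) by (intro infdist_le) auto
    ultimately show ?thesis
      using infdist_nonneg[of "\<kappa> n *\<^sub>R ?s" "(*\<^sub>R) l ` \<Phi> x"] by simp
  qed
  then show "\<exists>n0. \<forall>n\<ge>n0. norm (infdist (\<kappa> n *\<^sub>R (\<Sum>y\<in>Y n. c n y *\<^sub>R f n y)) ((*\<^sub>R) l ` \<Phi> x) - 0) < \<epsilon>"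
    by blast
qed

text \<open>The radial retraction onto the ball of radius \<rho>. Evaluating F there keeps all
  states in a compact set, which gives a uniform velocity bound and admits a finite partition of
  unity. The value is always a positive multiple of x, so signs of inner products with x
  survive.\<close>

definition trunc :: "real \<Rightarrow> 'a::real_normed_vector \<Rightarrow> 'a" where
  "trunc \<rho> x = x /\<^sub>R max 1 (norm x / \<rho>)"

lemma trunc_id: "\<lbrakk>0 < \<rho>; norm x \<le> \<rho>\<rbrakk> \<Longrightarrow> trunc \<rho> x = x"
  by (simp add: trunc_def max_def)

lemma norm_trunc_le: "0 < \<rho> \<Longrightarrow> norm (trunc \<rho> x) \<le> \<rho>"
  by (cases "norm x \<le> \<rho>") (auto simp: trunc_def max_def field_simps)

lemma norm_trunc_ge: "\<lbrakk>0 < \<rho>; R \<le> \<rho>; R \<le> norm x\<rbrakk> \<Longrightarrow> R \<le> norm (trunc \<rho> x)"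
  by (cases "norm x \<le> \<rho>") (auto simp: trunc_def max_def field_simps)

lemma continuous_on_trunc: "0 < \<rho> \<Longrightarrow> continuous_on UNIV (trunc \<rho>)"
proof -
  have "max 1 (norm x / \<rho>) \<noteq> 0" for x :: 'a
    using max.cobounded1[of 1 "norm x / \<rho>"] by linarith
  then show "0 < \<rho> \<Longrightarrow> continuous_on UNIV (trunc \<rho> :: 'a \<Rightarrow> 'a)"
    unfolding trunc_def by (intro continuous_intros) auto
qed

lemma inner_trunc_neg: "trunc \<rho> x \<bullet> w < 0 \<Longrightarrow> x \<bullet> w < 0"
  by (simp add: trunc_def zero_less_mult_iff mult_less_0_iff max_def split: if_splits)

text \<open>All that the rest needs of the potential: a radius \<rho> whose sphere lies in the level
  set, and the inward inequality from radius R on. \<open>g_return\<close> is condition (i);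
  \<open>g_sphere\<close> is (ii) and (iii) on that sphere.\<close>

locale guided_nonlocal_inclusion =
  fixes T R \<rho> :: real and F :: "real \<Rightarrow> real ^ 'n \<Rightarrow> (real ^ 'n) set"
    and g :: "(real \<Rightarrow> real ^ 'n) \<Rightarrow> real ^ 'n"
  assumes T_pos: "T > 0" and R_pos: "R > 0" and R_less: "R < \<rho>"
    and caratheodory: "caratheodory_map T F"
    and inward: "\<And>t x v. \<lbrakk>t \<in> {0..T}; R \<le> norm x; v \<in> F t x\<rbrakk> \<Longrightarrow> x \<bullet> v < 0"
    and g_cont: "continuous_map (mtopology_of (CI T)) euclidean g"
    and g_return: "\<And>x. x \<in> ACI T \<Longrightarrow> x 0 = g x \<Longrightarrow> \<exists>t\<in>{0<..T}. norm (g x) \<le> norm (x t)"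
    and g_sphere: "\<And>x. norm x = \<rho> \<Longrightarrow> norm (g (const_fun T x)) \<le> \<rho> \<and> g (const_fun T x) \<noteq> x"
begin

lemma \<rho>_pos: "\<rho> > 0"
  using R_pos R_less by simp

lemma F_values: "t \<in> {0..T} \<Longrightarrow> F t x \<noteq> {} \<and> convex (F t x) \<and> compact (F t x)"
  using caratheodory unfolding caratheodory_map_def by blast

lemma F_usc: obtains N where "negligible N" "\<And>t. t \<in> {0..T} - N \<Longrightarrow> usc_multimap (F t)"
  using caratheodory unfolding caratheodory_map_def AE_lebesgue_on_Icc_iff by blast

definition growth :: "real \<Rightarrow> real" where
  "growth = (SOME \<mu>. integrable (lebesgue_on {0..T}) \<mu> \<and>
      (\<forall>t\<in>{0..T}. \<forall>x. Sup (norm ` F t x) \<le> \<mu> t * (1 + norm x)))"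

lemma growth:
  "integrable (lebesgue_on {0..T}) growth"
  "t \<in> {0..T} \<Longrightarrow> Sup (norm ` F t x) \<le> growth t * (1 + norm x)"
proof -
  have "\<exists>\<mu>. integrable (lebesgue_on {0..T}) \<mu> \<and> (\<forall>t\<in>{0..T}. \<forall>x. Sup (norm ` F t x) \<le> \<mu> t * (1 + norm x))"
    using caratheodory unfolding caratheodory_map_def by blast
  from someI_ex[OF this] show "integrable (lebesgue_on {0..T}) growth"
    "t \<in> {0..T} \<Longrightarrow> Sup (norm ` F t x) \<le> growth t * (1 + norm x)"
    unfolding growth_def by blast+
qed

lemma F_bound:
  assumes "t \<in> {0..T}" "v \<in> F t x"
  shows "norm v \<le> growth t * (1 + norm x)"
proof -
  have "bdd_above (norm ` F t x)"
    using F_values[OF assms(1), of x]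
    by (intro bounded_imp_bdd_above compact_imp_bounded compact_continuous_image continuous_on_norm_id) auto
  then have "norm v \<le> Sup (norm ` F t x)"
    using assms(2) by (intro cSup_upper) auto
  also have "\<dots> \<le> growth t * (1 + norm x)"
    by (rule growth(2)[OF assms(1)])
  finally show ?thesis .
qed

lemma growth_nonneg:
  assumes "t \<in> {0..T}"
  shows "0 \<le> growth t"
proof -
  obtain v where "v \<in> F t 0"
    using F_values[OF assms, of 0] by blast
  then have "norm v \<le> growth t"
    using F_bound[OF assms, of v 0] by simp
  then show ?thesis
    by (rule order_trans[OF norm_ge_zero])
qed

lemma growth_integrable: "(\<lambda>t. growth t * B) integrable_on {0..T}"
proof -
  have "growth integrable_on {0..T}"
    by (rule integrable_on_lebesgue_on[OF growth(1)]) simp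
  from integrable_cmul[OF this, of B] show ?thesis
    by (simp add: mult.commute)
qed

abbreviation rate :: "real \<Rightarrow> real" where
  "rate t \<equiv> growth t * (1 + \<rho>)"

lemma rate_nonneg: "t \<in> {0..T} \<Longrightarrow> 0 \<le> rate t"
  using growth_nonneg \<rho>_pos by simp

lemma F_rate:
  assumes "t \<in> {0..T}" "v \<in> F t x" "norm x \<le> \<rho>"
  shows "norm v \<le> rate t"
  using F_bound[OF assms(1,2)] growth_nonneg[OF assms(1)] assms(3)
  by (meson add_left_mono mult_left_mono order_trans)

text \<open>Outside radius R the norm stays below its initial value at every later time. The time
  supplied by (i) contradicts this unless the norm there is at most R, which bounds the initial
  value by R and then, by decay once more, the whole curve. The bound \<open>m\<close> is left
  general since exact solutions come with a preliminary bound of their own.\<close>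

lemma inclusion_norm_le:
  assumes m: "m integrable_on {0..T}" "\<And>t. t \<in> {0..T} \<Longrightarrow> 0 \<le> m t"
    and x_dom: "\<And>s t. \<lbrakk>0 \<le> s; s \<le> t; t \<le> T\<rbrakk> \<Longrightarrow> norm (x t - x s) \<le> integral {s..t} m"
    and N: "negligible N"
    and deriv: "\<And>t. t \<in> {0..T} - N \<Longrightarrow> (x has_vector_derivative v t) (at t within {0..T})"
    and v: "\<And>t. \<lbrakk>t \<in> {0..T} - N; R \<le> norm (x t)\<rbrakk> \<Longrightarrow> x t \<bullet> v t < 0"
    and x: "x \<in> ACI T" "x 0 = g x" and t: "t \<in> {0..T}"
  shows "norm (x t) \<le> R"
proof -
  have decr: "norm (x t) < norm (x 0)" if "0 < t" "t \<le> T" "R < norm (x t)" for t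
    by (rule norm_decreasing_outside_ball[OF m x_dom N deriv v]) (use that in auto)
  obtain \<tau> where "\<tau> \<in> {0<..T}" "norm (x 0) \<le> norm (x \<tau>)"
    using g_return[OF x] x(2) by auto
  then have "norm (x 0) \<le> R"
    using decr[of \<tau>] by fastforce
  then show ?thesis
    using decr[of t] t by (cases "t = 0") force+
qed

text \<open>A bootstrap: continuity gives some bound B for the individual solution, hence a speed
  bound depending on it; this suffices for the a priori bound R, which in turn gives the speed bound
  \<open>rate\<close> common to all solutions.\<close>

lemma solution_rate:
  assumes "x \<in> solution_set T F g"
  obtains u N where "negligible N" "\<And>t. t \<in> {0..T} - N \<Longrightarrow> u t \<in> F t (x t)"
    "\<And>t. t \<in> {0..T} \<Longrightarrow> norm (u t) \<le> rate t" "\<And>t. t \<in> {0..T} \<Longrightarrow> norm (x t) \<le> R"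
    "\<And>s t. \<lbrakk>0 \<le> s; s \<le> t; t \<le> T\<rbrakk> \<Longrightarrow> (u has_integral (x t - x s)) {s..t}"
proof -
  have x: "x \<in> ACI T" "x 0 = g x" and
    ae: "AE t in lebesgue_on {0..T}. \<exists>v \<in> F t (x t). (x has_vector_derivative v) (at t within {0..T})"
    using assms by (auto simp: solution_set_def)
  obtain N where N: "negligible N"
    and "\<And>t. t \<in> {0..T} - N \<Longrightarrow> \<exists>v. v \<in> F t (x t) \<and> (x has_vector_derivative v) (at t within {0..T})"
    using ae unfolding AE_lebesgue_on_Icc_iff by blast
  then obtain v where v: "\<And>t. t \<in> {0..T} - N \<Longrightarrow> v t \<in> F t (x t)"
    "\<And>t. t \<in> {0..T} - N \<Longrightarrow> (x has_vector_derivative v t) (at t within {0..T})"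
    by metis
  \<comment> \<open>Value 0 on the exceptional set makes the speed bound hold at every time.\<close>
  define u where "u = (\<lambda>t. if t \<in> N then 0 else v t)"
  have ac: "abs_continuous_on {0..T} x" and cont: "continuous_on {0..T} x"
    using x(1) by (auto simp: ACI_def mem_CI_iff)
  have u_int: "(u has_integral (x t - x s)) {s..t}" if st: "0 \<le> s" "s \<le> t" "t \<le> T" for s t
  proof (rule abs_continuous_on_has_integral[OF _ st(2) N])
    show "abs_continuous_on {s..t} x"
      using ac st unfolding abs_continuous_on_def by (meson atLeastatMost_subset_iff order_trans)
    show "(x has_vector_derivative u \<tau>) (at \<tau> within {s..t})" if "\<tau> \<in> {s..t} - N" for \<tau>
      using has_vector_derivative_within_subset[OF v(2), of \<tau> "{s..t}"] that st by (auto simp: u_def)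
  qed
  have "compact (x ` {0..T})"
    by (intro compact_continuous_image cont) auto
  then obtain B where "\<forall>y\<in>x ` {0..T}. norm y \<le> B"
    using compact_imp_bounded[of "x ` {0..T}"] unfolding bounded_iff by blast
  then have B: "norm (x t) \<le> B" if "t \<in> {0..T}" for t
    using that by blast
  have "0 \<le> B"
    using B[of 0] T_pos norm_ge_zero[of "x 0"] by (auto simp del: norm_ge_zero)
  have u_bound: "norm (u t) \<le> growth t * (1 + K)" if "t \<in> {0..T}" "norm (x t) \<le> K" for t K
  proof (cases "t \<in> N")
    case True
    then show ?thesis
      using growth_nonneg[OF that(1)] order_trans[OF norm_ge_zero that(2)] by (simp add: u_def)
  next
    case False
    then have "norm (u t) \<le> growth t * (1 + norm (x t))"
      using F_bound[OF that(1) v(1)] that(1) by (simp add: u_def)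
    also have "\<dots> \<le> growth t * (1 + K)"
      using that growth_nonneg[OF that(1)] by (intro mult_left_mono) auto
    finally show ?thesis .
  qed
  have R_bound: "norm (x t) \<le> R" if "t \<in> {0..T}" for t
  proof (rule inclusion_norm_le[OF growth_integrable _ _ N v(2) _ x that])
    show "0 \<le> growth t * (1 + B)" if "t \<in> {0..T}" for t
      using growth_nonneg[OF that] \<open>0 \<le> B\<close> by simp
    show "norm (x t - x s) \<le> integral {s..t} (\<lambda>t. growth t * (1 + B))" if "0 \<le> s" "s \<le> t" "t \<le> T" for s t
      by (rule increment_norm_le[OF u_int[OF that] growth_integrable u_bound[OF _ B]]) (use that in auto)
    show "x t \<bullet> v t < 0" if "t \<in> {0..T} - N" "R \<le> norm (x t)" for t
      using inward[OF _ that(2) v(1)[OF that(1)]] that(1) by simp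
  qed
  show thesis
  proof (rule that[OF N _ _ R_bound u_int])
    show "u t \<in> F t (x t)" if "t \<in> {0..T} - N" for t
      using v(1)[OF that] that by (simp add: u_def)
    show "norm (u t) \<le> rate t" if "t \<in> {0..T}" for t
      using u_bound[OF that] R_bound[OF that] R_less by simp
  qed
qed

text \<open>The passage to the limit shared by existence and compactness; l is the limit of the
  homotopy parameters, and compactness uses it with l = 1. The nonlocal condition survives because g
  is continuous.\<close>

lemma limit_inclusion:
  assumes E: "\<And>n. E n \<in> mspace (CI T)" "\<And>n. E n 0 = g (E n)"
    and u: "\<And>n s t. \<lbrakk>0 \<le> s; s \<le> t; t \<le> T\<rbrakk> \<Longrightarrow> (u n has_integral (E n t - E n s)) {s..t}"
    and bound: "\<And>n t. t \<in> {0..T} \<Longrightarrow> norm (u n t) \<le> rate t"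
    and unif: "uniform_limit {0..T} E x sequentially"
    and x: "x \<in> extensional {0..T}" and N: "negligible N"
    and near: "\<And>t. t \<in> {0..T} - N \<Longrightarrow> (\<lambda>n. infdist (u n t) ((*\<^sub>R) l ` F t (trunc \<rho> (x t)))) \<longlonglongrightarrow> 0"
  shows "x \<in> ACI T" and "x 0 = g x" and "limitin (mtopology_of (CI T)) E x sequentially"
    and "\<exists>v N. negligible N \<and> (\<forall>t\<in>{0..T} - N. v t \<in> F t (trunc \<rho> (x t)) \<and>
      (x has_vector_derivative l *\<^sub>R v t) (at t within {0..T}))"
proof -
  have conv: "(\<lambda>n. E n t) \<longlonglongrightarrow> x t" if "t \<in> {0..T}" for t
    using tendsto_uniform_limitI[OF unif that] .
  define G where "G = (\<lambda>t. (*\<^sub>R) l ` F t (trunc \<rho> (x t)))"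
  have G: "convex (G t) \<and> compact (G t) \<and> G t \<noteq> {}" if "t \<in> {0..T} - N" for t
    using F_values[of t "trunc \<rho> (x t)"] that unfolding G_def by (auto intro: convex_scaling compact_scaling)
  have G_near: "(\<lambda>n. infdist (u n t) (G t)) \<longlonglongrightarrow> 0" if "t \<in> {0..T} - N" for t
    unfolding G_def by (rule near[OF that])
  have dom: "norm (x t - x s) \<le> integral {s..t} rate" if "0 \<le> s" "s \<le> t" "t \<le> T" for s t
    by (rule limit_increment_norm_le[OF growth_integrable u bound conv that])
  have "\<exists>w N. negligible N \<and>
      (\<forall>t\<in>{0..T} - N. (x has_vector_derivative w t) (at t within {0..T}) \<and> w t \<in> G t)"
    by (rule limit_of_differential_inclusions
        [OF less_imp_le[OF T_pos] growth_integrable rate_nonneg u bound conv N G G_near])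
  then obtain w N' where N': "negligible N'"
    and w: "\<forall>t\<in>{0..T} - N'. (x has_vector_derivative w t) (at t within {0..T}) \<and> w t \<in> G t"
    by blast
  have "\<forall>t\<in>{0..T} - N'. \<exists>y. y \<in> F t (trunc \<rho> (x t)) \<and> (x has_vector_derivative l *\<^sub>R y) (at t within {0..T})"
  proof
    fix t assume "t \<in> {0..T} - N'"
    with w have "(x has_vector_derivative w t) (at t within {0..T})" "w t \<in> G t"
      by auto
    then show "\<exists>y. y \<in> F t (trunc \<rho> (x t)) \<and> (x has_vector_derivative l *\<^sub>R y) (at t within {0..T})"
      by (auto simp: G_def)
  qed
  then obtain v where v: "\<forall>t\<in>{0..T} - N'. v t \<in> F t (trunc \<rho> (x t)) \<and> (x has_vector_derivative l *\<^sub>R v t) (at t within {0..T})"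
    by metis
  with N' show "\<exists>v N. negligible N \<and> (\<forall>t\<in>{0..T} - N. v t \<in> F t (trunc \<rho> (x t)) \<and>
      (x has_vector_derivative l *\<^sub>R v t) (at t within {0..T}))"
    by blast
  have x_CI: "x \<in> mspace (CI T)"
    using x dominated_continuous_on[OF growth_integrable dom] by (simp add: mem_CI_iff)
  show "x \<in> ACI T"
    using x_CI abs_continuous_on_dominated[OF growth_integrable rate_nonneg dom] by (simp add: ACI_def)
  show lim: "limitin (mtopology_of (CI T)) E x sequentially"
    by (rule limitin_CI[OF E(1) x_CI unif])
  have "limitin euclidean (g \<circ> E) (g x) sequentially"
    by (rule continuous_map_limit[OF g_cont lim])
  then have "(\<lambda>n. E n 0) \<longlonglongrightarrow> g x"
    by (simp add: o_def E(2))
  then show "x 0 = g x"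
    using conv[of 0] T_pos LIMSEQ_unique by auto
qed

text \<open>Both the retraction and the factor l rescale by positive numbers, so the inward
  inequality at the retracted state carries over to x itself; this fails for l = 0.\<close>

lemma homotopy_limit_norm_le:
  assumes "0 < l" and x: "x \<in> ACI T" "x 0 = g x" and N: "negligible N"
    and v: "\<And>t. t \<in> {0..T} - N \<Longrightarrow> v t \<in> F t (trunc \<rho> (x t))"
    and deriv: "\<And>t. t \<in> {0..T} - N \<Longrightarrow> (x has_vector_derivative l *\<^sub>R v t) (at t within {0..T})"
    and dom: "\<And>s t. \<lbrakk>0 \<le> s; s \<le> t; t \<le> T\<rbrakk> \<Longrightarrow> norm (x t - x s) \<le> integral {s..t} rate"
    and t: "t \<in> {0..T}"
  shows "norm (x t) \<le> R"
proof (rule inclusion_norm_le[OF growth_integrable rate_nonneg dom N deriv _ x t])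
  fix t assume t: "t \<in> {0..T} - N" "R \<le> norm (x t)"
  have "trunc \<rho> (x t) \<bullet> v t < 0"
    using t norm_trunc_ge[OF \<rho>_pos less_imp_le[OF R_less] t(2)] by (intro inward[OF _ _ v]) auto
  then have "x t \<bullet> v t < 0"
    by (rule inner_trunc_neg)
  then show "x t \<bullet> (l *\<^sub>R v t) < 0"
    using \<open>0 < l\<close> by (simp add: mult_pos_neg)
qed

lemma mem_solution_set:
  assumes x: "x \<in> ACI T" "x 0 = g x" and N: "negligible N"
    and v: "\<And>t. t \<in> {0..T} - N \<Longrightarrow> v t \<in> F t (trunc \<rho> (x t))"
    and deriv: "\<And>t. t \<in> {0..T} - N \<Longrightarrow> (x has_vector_derivative v t) (at t within {0..T})"
    and le: "\<And>t. t \<in> {0..T} \<Longrightarrow> norm (x t) \<le> R"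
  shows "x \<in> solution_set T F g"
proof -
  have "\<exists>w \<in> F t (x t). (x has_vector_derivative w) (at t within {0..T})" if "t \<in> {0..T} - N" for t
    using v[OF that] deriv[OF that] le[of t] that trunc_id[OF \<rho>_pos, of "x t"] R_less by auto
  then show ?thesis
    unfolding solution_set_def AE_lebesgue_on_Icc_iff using x N by blast
qed

lemma compactin_solution_set: "compactin (mtopology_of (CI T)) (solution_set T F g)"
  unfolding mtopology_of_def Metric_space.compactin_sequentially[OF Metric_space_mspace_mdist]
proof (intro conjI allI impI)
  show "solution_set T F g \<subseteq> mspace (CI T)"
    by (auto simp: solution_set_def ACI_def)
  fix \<sigma> :: "nat \<Rightarrow> real \<Rightarrow> real ^ 'n"
  assume "range \<sigma> \<subseteq> solution_set T F g"
  then have \<sigma>: "\<sigma> n \<in> solution_set T F g" for n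
    by blast
  have "\<exists>u N. negligible N \<and> (\<forall>t\<in>{0..T} - N. u t \<in> F t (\<sigma> n t)) \<and>
      (\<forall>t\<in>{0..T}. norm (u t) \<le> rate t \<and> norm (\<sigma> n t) \<le> R) \<and>
      (\<forall>s t. 0 \<le> s \<longrightarrow> s \<le> t \<longrightarrow> t \<le> T \<longrightarrow> (u has_integral (\<sigma> n t - \<sigma> n s)) {s..t})" for n
    by (rule solution_rate[OF \<sigma>[of n]]) blast
  then obtain u N where N: "\<And>n. negligible (N n)" "\<And>n t. t \<in> {0..T} - N n \<Longrightarrow> u n t \<in> F t (\<sigma> n t)"
    and bounds: "\<And>n t. t \<in> {0..T} \<Longrightarrow> norm (u n t) \<le> rate t \<and> norm (\<sigma> n t) \<le> R"
    and u: "\<And>n s t. \<lbrakk>0 \<le> s; s \<le> t; t \<le> T\<rbrakk> \<Longrightarrow> (u n has_integral (\<sigma> n t - \<sigma> n s)) {s..t}"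
    by metis
  obtain x0 k where "strict_mono (k :: nat \<Rightarrow> nat)" and unif0: "uniform_limit {0..T} (\<sigma> \<circ> k) x0 sequentially"
  proof (rule dominated_uniform_limit_subsequence[OF less_imp_le[OF T_pos] growth_integrable rate_nonneg])
    show "norm (\<sigma> n t - \<sigma> n s) \<le> integral {s..t} rate" if "0 \<le> s" "s \<le> t" "t \<le> T" for n s t
      by (rule increment_norm_le[OF u[OF that] growth_integrable]) (use bounds that in auto)
    show "norm (\<sigma> n 0) \<le> R" for n
      using bounds[of 0 n] T_pos by simp
  qed
  \<comment> \<open>Arzela-Ascoli determines the limit on \<open>{0..T}\<close> only; elements of
    \<open>CI T\<close> are \<open>undefined\<close> elsewhere.\<close>
  define x where "x = restrict x0 {0..T}"
  have unif: "uniform_limit {0..T} (\<sigma> \<circ> k) x sequentially"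
    using unif0 by (rule uniform_limit_cong'[THEN iffD1, rotated 2]) (auto simp: x_def)
  have x_lim: "(\<lambda>n. \<sigma> (k n) t) \<longlonglongrightarrow> x t" if "t \<in> {0..T}" for t
    using tendsto_uniform_limitI[OF unif that] by (simp add: o_def)
  have x_le: "norm (x t) \<le> R" if "t \<in> {0..T}" for t
    using bounds[OF that] by (intro Lim_norm_ubound[OF _ x_lim[OF that]]) auto
  obtain N0 where N0: "negligible N0" "\<And>t. t \<in> {0..T} - N0 \<Longrightarrow> usc_multimap (F t)"
    using F_usc by blast
  have near: "(\<lambda>n. infdist (u (k n) t) ((*\<^sub>R) 1 ` F t (trunc \<rho> (x t)))) \<longlonglongrightarrow> 0"
    if t: "t \<in> {0..T} - (N0 \<union> (\<Union>n. N n))" for t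
  proof -
    have trunc_x: "trunc \<rho> (x t) = x t"
      using x_le[of t] R_less t by (intro trunc_id \<rho>_pos) auto
    \<comment> \<open>Exact solutions are the case of one-point combinations with factor 1. The
      point equals its own target, so any positive null sequence serves as tolerance.\<close>
    have "(\<lambda>n. infdist (1 *\<^sub>R (\<Sum>y\<in>{\<sigma> (k n) t}. 1 *\<^sub>R u (k n) t)) ((*\<^sub>R) 1 ` F t (x t))) \<longlonglongrightarrow> 0"
    proof (rule usc_multimap_convex_combinations_limit)
      show "usc_multimap (F t)"
        using N0(2) t by blast
      show "convex (F t (x t))" "compact (F t (x t))" "F t (x t) \<noteq> {}"
        using F_values[of t "x t"] t by auto
      show "(\<lambda>n. \<sigma> (k n) t) \<longlonglongrightarrow> x t"
        using x_lim t by blast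
      show "(\<lambda>n. inverse (real (Suc n))) \<longlonglongrightarrow> 0"
        by (rule LIMSEQ_inverse_real_of_nat)
      show "u (k n) t \<in> F t y" if "y \<in> {\<sigma> (k n) t}" for n y
        using that N(2)[of t "k n"] t by auto
    qed auto
    then show ?thesis
      by (simp add: trunc_x)
  qed
  have \<sigma>_CI: "(\<sigma> \<circ> k) n \<in> mspace (CI T)" "(\<sigma> \<circ> k) n 0 = g ((\<sigma> \<circ> k) n)" for n
    using \<sigma>[of "k n"] by (auto simp: solution_set_def ACI_def)
  have u_k: "(u (k n) has_integral ((\<sigma> \<circ> k) n t - (\<sigma> \<circ> k) n s)) {s..t}" if "0 \<le> s" "s \<le> t" "t \<le> T" for n s t
    using u[OF that] by simp
  have u_bound: "norm (u (k n) t) \<le> rate t" if "t \<in> {0..T}" for n t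
    using bounds[OF that] by blast
  have x_ext: "x \<in> extensional {0..T}"
    by (simp add: x_def)
  have N_all: "negligible (N0 \<union> (\<Union>n. N n))"
    using N0(1) N(1) by (intro negligible_Un negligible_countable_Union) auto
  note limit = limit_inclusion[OF \<sigma>_CI u_k u_bound unif x_ext N_all near]
  obtain v N' where "negligible N'" "\<forall>t\<in>{0..T} - N'. v t \<in> F t (trunc \<rho> (x t)) \<and>
      (x has_vector_derivative 1 *\<^sub>R v t) (at t within {0..T})"
    using limit(4) by blast
  then have "x \<in> solution_set T F g"
    by (intro mem_solution_set[of x N' v] limit(1,2) x_le) auto
  then show "\<exists>l r. l \<in> solution_set T F g \<and> strict_mono r \<and>
      limitin (Metric_space.mtopology (mspace (CI T)) (mdist (CI T))) (\<sigma> \<circ> r) l sequentially"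
    using \<open>strict_mono k\<close> limit(3) unfolding mtopology_of_def by blast
qed

section \<open>Approximate solutions and existence\<close>

lemma selection_integrable:
  "(\<lambda>t. closest_point (F t y) 0) \<in> borel_measurable (lebesgue_on {0..T})"
  "norm y \<le> \<rho> \<Longrightarrow> (\<lambda>t. closest_point (F t y) 0) integrable_on {0..T}"
  "t \<in> {0..T} \<Longrightarrow> closest_point (F t y) 0 \<in> F t y"
proof -
  show mem: "closest_point (F t y) 0 \<in> F t y" if "t \<in> {0..T}" for t
    using F_values[OF that, of y] by (intro closest_point_in_set) (auto intro: compact_imp_closed)
  show meas: "(\<lambda>t. closest_point (F t y) 0) \<in> borel_measurable (lebesgue_on {0..T})"
  proof (rule closest_point_measurable)
    show "F t y \<noteq> {} \<and> convex (F t y) \<and> compact (F t y)" if "t \<in> space (lebesgue_on {0..T})" for t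
      using F_values[of t y] that by simp
    fix A :: "(real ^ 'n) set" assume "closed A"
    then have "{t \<in> {0..T}. F t y \<subseteq> A} \<in> sets lebesgue"
      using caratheodory unfolding caratheodory_map_def by blast
    then show "{t \<in> space (lebesgue_on {0..T}). F t y \<subseteq> A} \<in> sets (lebesgue_on {0..T})"
      by (subst sets_restrict_space_iff) auto
  qed
  show "(\<lambda>t. closest_point (F t y) 0) integrable_on {0..T}" if "norm y \<le> \<rho>"
    by (rule measurable_bounded_by_integrable_imp_integrable[OF meas growth_integrable])
      (use F_rate[OF _ mem that] in auto)
qed

text \<open>All that the limit argument needs to know about the construction, with partition and
  polygon hidden behind the quantifiers. One \<epsilon> bounds both the time lag of the polygon and
  the distance to the points where F is evaluated.\<close>

definition approx_velocity :: "real \<Rightarrow> real \<Rightarrow> (real \<Rightarrow> real ^ 'n) \<Rightarrow> real \<Rightarrow> real ^ 'n \<Rightarrow> bool" where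
  "approx_velocity \<epsilon> \<kappa> E t v \<longleftrightarrow> (\<exists>\<tau> Y c f. \<tau> \<in> {0..T} \<and> \<bar>t - \<tau>\<bar> < \<epsilon> \<and>
     finite Y \<and> (\<forall>y\<in>Y. 0 \<le> c y) \<and> (\<Sum>y\<in>Y. c y) = (1 :: real) \<and>
     (\<forall>y\<in>Y. c y \<noteq> 0 \<longrightarrow> dist y (trunc \<rho> (E \<tau>)) < \<epsilon>) \<and> (\<forall>y\<in>Y. f y \<in> F t y) \<and>
     v = \<kappa> *\<^sub>R (\<Sum>y\<in>Y. c y *\<^sub>R f y))"

text \<open>The disjunction is the outcome of the homotopy. The factor \<kappa> is positive for
  every \<epsilon> but without a lower bound, so the limit factor may still be 0.\<close>

definition approx_solution :: "real \<Rightarrow> real \<Rightarrow> (real \<Rightarrow> real ^ 'n) \<Rightarrow> (real \<Rightarrow> real ^ 'n) \<Rightarrow> bool" where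
  "approx_solution \<epsilon> \<kappa> E u \<longleftrightarrow> 0 < \<kappa> \<and> \<kappa> \<le> 1 \<and> E \<in> mspace (CI T) \<and> E 0 = g E \<and>
     norm (E 0) \<le> \<rho> \<and> (\<kappa> = 1 \<or> norm (E 0) = \<rho>) \<and>
     (\<forall>s t. 0 \<le> s \<longrightarrow> s \<le> t \<longrightarrow> t \<le> T \<longrightarrow> (u has_integral (E t - E s)) {s..t}) \<and>
     (\<forall>t\<in>{0..T}. norm (u t) \<le> rate t \<and> approx_velocity \<epsilon> \<kappa> E t (u t))"

lemma approx_solution_exists:
  assumes "\<epsilon> > 0"
  shows "\<exists>\<kappa> E u. approx_solution \<epsilon> \<kappa> E u"
proof -
  obtain Y and w :: "real ^ 'n \<Rightarrow> real ^ 'n \<Rightarrow> real" where Y: "finite Y" "Y \<subseteq> cball 0 \<rho>"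
    and w_cont: "\<And>y. y \<in> Y \<Longrightarrow> continuous_on (cball 0 \<rho>) (w y)" and w_nonneg: "\<And>x y. w y x \<ge> 0"
    and w_sum: "\<And>x. x \<in> cball 0 \<rho> \<Longrightarrow> (\<Sum>y\<in>Y. w y x) = 1" and w_near: "\<And>x y. w y x \<noteq> 0 \<Longrightarrow> dist y x < \<epsilon>"
    using compact_finite_partition_near[OF compact_cball assms, of 0 \<rho>] by blast
  define f where "f = (\<lambda>y t. closest_point (F t y) 0)"
  \<comment> \<open>Time \<sigma> runs both legs of the homotopy. Up to 1/2 the factor l is 0,
    curves are constant, and the prefactor \<open>min 1 (2 * \<sigma>)\<close> leads from 0 to
    g(i(y)); afterwards the prefactor is 1 and l grows from 0 to 1.\<close>
  define l where "l = (\<lambda>\<sigma>::real. max 0 (min 1 (2 * \<sigma> - 1)))"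
  define Q where "Q = (\<lambda>(p :: real \<times> (real ^ 'n)) s x. \<Sum>y\<in>Y. (l (fst p) * w y (trunc \<rho> x)) *\<^sub>R f y s)"
  define X where "X = (\<lambda>p. restrict (euler_curve (Q p) \<epsilon> (snd p)) {0..T})"
  have l: "0 \<le> l \<sigma>" "l \<sigma> \<le> 1" for \<sigma>
    by (auto simp: l_def)
  have Q_eq: "Q p s x = l (fst p) *\<^sub>R (\<Sum>y\<in>Y. w y (trunc \<rho> x) *\<^sub>R f y s)" for p s x
    by (simp add: Q_def scaleR_right.sum)
  have f_bound: "norm (f y s) \<le> rate s" if "y \<in> Y" "s \<in> {0..T}" for y s
    unfolding f_def using that Y(2) by (intro F_rate[OF _ selection_integrable(3)]) auto
  have Q_meas: "(\<lambda>s. Q p s x) \<in> borel_measurable (lebesgue_on {0..T})" for p x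
    unfolding Q_def f_def
    by (intro borel_measurable_sum borel_measurable_scaleR borel_measurable_const selection_integrable(1))
  have trunc_mem: "trunc \<rho> x \<in> cball 0 \<rho>" for x :: "real ^ 'n"
    using norm_trunc_le[OF \<rho>_pos] by simp
  have Q_bound: "norm (Q p s x) \<le> rate s" if s: "s \<in> {0..T}" for p s x
  proof -
    have "norm (\<Sum>y\<in>Y. w y (trunc \<rho> x) *\<^sub>R f y s) \<le> (\<Sum>y\<in>Y. w y (trunc \<rho> x) * rate s)"
      using f_bound s w_nonneg by (intro sum_norm_le) (auto intro: mult_left_mono)
    also have "\<dots> = rate s"
      using w_sum[OF trunc_mem] by (simp add: sum_distrib_right[symmetric])
    finally have "norm (Q p s x) \<le> l (fst p) * rate s"
      unfolding Q_eq using l(1)[of "fst p"] by (simp add: mult_left_mono)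
    also have "\<dots> \<le> 1 * rate s"
      by (intro mult_right_mono l rate_nonneg[OF s])
    finally show ?thesis by simp
  qed
  note euler = Q_meas Q_bound growth_integrable \<open>\<epsilon> > 0\<close>
  have incr: "(euler_rhs (Q p) \<epsilon> (snd p) has_integral (X p t - X p s)) {s..t}" if "0 \<le> s" "s \<le> t" "t \<le> T" for p s t
    using euler_curve_increment[where Q = "Q p" and ?x0.0 = "snd p", OF euler that] that by (simp add: X_def)
  have X_0: "X p 0 = snd p" for p
    using T_pos by (simp add: X_def euler_curve_def)
  have rhs_bound: "norm (euler_rhs (Q p) \<epsilon> (snd p) t) \<le> rate t" if "t \<in> {0..T}" for p t
    unfolding euler_rhs_def by (rule Q_bound[OF that])
  have X_CI: "X p \<in> mspace (CI T)" for p
  proof -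
    have "continuous_on {0..T} (X p)"
      by (rule dominated_continuous_on[OF growth_integrable])
        (rule increment_norm_le[OF incr growth_integrable rhs_bound]; assumption)
    then show ?thesis
      by (simp add: mem_CI_iff X_def)
  qed
  have "continuous_map euclidean (mtopology_of (CI T)) X"
  proof (rule continuous_map_into_CI[OF X_CI])
    fix p and e :: real assume "e > 0"
    have "\<forall>\<^sub>F p' in nhds p. \<forall>t\<in>{0..T}. norm (euler_curve (Q p') \<epsilon> (snd p') t - euler_curve (Q p) \<epsilon> (snd p) t) < e"
      unfolding Q_def
    proof (rule euler_curve_continuous_parameters)
      show "finite Y" "\<epsilon> > 0" "e > 0" "rate integrable_on {0..T}"
        by (fact Y(1), fact assms, fact \<open>e > 0\<close>, rule growth_integrable)
      show "norm (f y s) \<le> rate s" if "y \<in> Y" "s \<in> {0..T}" for y s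
        by (rule f_bound[OF that])
      show "continuous_on UNIV (snd :: real \<times> (real ^ 'n) \<Rightarrow> _)"
        by (intro continuous_intros)
      show "f y integrable_on {0..T}" if "y \<in> Y" for y
        unfolding f_def using that Y(2) by (intro selection_integrable(2)) auto
      show "continuous_on UNIV (\<lambda>(p :: real \<times> (real ^ 'n), x). l (fst p) * w y (trunc \<rho> x))" if "y \<in> Y" for y
      proof -
        have "continuous_on UNIV (\<lambda>q :: (real \<times> (real ^ 'n)) \<times> (real ^ 'n). trunc \<rho> (snd q))"
          by (intro continuous_on_compose2[OF continuous_on_trunc[OF \<rho>_pos]] continuous_intros) auto
        then have "continuous_on UNIV (\<lambda>q :: (real \<times> (real ^ 'n)) \<times> (real ^ 'n). w y (trunc \<rho> (snd q)))"
          by (rule continuous_on_compose2[OF w_cont[OF that]]) (use trunc_mem in blast)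
        then show ?thesis
          unfolding case_prod_unfold l_def by (intro continuous_intros)
      qed
      show "euler_rhs (\<lambda>s x. \<Sum>y\<in>Y. (l (fst p) * w y (trunc \<rho> x)) *\<^sub>R f y s) \<epsilon> (snd p) integrable_on {0..T}" for p
        using euler_rhs_integrable[where Q = "Q p" and ?x0.0 = "snd p", OF euler] by (simp add: Q_def)
    qed
    then show "\<forall>\<^sub>F p' in nhds p. \<forall>t\<in>{0..T}. norm (X p' t - X p t) < e"
      by (rule eventually_mono) (simp add: X_def)
  qed
  then have "continuous_map euclidean euclidean (g \<circ> X)"
    using g_cont by (rule continuous_map_compose)
  then have gX_cont: "continuous_on UNIV (\<lambda>p. g (X p))"
    by (simp add: o_def)
  obtain \<sigma> y where \<sigma>: "\<sigma> \<in> {0..1}" and y: "norm y \<le> \<rho>" "min 1 (2 * \<sigma>) *\<^sub>R g (X (\<sigma>, y)) = y" "\<sigma> = 1 \<or> norm y = \<rho>"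
  proof (rule homotopy_fixed_point[OF \<rho>_pos])
    show "continuous_on ({0..1} \<times> cball 0 \<rho>) (\<lambda>(\<sigma>, y). min 1 (2 * \<sigma>) *\<^sub>R g (X (\<sigma>, y)))"
      unfolding case_prod_unfold
      by (intro continuous_intros) (use gX_cont continuous_on_subset in auto)
  qed auto
  \<comment> \<open>On the first leg the fixed point lies on the sphere, and (ii) leaves only
    2\<sigma> = 1, where y would be a fixed point excluded by (iii).\<close>
  have "\<sigma> > 1 / 2"
  proof (rule ccontr)
    assume "\<not> \<sigma> > 1 / 2"
    then have "l \<sigma> = 0" and sphere: "norm y = \<rho>"
      using y(3) by (auto simp: l_def)
    then have "X (\<sigma>, y) = const_fun T y"
      by (auto simp: X_def const_fun_def euler_curve_def euler_rhs_def[abs_def] Q_eq)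
    then have y_eq: "(2 * \<sigma>) *\<^sub>R g (const_fun T y) = y"
      using y(2) \<open>\<not> \<sigma> > 1 / 2\<close> by simp
    then have "\<rho> = 2 * \<sigma> * norm (g (const_fun T y))"
      using sphere \<sigma> by (metis abs_of_nonneg atLeastAtMost_iff mult_nonneg_nonneg norm_scaleR zero_le_numeral)
    also have "\<dots> \<le> 2 * \<sigma> * \<rho>"
      using g_sphere[OF sphere] \<sigma> by (intro mult_left_mono) auto
    finally have "2 * \<sigma> = 1"
      using \<rho>_pos \<open>\<not> \<sigma> > 1 / 2\<close> by (simp add: field_simps)
    then show False
      using y_eq g_sphere[OF sphere] by simp
  qed
  then have l\<sigma>: "l \<sigma> \<in> {0<..1}" "\<sigma> = 1 \<Longrightarrow> l \<sigma> = 1"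
    by (auto simp: l_def)
  have fixed: "g (X (\<sigma>, y)) = y"
    using y(2) \<open>\<sigma> > 1 / 2\<close> by simp
  let ?E = "X (\<sigma>, y)" and ?u = "euler_rhs (Q (\<sigma>, y)) \<epsilon> y"
  have "approx_velocity \<epsilon> (l \<sigma>) ?E t (?u t)" if t: "t \<in> {0..T}" for t
  proof -
    define \<tau> where "\<tau> = real (nat \<lfloor>t / \<epsilon>\<rfloor>) * \<epsilon>"
    note eq = euler_rhs_eq(1)[where Q = "Q (\<sigma>, y)" and ?x0.0 = y, OF euler t, folded \<tau>_def]
      euler_rhs_eq(2,3)[where Q = "Q (\<sigma>, y)", OF euler t, folded \<tau>_def]
    show ?thesis
      unfolding approx_velocity_def
    proof (intro exI conjI ballI impI)
      show "\<tau> \<in> {0..T}" "\<bar>t - \<tau>\<bar> < \<epsilon>" using eq by blast+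
      show "finite Y" by (fact Y(1))
      show "0 \<le> w z (trunc \<rho> (?E \<tau>))" for z by (rule w_nonneg)
      show "(\<Sum>z\<in>Y. w z (trunc \<rho> (?E \<tau>))) = 1" by (rule w_sum[OF trunc_mem])
      show "dist z (trunc \<rho> (?E \<tau>)) < \<epsilon>" if "w z (trunc \<rho> (?E \<tau>)) \<noteq> 0" for z
        by (rule w_near[OF that])
      show "f z t \<in> F t z" for z
        unfolding f_def by (rule selection_integrable(3)[OF t])
      show "?u t = l \<sigma> *\<^sub>R (\<Sum>z\<in>Y. w z (trunc \<rho> (?E \<tau>)) *\<^sub>R f z t)"
        using eq(1,2) by (simp add: X_def Q_eq)
    qed
  qed
  moreover have "?E 0 = g ?E" "norm (?E 0) \<le> \<rho>" "l \<sigma> = 1 \<or> norm (?E 0) = \<rho>"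
    using X_0[of "(\<sigma>, y)"] fixed y l\<sigma>(2) by auto
  ultimately have "approx_solution \<epsilon> (l \<sigma>) ?E ?u"
    unfolding approx_solution_def
    using l\<sigma>(1) X_CI incr[of _ _ "(\<sigma>, y)"] rhs_bound[of _ "(\<sigma>, y)"] by simp
  then show ?thesis by blast
qed

lemma solution_set_nonempty: "solution_set T F g \<noteq> {}"
proof -
  have "\<exists>\<kappa> E u. approx_solution (inverse (real (Suc n))) \<kappa> E u" for n
    by (rule approx_solution_exists) simp
  then obtain \<kappa>0 E0 u0 where approx0: "\<And>n. approx_solution (inverse (real (Suc n))) (\<kappa>0 n) (E0 n) (u0 n)"
    by metis
  have "\<kappa>0 n \<in> {0..1}" for n
    using approx0[of n] by (simp add: approx_solution_def)
  then obtain l k1 where l: "l \<in> {0..1}" and k1: "strict_mono (k1 :: nat \<Rightarrow> nat)" "(\<kappa>0 \<circ> k1) \<longlonglongrightarrow> l"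
    using compact_imp_seq_compact[OF compact_Icc] unfolding seq_compact_def by metis
  obtain x0 k2 where k2: "strict_mono (k2 :: nat \<Rightarrow> nat)" and unif0: "uniform_limit {0..T} ((E0 \<circ> k1) \<circ> k2) x0 sequentially"
  proof (rule dominated_uniform_limit_subsequence[OF less_imp_le[OF T_pos] growth_integrable rate_nonneg])
    show "norm ((E0 \<circ> k1) n t - (E0 \<circ> k1) n s) \<le> integral {s..t} rate" if "0 \<le> s" "s \<le> t" "t \<le> T" for n s t
      by (rule increment_norm_le[where u = "u0 (k1 n)", OF _ growth_integrable])
        (use approx0[of "k1 n"] that in \<open>auto simp: approx_solution_def\<close>)
    show "norm ((E0 \<circ> k1) n 0) \<le> \<rho>" for n
      using approx0[of "k1 n"] unfolding approx_solution_def o_def by blast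
  qed
  define K where "K = k1 \<circ> k2"
  define \<kappa> where "\<kappa> = \<kappa>0 \<circ> K"
  define E where "E = E0 \<circ> K"
  define u where "u = u0 \<circ> K"
  define e where "e = (\<lambda>n. inverse (real (Suc (K n))))"
  have K: "strict_mono K"
    unfolding K_def using k1(1) k2 by (rule strict_mono_o)
  have e_lim: "e \<longlonglongrightarrow> 0"
    using LIMSEQ_subseq_LIMSEQ[OF LIMSEQ_inverse_real_of_nat K] by (simp add: e_def o_def)
  have \<kappa>_lim: "\<kappa> \<longlonglongrightarrow> l"
    using LIMSEQ_subseq_LIMSEQ[OF k1(2) k2] by (simp add: \<kappa>_def K_def o_assoc)
  have approx: "approx_solution (e n) (\<kappa> n) (E n) (u n)" for n
    using approx0[of "K n"] by (simp add: e_def \<kappa>_def E_def u_def)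
  have E: "E n \<in> mspace (CI T)" "E n 0 = g (E n)" for n
    using approx[of n] by (simp_all add: approx_solution_def)
  have u: "(u n has_integral (E n t - E n s)) {s..t}" if "0 \<le> s" "s \<le> t" "t \<le> T" for n s t
    using approx[of n] that by (simp add: approx_solution_def)
  have bound: "norm (u n t) \<le> rate t" if "t \<in> {0..T}" for n t
    using approx[of n] that by (simp add: approx_solution_def)
  have E_dom: "norm (E n t - E n s) \<le> integral {s..t} rate" if "0 \<le> s" "s \<le> t" "t \<le> T" for n s t
    by (rule increment_norm_le[OF u[OF that] growth_integrable bound]) (use that in auto)
  define x where "x = restrict x0 {0..T}"
  have x_ext: "x \<in> extensional {0..T}"
    by (simp add: x_def)
  have unif: "uniform_limit {0..T} E x sequentially"
  proof -
    have "uniform_limit {0..T} E x0 sequentially"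
      using unif0 by (simp add: E_def K_def o_assoc)
    then show ?thesis
      by (rule uniform_limit_cong'[THEN iffD1, rotated 2]) (auto simp: x_def)
  qed
  have x_lim: "(\<lambda>n. E n t) \<longlonglongrightarrow> x t" if "t \<in> {0..T}" for t
    using tendsto_uniform_limitI[OF unif that] .
  obtain N0 where N0: "negligible N0" "\<And>t. t \<in> {0..T} - N0 \<Longrightarrow> usc_multimap (F t)"
    using F_usc by blast
  have near: "(\<lambda>n. infdist (u n t) ((*\<^sub>R) l ` F t (trunc \<rho> (x t)))) \<longlonglongrightarrow> 0" if t: "t \<in> {0..T} - N0" for t
  proof -
    have "\<forall>n. \<exists>\<tau> Y c f. \<tau> \<in> {0..T} \<and> \<bar>t - \<tau>\<bar> < e n \<and>
        finite Y \<and> (\<forall>y\<in>Y. 0 \<le> c y) \<and> (\<Sum>y\<in>Y. c y) = (1 :: real) \<and>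
        (\<forall>y\<in>Y. c y \<noteq> 0 \<longrightarrow> dist y (trunc \<rho> (E n \<tau>)) < e n) \<and> (\<forall>y\<in>Y. f y \<in> F t y) \<and>
        u n t = \<kappa> n *\<^sub>R (\<Sum>y\<in>Y. c y *\<^sub>R f y)" (is "\<forall>n. \<exists>\<tau> Y c f. ?P n \<tau> Y c f")
      using approx t unfolding approx_solution_def approx_velocity_def by blast
    from choice[OF this] obtain \<tau> where "\<forall>n. \<exists>Y c f. ?P n (\<tau> n) Y c f" ..
    from choice[OF this] obtain Y where "\<forall>n. \<exists>c f. ?P n (\<tau> n) (Y n) c f" ..
    from choice[OF this] obtain c where "\<forall>n. \<exists>f. ?P n (\<tau> n) (Y n) (c n) f" ..
    from choice[OF this] obtain f where "\<forall>n. ?P n (\<tau> n) (Y n) (c n) (f n)" ..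
    then have \<tau>: "\<And>n. \<tau> n \<in> {0..T}" "\<And>n. \<bar>t - \<tau> n\<bar> < e n"
      and Y: "\<And>n. finite (Y n)" "\<And>n. \<forall>y\<in>Y n. 0 \<le> c n y" "\<And>n. (\<Sum>y\<in>Y n. c n y) = (1 :: real)"
        "\<And>n. \<forall>y\<in>Y n. c n y \<noteq> 0 \<longrightarrow> dist y (trunc \<rho> (E n (\<tau> n))) < e n"
        "\<And>n. \<forall>y\<in>Y n. f n y \<in> F t y"
      and u_eq: "\<And>n. u n t = \<kappa> n *\<^sub>R (\<Sum>y\<in>Y n. c n y *\<^sub>R f n y)"
      by simp_all
    \<comment> \<open>The sampling times tend to t, and equicontinuity, uniform in n, makes the lag
      disappear in the limit.\<close>
    have "(\<lambda>n. E n (\<tau> n) - E n t) \<longlonglongrightarrow> 0"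
    proof (rule LIMSEQ_I)
      fix \<epsilon> :: real assume "0 < \<epsilon>"
      obtain d where "d > 0" and d: "\<And>(x :: real \<Rightarrow> real ^ 'n) s t.
          \<lbrakk>\<And>s t. \<lbrakk>0 \<le> s; s \<le> t; t \<le> T\<rbrakk> \<Longrightarrow> norm (x t - x s) \<le> integral {s..t} rate;
            s \<in> {0..T}; t \<in> {0..T}; \<bar>s - t\<bar> < d\<rbrakk> \<Longrightarrow> norm (x s - x t) < \<epsilon>"
        using dominated_equicontinuous[OF growth_integrable \<open>0 < \<epsilon>\<close>, where 'a = "real ^ 'n"] by blast
      obtain n0 where n0: "\<And>n. n \<ge> n0 \<Longrightarrow> e n < d"
        using order_tendstoD(2)[OF e_lim \<open>d > 0\<close>] unfolding eventually_sequentially by blast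
      have "norm (E n (\<tau> n) - E n t) < \<epsilon>" if "n \<ge> n0" for n
        using n0[OF that] \<tau>(2)[of n] t by (intro d E_dom \<tau>(1)) auto
      then show "\<exists>n0. \<forall>n\<ge>n0. norm (E n (\<tau> n) - E n t - 0) < \<epsilon>"
        by auto
    qed
    from tendsto_add[OF this x_lim[of t]] have "(\<lambda>n. E n (\<tau> n)) \<longlonglongrightarrow> x t"
      using t by simp
    then have p_lim: "(\<lambda>n. trunc \<rho> (E n (\<tau> n))) \<longlonglongrightarrow> trunc \<rho> (x t)"
      by (rule continuous_on_tendsto_compose[OF continuous_on_trunc[OF \<rho>_pos]]) auto
    show ?thesis
      unfolding u_eq
    proof (rule usc_multimap_convex_combinations_limit[OF _ _ _ _ _ _ _ _ p_lim e_lim \<kappa>_lim])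
      show "usc_multimap (F t)"
        using N0(2) t by blast
      show "convex (F t (trunc \<rho> (x t)))" "compact (F t (trunc \<rho> (x t)))" "F t (trunc \<rho> (x t)) \<noteq> {}"
        using F_values[of t "trunc \<rho> (x t)"] t by auto
      show "\<kappa> n \<in> {0..1}" for n
        using approx[of n] by (simp add: approx_solution_def)
    qed (use Y in auto)
  qed
  note limit = limit_inclusion[OF E u bound unif x_ext N0(1) near]
  note x = limit(1,2)
  have dom: "norm (x t - x s) \<le> integral {s..t} rate" if "0 \<le> s" "s \<le> t" "t \<le> T" for s t
    by (rule limit_increment_norm_le[OF growth_integrable u bound x_lim that])
  obtain v N where N: "negligible N" and
    "\<forall>t\<in>{0..T} - N. v t \<in> F t (trunc \<rho> (x t)) \<and> (x has_vector_derivative l *\<^sub>R v t) (at t within {0..T})"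
    using limit(4) by blast
  then have v: "v t \<in> F t (trunc \<rho> (x t))"
    and deriv: "(x has_vector_derivative l *\<^sub>R v t) (at t within {0..T})" if "t \<in> {0..T} - N" for t
    using that by auto
  \<comment> \<open>The alternative may hold for different reasons at different n; written as a
    vanishing product it passes to the limit.\<close>
  have boundary: "l = 1 \<or> norm (x 0) = \<rho>"
  proof (rule ccontr)
    assume neg: "\<not> (l = 1 \<or> norm (x 0) = \<rho>)"
    have "(\<lambda>n. (1 - \<kappa> n) * (\<rho> - norm (E n 0))) \<longlonglongrightarrow> (1 - l) * (\<rho> - norm (x 0))"
      using T_pos by (intro tendsto_intros \<kappa>_lim x_lim) auto
    moreover have "(1 - \<kappa> n) * (\<rho> - norm (E n 0)) = 0" for n
      using approx[of n] by (auto simp: approx_solution_def)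
    ultimately have "(1 - l) * (\<rho> - norm (x 0)) = 0"
      by (simp add: LIMSEQ_const_iff)
    then show False
      using neg by auto
  qed
  \<comment> \<open>With l = 0 the limit has zero derivative almost everywhere and is constant. By
    \<open>boundary\<close> it starts on the sphere, and x(0) = g(x) then contradicts (iii).\<close>
  have "l \<noteq> 0"
  proof
    assume "l = 0"
    have const: "x t = x 0" if t: "t \<in> {0..T}" for t
    proof -
      have "((\<lambda>_. 0) has_integral (x t - x 0)) {0..t}"
      proof (rule abs_continuous_on_has_integral[OF _ _ N])
        show "abs_continuous_on {0..t} x"
          by (rule abs_continuous_on_dominated[OF integrable_on_subinterval[OF growth_integrable] rate_nonneg dom])
            (use t in auto)
        show "(x has_vector_derivative 0) (at s within {0..t})" if "s \<in> {0..t} - N" for s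
          using has_vector_derivative_within_subset[OF deriv, of s "{0..t}"] that t \<open>l = 0\<close> by auto
      qed (use t in auto)
      then show ?thesis
        using has_integral_unique[OF has_integral_0] by fastforce
    qed
    have "x = const_fun T (x 0)"
    proof (rule ext)
      fix s show "x s = const_fun T (x 0) s"
        using const[of s] extensional_arb[OF x_ext, of s] by (cases "s \<in> {0..T}") (simp_all only: const_fun_def restrict_apply if_True if_False not_False_eq_True)
    qed
    then show False
      using g_sphere[of "x 0"] boundary \<open>l = 0\<close> x(2) by auto
  qed
  then have "0 < l"
    using l by simp
  have le: "norm (x t) \<le> R" if "t \<in> {0..T}" for t
    by (rule homotopy_limit_norm_le[OF \<open>0 < l\<close> x N v deriv dom that])
  have "norm (x 0) \<le> R"
    by (rule le) (use T_pos in simp)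
  \<comment> \<open>The start lies in the ball of radius R < \<rho>, which rules out the sphere
    alternative.\<close>
  then have "l = 1"
    using boundary R_less by linarith
  then have "x \<in> solution_set T F g"
    using deriv by (intro mem_solution_set[OF x N v _ le]) auto
  then show ?thesis by blast
qed

end

theorem theorem8:
  fixes T R r :: real
    and F :: "real \<Rightarrow> real ^ 'n \<Rightarrow> (real ^ 'n) set"
    and V :: "real ^ 'n \<Rightarrow> real"
    and g :: "(real \<Rightarrow> real ^ 'n) \<Rightarrow> real ^ 'n"
  assumes T_pos: "T > 0"
    and F: "caratheodory_map T F"
    and V: "strictly_neg_guiding T V F" "monotone_potential V" "coercive V"
    and R_pos: "R > 0"
    and R_nonsing: "\<And>x. norm x \<ge> R \<Longrightarrow> grad V x \<noteq> 0"
    and R_guiding: "\<And>x t. norm x \<ge> R \<Longrightarrow> t \<in> {0..T} \<Longrightarrow> inner_plus (grad V x) (F t x) < 0"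
    and r: "r > Sup {V x | x. norm x \<le> R}"
    and g_cont: "continuous_map (mtopology_of (CI T)) euclidean g"
    and g_bdd: "\<And>B. Metric_space.mbounded (mspace (CI T)) (mdist (CI T)) B \<Longrightarrow> bounded (g ` B)"
    and i: "\<And>x. x \<in> ACI T \<Longrightarrow> x 0 = g x \<Longrightarrow> \<exists>t\<in>{0<..T}. norm (g x) \<le> norm (x t)"
    and ii: "\<And>x. x \<in> V -` {r} \<Longrightarrow> norm (g (const_fun T x)) \<le> norm x"
    and iii: "\<And>x. x \<in> V -` {r} \<Longrightarrow> g (const_fun T x) \<noteq> x"
  shows "solution_set T F g \<noteq> {} \<and> compactin (mtopology_of (CI T)) (solution_set T F g)"
proof -
  have C1: "V differentiable (at x)" for x
    using V(1) by (auto simp: strictly_neg_guiding_def C1_fun_def)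
  then have "continuous_on UNIV V"
    by (simp add: continuous_on_eq_continuous_at differentiable_imp_continuous_within)
  then obtain \<rho> where \<rho>: "R < \<rho>" "\<And>x. norm x = \<rho> \<Longrightarrow> V x = r"
    using coercive_monotone_level_sphere[OF _ V(2,3) less_imp_le[OF R_pos] r] by blast
  have inward: "x \<bullet> v < 0" if t: "t \<in> {0..T}" and x: "R \<le> norm x" and v: "v \<in> F t x" for t x v
  proof (rule monotone_potential_inner_neg[OF V(2) C1])
    show "x \<noteq> 0"
      using x R_pos by auto
    have "compact (F t x)"
      using F t by (auto simp: caratheodory_map_def)
    \<comment> \<open>Boundedness makes the supremum in \<open>inner_plus\<close> a genuine upper
      bound, so its sign passes to each v in F t x.\<close>
    then have "bdd_above ((\<lambda>b. grad V x \<bullet> b) ` F t x)"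
      by (intro bounded_imp_bdd_above compact_imp_bounded compact_continuous_image continuous_intros)
    then have "grad V x \<bullet> v \<le> inner_plus (grad V x) (F t x)"
      unfolding inner_plus_def using v by (rule cSUP_upper[rotated])
    then show "grad V x \<bullet> v < 0"
      using R_guiding[OF x t] by simp
  qed
  interpret guided_nonlocal_inclusion T R \<rho> F g
  proof
    show "norm (g (const_fun T x)) \<le> \<rho> \<and> g (const_fun T x) \<noteq> x" if "norm x = \<rho>" for x
      using ii[of x] iii[of x] \<rho>(2)[OF that] that by simp
  qed (fact T_pos R_pos \<rho>(1) F inward g_cont i)+
  show ?thesis
    using solution_set_nonempty compactin_solution_set by blast
qed

end
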